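(* Let $S\subset\mathbb{C}^m$ be an algebraic irreducible hypersurface with $S\cap(\mathbb{C}^* )^m\neq\emptyset$. The logarithmic Gauss map $\gamma_S:S\dashrightarrow\mathbb{P}^{m-1}$ is birational if and only if there exist a non defective and regular integer matrix $C\in\mathbb{Z}^{n\times m}$ of full rank $m$ (for some $n\ge m$) without zero rows, and a constant $\lambda\in(\mathbb{C}^* )^m$, such that $S=\lambda\cdot S_C$ (the image of $S_C$ under coordinatewise multiplication by $\lambda$). Moreover, in this case, for such $C$ and $\lambda$, the rational map $\lambda\cdot\psi_C:\mathbb{P}^{m-1}\dashrightarrow S$ is birational, and the logarithmic Gauss map $\gamma_S$ is its inverse.
   Context: Logarithmic Gauss map: for an irreducible hypersurface $S\subset\mathbb{C}^m$ meeting the torus $(\mathbb{C}^* )^m$, with irreducible equation $\Delta=0$, $\gamma_S:S\dashrightarrow\mathbb{P}^{m-1}$ is the rational map $\gamma_S(y)=\left(y_1\frac{\partial\Delta}{\partial y_1}(y):\cdots:y_m\frac{\partial\Delta}{\partial y_m}(y)\right)$, defined at smooth points $y$ of $S\cap(\mathbb{C}^* )^m$ (equivalently, it sends $y$ to the hyperplane $d(l_y^{-1})(T_yS)$ in the Lie algebra $\mathbb{C}^m$ of the torus, where $l_y$ is coordinatewise multiplication by $y$). Horn-Kapranov parametrization: let $C=(c_{i,k})\in\mathbb{Z}^{n\times m}$, $n\ge m$, with rows $C_1,\dots,C_n$, none of which is zero. $C$ is regular if $C_1+\cdots+C_n=0$. Put $l_i(u)=\langle C_i,u\rangle=\sum_{k=1}^m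 c_{i,k}u_k$. For regular $C$, the rational functions $y_k=\prod_{i=1}^n l_i(u)^{c_{i,k}}$, $k=1,\dots,m$, are homogeneous of degree $0$ in $u=(u_1,\dots,u_m)$, so they define a rational map $\psi_C:\mathbb{P}^{m-1}\dashrightarrow\mathbb{C}^m$, $u\mapsto(y_1,\dots,y_m)$. $S_C\subset\mathbb{C}^m$ denotes the Zariski closure of the image of $\psi_C$. $C$ is called defective if $\operatorname{codim}(S_C)>1$, and non defective otherwise (i.e. if $S_C$ is a hypersurface). $\lambda\cdot\psi_C$ is the coordinatewise product of the constant vector $\lambda$ and $\psi_C$. The $\gcd$ of the maximal minors of $C$ is not required to be $1$. *)

theory Defs
  imports "HOL-Analysis.Analysis" "HOL-Library.Poly_Mapping" "HOL-Library.Extended_Nat"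
    "HOL-Computational_Algebra.Factorial_Ring"
begin

section \<open>Polynomials in the coordinates of \<open>\<complex>\<^sup>m\<close>\<close>

text \<open>
  The index type \<open>'m\<close> plays the role of \<open>{1, ..., m}\<close>. A polynomial maps each monomial (given by
  its exponents) to its coefficient; \<^theory>\<open>HOL-Library.Poly_Mapping\<close> supplies the ring structure
  (convolution product).
\<close>

type_synonym 'm cpoly = "('m \<Rightarrow>\<^sub>0 nat) \<Rightarrow>\<^sub>0 complex"

definition peval :: "'m::finite cpoly \<Rightarrow> complex ^ 'm \<Rightarrow> complex" where
  "peval p y = (\<Sum>a\<in>Poly_Mapping.keys p.
     Poly_Mapping.lookup p a * (\<Prod>i\<in>UNIV. (y $ i) ^ Poly_Mapping.lookup a i))"

text \<open>
  Formal partial derivative. The truncated subtraction of exponents is harmless: it only occurs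
  with coefficient \<open>0\<close>.
\<close>

definition partial_deriv :: "'m::finite \<Rightarrow> 'm cpoly \<Rightarrow> 'm cpoly" where
  "partial_deriv i p = (\<Sum>a\<in>Poly_Mapping.keys p.
     Poly_Mapping.single (a - Poly_Mapping.single i 1)
       (of_nat (Poly_Mapping.lookup a i) * Poly_Mapping.lookup p a))"

definition homogeneous :: "nat \<Rightarrow> 'm::finite cpoly \<Rightarrow> bool" where
  "homogeneous d p \<longleftrightarrow>
     (\<forall>a\<in>Poly_Mapping.keys p. (\<Sum>i\<in>UNIV. Poly_Mapping.lookup a i) = d)"

lemma peval_homogeneous_scale:
  assumes "homogeneous d p"
  shows "peval p (c *s v) = c ^ d * peval p v"
proof -
  have "(\<Prod>i\<in>UNIV. ((c *s v) $ i) ^ Poly_Mapping.lookup a i) =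
      c ^ d * (\<Prod>i\<in>UNIV. (v $ i) ^ Poly_Mapping.lookup a i)"
    if "a \<in> Poly_Mapping.keys p" for a
  proof -
    have "(\<Prod>i\<in>UNIV. c ^ Poly_Mapping.lookup a i) = c ^ d"
      using that assms by (metis homogeneous_def power_sum)
    then show ?thesis
      by (simp add: power_mult_distrib prod.distrib)
  qed
  then show ?thesis
    by (simp add: peval_def sum_distrib_left mult.left_commute cong: sum.cong)
qed

definition hypersurface :: "'m::finite cpoly \<Rightarrow> (complex ^ 'm) set" where
  "hypersurface p = {y. peval p y = 0}"

definition torus :: "(complex ^ 'm::finite) set" where
  "torus = {y. \<forall>i. y $ i \<noteq> 0}"

section \<open>Projective space and the Zariski topologies\<close>

text \<open>
  A point of the projective space over the coordinates \<open>'m\<close> (of dimension \<open>CARD('m) - 1\<close>) is the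
  line through a nonzero vector.
\<close>

type_synonym 'm proj = "(complex ^ 'm) set"

definition proj_point :: "complex ^ 'm::finite \<Rightarrow> 'm proj" where
  "proj_point v = range (\<lambda>c. c *s v)"

definition proj_space :: "'m::finite proj set" where
  "proj_space = proj_point ` {v. v \<noteq> 0}"

text \<open>Both topologies are given by their bases of distinguished open sets.\<close>

definition zariski :: "(complex ^ 'm::finite) topology" where
  "zariski = topology_generated_by {{y. peval p y \<noteq> 0} | p. True}"

definition proj_zariski :: "'m::finite proj topology" where
  "proj_zariski = topology_generated_by
     {{L \<in> proj_space. \<forall>v\<in>L - {0}. peval p v \<noteq> 0} | p d. homogeneous d p}"

section \<open>Varieties, rational maps, birational maps\<close>

text \<open>
  A variety is recorded as a topological space together with the regular functions on its open
  sets; only the values on the open set matter. The parameter is any type of points, so that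
  affine and projective varieties are treated uniformly.
\<close>

record 'a variety =
  vtop :: "'a topology"
  regular_on :: "'a set \<Rightarrow> ('a \<Rightarrow> complex) set"

definition affine_variety :: "(complex ^ 'm::finite) set \<Rightarrow> (complex ^ 'm) variety" where
  "affine_variety S = \<lparr>
     vtop = subtopology zariski S,
     regular_on = (\<lambda>U. {f. \<forall>x\<in>U. \<exists>V g h.
       openin (subtopology zariski S) V \<and> x \<in> V \<and> V \<subseteq> U \<and>
       (\<forall>y\<in>V. peval h y \<noteq> 0 \<and> f y = peval g y / peval h y)})\<rparr>"

definition projective_space_variety :: "'m::finite proj variety" where
  "projective_space_variety = \<lparr>
     vtop = proj_zariski,
     regular_on = (\<lambda>U. {f. \<forall>x\<in>U. \<exists>V g h d.
       openin proj_zariski V \<and> x \<in> V \<and> V \<subseteq> U \<and> homogeneous d g \<and> homogeneous d h \<and>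
       (\<forall>L\<in>V. \<forall>v\<in>L - {0}. peval h v \<noteq> 0 \<and> f L = peval g v / peval h v)})\<rparr>"

text \<open>Morphism from the open subset \<open>U\<close> of \<open>X\<close> to \<open>Y\<close>.\<close>

definition morphism_on :: "'a variety \<Rightarrow> 'a set \<Rightarrow> 'b variety \<Rightarrow> ('a \<Rightarrow> 'b) \<Rightarrow> bool" where
  "morphism_on X U Y \<phi> \<longleftrightarrow>
     continuous_map (subtopology (vtop X) U) (vtop Y) \<phi> \<and>
     (\<forall>V f. openin (vtop Y) V \<and> f \<in> regular_on Y V \<longrightarrow> f \<circ> \<phi> \<in> regular_on X (U \<inter> \<phi> -` V))"

text \<open>
  A rational map between irreducible varieties is represented by a partial function whose domain
  is a nonempty open set. Two representatives are the same rational map if they agree on a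
  nonempty open set, so below two rational maps are inverse to each other if both composites are
  the identity on some nonempty open set.
\<close>

definition rational_map :: "'a variety \<Rightarrow> 'b variety \<Rightarrow> ('a \<rightharpoonup> 'b) \<Rightarrow> bool" where
  "rational_map X Y f \<longleftrightarrow>
     openin (vtop X) (dom f) \<and> dom f \<noteq> {} \<and> morphism_on X (dom f) Y (the \<circ> f)"

definition generically_identity :: "'a variety \<Rightarrow> ('a \<rightharpoonup> 'a) \<Rightarrow> bool" where
  "generically_identity X f \<longleftrightarrow>
     (\<exists>U. openin (vtop X) U \<and> U \<noteq> {} \<and> (\<forall>x\<in>U. f x = Some x))"

definition rational_inverse ::
  "'a variety \<Rightarrow> 'b variety \<Rightarrow> ('a \<rightharpoonup> 'b) \<Rightarrow> ('b \<rightharpoonup> 'a) \<Rightarrow> bool" where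
  "rational_inverse X Y f g \<longleftrightarrow>
     rational_map X Y f \<and> rational_map Y X g \<and>
     generically_identity X (g \<circ>\<^sub>m f) \<and> generically_identity Y (f \<circ>\<^sub>m g)"

definition birational :: "'a variety \<Rightarrow> 'b variety \<Rightarrow> ('a \<rightharpoonup> 'b) \<Rightarrow> bool" where
  "birational X Y f \<longleftrightarrow> (\<exists>g. rational_inverse X Y f g)"

section \<open>Codimension in \<open>\<complex>\<^sup>m\<close>\<close>

definition irreducible_closed :: "(complex ^ 'm::finite) set \<Rightarrow> bool" where
  "irreducible_closed Z \<longleftrightarrow> closedin zariski Z \<and> Z \<noteq> {} \<and>
     (\<forall>A B. closedin zariski A \<and> closedin zariski B \<and> Z \<subseteq> A \<union> B \<longrightarrow> Z \<subseteq> A \<or> Z \<subseteq> B)"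

text \<open>
  Codimension of a closed set: for irreducible \<open>Y\<close>, the supremum of the lengths of chains of
  irreducible closed sets going up from \<open>Y\<close>; in general, the infimum over the irreducible closed
  subsets.
\<close>

definition irreducible_codim :: "(complex ^ 'm::finite) set \<Rightarrow> enat" where
  "irreducible_codim Y = Sup {enat r | r. \<exists>W :: nat \<Rightarrow> (complex ^ 'm) set.
     W 0 = Y \<and> (\<forall>i\<le>r. irreducible_closed (W i)) \<and> (\<forall>i<r. W i \<subset> W (Suc i))}"

definition codim :: "(complex ^ 'm::finite) set \<Rightarrow> enat" where
  "codim Z = (INF Y\<in>{Y. irreducible_closed Y \<and> Y \<subseteq> Z}. irreducible_codim Y)"

section \<open>The logarithmic Gauss map\<close>

text \<open>
  Here \<open>\<Delta>\<close> is an irreducible equation of the hypersurface, so that the points where its gradient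
  does not vanish are the smooth points. On the torus, the vector below is nonzero at
  exactly these points.
\<close>

definition log_gauss :: "'m::finite cpoly \<Rightarrow> (complex ^ 'm \<rightharpoonup> 'm proj)" where
  "log_gauss \<Delta> y =
     (if y \<in> hypersurface \<Delta> \<inter> torus \<and> (\<exists>i. peval (partial_deriv i \<Delta>) y \<noteq> 0)
      then Some (proj_point (\<chi> i. y $ i * peval (partial_deriv i \<Delta>) y))
      else None)"

section \<open>The Horn-Kapranov parametrization\<close>

text \<open>
  An integer matrix with columns indexed by \<open>'m\<close> is the list of its rows, so that the number of
  rows can be quantified over.
\<close>

type_synonym 'm int_matrix = "(int ^ 'm) list"

definition row_form :: "int ^ 'm::finite \<Rightarrow> complex ^ 'm \<Rightarrow> complex" where
  "row_form c u = (\<Sum>k\<in>UNIV. of_int (c $ k) * u $ k)"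

definition regular_matrix :: "'m::finite int_matrix \<Rightarrow> bool" where
  "regular_matrix C \<longleftrightarrow> sum_list C = 0"

definition matrix_rank :: "'m::finite int_matrix \<Rightarrow> nat" where
  "matrix_rank C = vec.dim ((\<lambda>c. (\<chi> k. of_int (c $ k)) :: rat ^ 'm) ` set C)"

definition horn_kapranov_vec :: "'m::finite int_matrix \<Rightarrow> complex ^ 'm \<Rightarrow> complex ^ 'm" where
  "horn_kapranov_vec C u = (\<chi> k. \<Prod>i<length C. row_form (C ! i) u powi ((C ! i) $ k))"

text \<open>
  The map \<open>\<psi>\<^sub>C\<close>, on the complement of the hyperplanes \<open>l\<^sub>i = 0\<close>, where all the products make sense as
  written. For regular \<open>C\<close> the choice of the representative \<open>u\<close> does not matter, see below.
\<close>

definition horn_kapranov :: "'m::finite int_matrix \<Rightarrow> ('m proj \<rightharpoonup> complex ^ 'm)" where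
  "horn_kapranov C L =
     (if L \<in> proj_space \<and> (\<forall>u\<in>L - {0}. \<forall>c\<in>set C. row_form c u \<noteq> 0)
      then Some (horn_kapranov_vec C (SOME u. u \<in> L - {0}))
      else None)"

definition horn_kapranov_variety :: "'m::finite int_matrix \<Rightarrow> (complex ^ 'm) set" where
  "horn_kapranov_variety C = zariski closure_of ran (horn_kapranov C)"

definition defective :: "'m::finite int_matrix \<Rightarrow> bool" where
  "defective C \<longleftrightarrow> codim (horn_kapranov_variety C) > 1"

text \<open>
  The product of vectors \<open>\<lambda> * y\<close> is the coordinatewise one.
\<close>

definition scaled_horn_kapranov ::
  "complex ^ 'm::finite \<Rightarrow> 'm int_matrix \<Rightarrow> ('m proj \<rightharpoonup> complex ^ 'm)" where
  "scaled_horn_kapranov l C = (\<lambda>L. map_option (\<lambda>y. l * y) (horn_kapranov C L))"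

text \<open>The conditions on \<open>(C, \<lambda>)\<close> relative to a hypersurface \<open>S\<close>.\<close>

definition horn_kapranov_presentation ::
  "(complex ^ 'm::finite) set \<Rightarrow> 'm int_matrix \<Rightarrow> complex ^ 'm \<Rightarrow> bool" where
  "horn_kapranov_presentation S C l \<longleftrightarrow>
     length C \<ge> CARD('m) \<and> matrix_rank C = CARD('m) \<and> 0 \<notin> set C \<and>
     regular_matrix C \<and> \<not> defective C \<and> l \<in> torus \<and>
     S = (\<lambda>y. l * y) ` horn_kapranov_variety C"

lemma row_form_scale: "row_form c (t *s u) = t * row_form c u"
  by (simp add: row_form_def sum_distrib_left mult.left_commute)

lemma horn_kapranov_vec_scale:
  assumes "regular_matrix C" "t \<noteq> 0"
  shows "horn_kapranov_vec C (t *s u) = horn_kapranov_vec C u"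
proof -
  have prod_powi: "(\<Prod>i<n. t powi (e i)) = t powi (\<Sum>i<n. e i)" for n :: nat and e :: "nat \<Rightarrow> int"
    by (induction n) (use assms(2) in \<open>simp_all add: power_int_add\<close>)
  have "(\<Sum>i<length C. (C ! i) $ k) = 0" for k
  proof -
    have "(\<Sum>i<length C. C ! i) = 0"
      using assms(1) by (simp add: regular_matrix_def sum_list_sum_nth atLeast0LessThan)
    then show ?thesis by (metis sum_component zero_index)
  qed
  then have "(\<Prod>i<length C. t powi ((C ! i) $ k)) = 1" for k
    by (simp add: prod_powi)
  then show ?thesis
    by (simp add: horn_kapranov_vec_def row_form_scale power_int_mult_distrib prod.distrib)
qed

lemma horn_kapranov_proj_point:
  assumes "regular_matrix C" "u \<noteq> 0" "\<forall>c\<in>set C. row_form c u \<noteq> 0"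
  shows "horn_kapranov C (proj_point u) = Some (horn_kapranov_vec C u)"
proof -
  have "u \<in> proj_point u - {0}"
    using assms(2) by (auto simp: proj_point_def intro!: image_eqI[where x = 1])
  then have "(SOME w. w \<in> proj_point u - {0}) \<in> proj_point u - {0}"
    by (rule someI)
  then obtain t where "t \<noteq> 0" "(SOME w. w \<in> proj_point u - {0}) = t *s u"
    by (auto simp: proj_point_def)
  moreover have "proj_point u \<in> proj_space"
    using assms(2) by (auto simp: proj_space_def)
  moreover have "\<forall>w\<in>proj_point u - {0}. \<forall>c\<in>set C. row_form c w \<noteq> 0"
    using assms(3) by (auto simp: proj_point_def row_form_scale)
  ultimately show ?thesis
    using assms(1) by (simp add: horn_kapranov_def horn_kapranov_vec_scale)
qed

end

theory Submission
  imports Defs "HOL-Computational_Algebra.Fundamental_Theorem_Algebra"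
begin

text \<open>
  The logarithmic derivatives of \<open>\<psi>\<^sub>C\<close> form the matrix \<open>M(u) = (\<Sum>\<^sub>i c\<^sub>i\<^sub>k c\<^sub>i\<^sub>j / l\<^sub>i(u))\<close>, which is symmetric and, for
  regular \<open>C\<close>, annihilates \<open>u\<close>. The logarithmic gradient of \<open>\<Delta>\<close> at \<open>\<lambda> \<psi>\<^sub>C(u)\<close> annihilates \<open>M(u)\<close> from the left, hence
  also from the right. Because \<open>S\<^sub>C\<close> is a hypersurface, a count of algebraically independent functions shows that
  the kernel of \<open>M(u)\<close> is generically a line, so the gradient is proportional to \<open>u\<close>: \<open>\<gamma>\<^sub>S\<close> is a left inverse of
  \<open>\<lambda> \<psi>\<^sub>C\<close>. That it is also a right inverse is a closed condition which holds on a dense subset of \<open>S\<close>.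

  Conversely, a rational inverse \<open>\<Phi>\<close> of \<open>\<gamma>\<^sub>S\<close> satisfies \<open>\<Sum>\<^sub>k v\<^sub>k d\<Phi>\<^sub>k/\<Phi>\<^sub>k = 0\<close>. In terms of the irreducible factors \<open>F\<close> of the
  \<open>\<Phi>\<^sub>k\<close> this reads \<open>\<Sum>\<^sub>F l\<^sub>F dF/F = 0\<close> with linear forms \<open>l\<^sub>F\<close> over \<open>\<int>\<close>; hence \<open>F\<close> divides \<open>l\<^sub>F\<close>, the \<open>\<Phi>\<^sub>k\<close> are products of powers of
  linear forms, and the equation becomes \<open>\<Sum>\<^sub>F l\<^sub>F = 0\<close>, which is regularity.
\<close>

section \<open>Polynomials in several variables\<close>

text \<open>Three facts about \<open>\<Delta>\<close> and its zero set S are used throughout: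
  \<open>\<Delta>\<close> is prime, it divides every polynomial that vanishes on S, and a nonzero
  polynomial free of a variable of \<open>\<Delta>\<close> does not vanish on all of S. They rest on
  Gauss' lemma, and they turn density arguments on S into divisibility arguments. In the direction
  from C to the Gauss map, the obstacle is that being a hypersurface is a statement about
  polynomials, while the kernel of M(u) is about derivatives. The bridge is that each
  \<open>u_i\<close> is algebraic over the coordinates of \<open>\<psi>_C\<close> together with a
  single \<open>u_j\<close>. As \<open>\<psi>_C\<close> has degree 0, this \<open>u_j\<close>
  accounts for the scaling direction, and characteristic 0 makes a minimal equation for
  \<open>u_i\<close> separable. In the converse, rank m and the number of rows are not derived from
  a dimension count: rows \<open>e_j\<close> and \<open>- e_j\<close> are appended, which multiplies
  \<open>\<psi>_C\<close> by a constant that is absorbed in \<open>\<lambda>\<close>.\<close>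

abbreviation "pkeys \<equiv> Poly_Mapping.keys"
abbreviation "plookup \<equiv> Poly_Mapping.lookup"
abbreviation "psingle \<equiv> Poly_Mapping.single"

definition monomial_value :: "('m::finite \<Rightarrow>\<^sub>0 nat) \<Rightarrow> complex ^ 'm \<Rightarrow> complex" where
  "monomial_value a y = (\<Prod>i\<in>UNIV. (y $ i) ^ plookup a i)"

definition const_poly :: "complex \<Rightarrow> 'm::finite cpoly" where
  "const_poly c = psingle 0 c"

definition var_poly :: "'m::finite \<Rightarrow> 'm cpoly" where
  "var_poly i = psingle (psingle i 1) 1"

lemma peval_superset:
  assumes "finite A" "pkeys p \<subseteq> A"
  shows "peval p y = (\<Sum>a\<in>A. plookup p a * monomial_value a y)"
  unfolding peval_def monomial_value_def using assms
  by (intro sum.mono_neutral_left) (auto simp: in_keys_iff)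

lemma peval_add [simp]: "peval (p + q) y = peval p y + peval q y"
proof -
  let ?A = "pkeys p \<union> pkeys q"
  have "peval (p + q) y = (\<Sum>a\<in>?A. plookup (p + q) a * monomial_value a y)"
    by (rule peval_superset) (simp_all add: keys_add)
  moreover have "peval p y = (\<Sum>a\<in>?A. plookup p a * monomial_value a y)"
    "peval q y = (\<Sum>a\<in>?A. plookup q a * monomial_value a y)"
    by (rule peval_superset; simp)+
  ultimately show ?thesis
    by (simp add: lookup_add algebra_simps sum.distrib)
qed

lemma peval_zero [simp]: "peval 0 y = 0"
  by (simp add: peval_def)

lemma peval_sum [simp]: "peval (\<Sum>a\<in>A. f a) y = (\<Sum>a\<in>A. peval (f a) y)"
  by (induction A rule: infinite_finite_induct) auto

lemma peval_uminus [simp]: "peval (- p) y = - peval p y"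
  using peval_add[of p "- p" y] by (simp add: eq_neg_iff_add_eq_0 add.commute)

lemma peval_diff [simp]: "peval (p - q) y = peval p y - peval q y"
  using peval_add[of p "- q" y] by simp

lemma peval_single [simp]: "peval (psingle a c) y = c * monomial_value a y"
  by (simp add: peval_def monomial_value_def)

lemma monomial_value_add: "monomial_value (a + b) y = monomial_value a y * monomial_value b y"
  by (simp add: monomial_value_def lookup_add power_add prod.distrib)

lemma monomial_value_zero [simp]: "monomial_value 0 y = 1"
  by (simp add: monomial_value_def)

lemma monomial_value_single [simp]: "monomial_value (psingle i n) y = (y $ i) ^ n"
proof -
  have "monomial_value (psingle i n) y =
      (\<Prod>j\<in>UNIV. if j = i then (y $ j) ^ n else 1)"
    unfolding monomial_value_def by (intro prod.cong) (auto simp: lookup_single when_def)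
  then show ?thesis by simp
qed

lemma sum_single_keys: "(\<Sum>a\<in>pkeys p. psingle a (plookup p a)) = p"
proof (rule poly_mapping_eqI)
  fix k
  have "plookup (\<Sum>a\<in>pkeys p. psingle a (plookup p a)) k =
      (\<Sum>a\<in>pkeys p. if a = k then plookup p k else 0)"
    by (auto simp: lookup_sum lookup_single when_def intro!: sum.cong)
  then show "plookup (\<Sum>a\<in>pkeys p. psingle a (plookup p a)) k = plookup p k"
    by (simp add: in_keys_iff)
qed

lemma peval_mult [simp]: "peval (p * q) y = peval p y * peval q y"
proof -
  have "p * q = (\<Sum>a\<in>pkeys p. \<Sum>b\<in>pkeys q.
      psingle (a + b) (plookup p a * plookup q b))"
    (is "_ = ?rhs")
  proof -
    have "?rhs = (\<Sum>a\<in>pkeys p. psingle a (plookup p a)) *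
        (\<Sum>b\<in>pkeys q. psingle b (plookup q b))"
      unfolding sum_product by (simp only: mult_single)
    then show ?thesis by (simp only: sum_single_keys)
  qed
  then have "peval (p * q) y = (\<Sum>a\<in>pkeys p. \<Sum>b\<in>pkeys q.
      (plookup p a * monomial_value a y) * (plookup q b * monomial_value b y))"
    by (simp add: monomial_value_add mult_ac)
  then show ?thesis
    by (simp add: peval_superset[OF finite_keys order_refl] sum_product)
qed

lemma peval_one [simp]: "peval 1 y = 1"
  using peval_single[of 0 1 y] by simp

lemma peval_power [simp]: "peval (p ^ n) y = peval p y ^ n"
  by (induction n) auto

lemma peval_prod [simp]: "peval (\<Prod>a\<in>A. f a) y = (\<Prod>a\<in>A. peval (f a) y)"
  by (induction A rule: infinite_finite_induct) auto

lemma peval_const [simp]: "peval (const_poly c) y = c"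
  by (simp add: const_poly_def)

lemma peval_var [simp]: "peval (var_poly i) y = y $ i"
  by (simp add: var_poly_def)

subsection \<open>Polynomial functions\<close>

definition polyfun :: "(complex ^ 'm::finite \<Rightarrow> complex) \<Rightarrow> bool" where
  "polyfun f \<longleftrightarrow> (\<exists>p. \<forall>y. peval p y = f y)"

lemma polyfun_peval [intro, simp]: "polyfun (peval p)"
  by (auto simp: polyfun_def)

lemma polyfun_const [intro, simp]: "polyfun (\<lambda>y. c)"
  unfolding polyfun_def by (rule exI[of _ "const_poly c"]) simp

lemma polyfun_nth [intro, simp]: "polyfun (\<lambda>y. y $ i)"
  unfolding polyfun_def by (rule exI[of _ "var_poly i"]) simp

lemma polyfun_add [intro]: "polyfun f \<Longrightarrow> polyfun g \<Longrightarrow> polyfun (\<lambda>y. f y + g y)"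
  unfolding polyfun_def by (elim exE, rename_tac p q, rule_tac x = "p + q" in exI) simp

lemma polyfun_mult [intro]: "polyfun f \<Longrightarrow> polyfun g \<Longrightarrow> polyfun (\<lambda>y. f y * g y)"
  unfolding polyfun_def by (elim exE, rename_tac p q, rule_tac x = "p * q" in exI) simp

lemma polyfun_power [intro]: "polyfun f \<Longrightarrow> polyfun (\<lambda>y. f y ^ n)"
  unfolding polyfun_def by (elim exE, rename_tac p, rule_tac x = "p ^ n" in exI) simp

lemma polyfun_sum [intro]: "(\<And>a. a \<in> A \<Longrightarrow> polyfun (f a)) \<Longrightarrow> polyfun (\<lambda>y. \<Sum>a\<in>A. f a y)"
  by (induction A rule: infinite_finite_induct) auto

lemma polyfun_prod [intro]: "(\<And>a. a \<in> A \<Longrightarrow> polyfun (f a)) \<Longrightarrow> polyfun (\<lambda>y. \<Prod>a\<in>A. f a y)"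
  by (induction A rule: infinite_finite_induct) auto

lemma polyfun_compose:
  assumes "\<And>i. polyfun (\<lambda>y. f y $ i)"
  shows "polyfun (\<lambda>y. peval p (f y))"
  unfolding peval_def using assms by (intro polyfun_sum polyfun_mult polyfun_prod polyfun_power) auto

lemma polyfun_rescale: "\<exists>f'. \<forall>z. peval f' z = peval f (c * z)"
proof -
  have "polyfun (\<lambda>z. peval f (c * z))" by (rule polyfun_compose) auto
  then show ?thesis by (simp add: polyfun_def)
qed

lemma polyfun_on_line:
  "\<exists>P. \<forall>t. poly P t = peval p (a + t *s b)"
proof -
  define P where "P = (\<Sum>k\<in>pkeys p. [:plookup p k:] * (\<Prod>i\<in>UNIV. [:a $ i, b $ i:] ^ plookup k i))"
  have "poly P t = peval p (a + t *s b)" for t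
    by (simp add: P_def peval_def poly_sum poly_prod)
  then show ?thesis by blast
qed

subsection \<open>Expansion in one variable\<close>

text \<open>The ring is kept: the coefficient of \<open>x ^ j\<close> is again a polynomial in all
  variables, with x absent, so that inductions on the number of variables need no change of
  type.\<close>

definition coeff_in :: "'m::finite \<Rightarrow> nat \<Rightarrow> 'm cpoly \<Rightarrow> 'm cpoly" where
  "coeff_in x j p = (\<Sum>a\<in>{a\<in>pkeys p. plookup a x = j}.
     psingle (a - psingle x j) (plookup p a))"

definition degree_in :: "'m::finite \<Rightarrow> 'm cpoly \<Rightarrow> nat" where
  "degree_in x p = Max (insert 0 ((\<lambda>a. plookup a x) ` pkeys p))"

definition lead_in :: "'m::finite \<Rightarrow> 'm cpoly \<Rightarrow> 'm cpoly" where
  "lead_in x p = coeff_in x (degree_in x p) p"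

lemma degree_in_le_iff: "degree_in x p \<le> n \<longleftrightarrow> (\<forall>a\<in>pkeys p. plookup a x \<le> n)"
  by (auto simp: degree_in_def)

lemma degree_in_zero [simp]: "degree_in x 0 = 0"
  by (simp add: degree_in_def)

lemma diff_single_add_cancel:
  fixes a :: "'m \<Rightarrow>\<^sub>0 nat"
  shows "a - psingle x (plookup a x) + psingle x (plookup a x) = a"
  by (rule poly_mapping_eqI) (simp add: lookup_add lookup_minus lookup_single when_def)

lemma lookup_coeff_in:
  "plookup (coeff_in x j p) b =
     (if plookup b x = 0 then plookup p (b + psingle x j) else 0)"
proof -
  let ?A = "{a\<in>pkeys p. plookup a x = j}"
  have "a - psingle x j = b \<longleftrightarrow> plookup b x = 0 \<and> a = b + psingle x j"
    if "a \<in> ?A" for a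
  proof -
    have "a - psingle x j + psingle x j = a"
      using that diff_single_add_cancel[of a x] by auto
    moreover have "plookup (a - psingle x j) x = 0"
      using that by (simp add: lookup_minus)
    ultimately show ?thesis by (metis add_diff_cancel_right')
  qed
  then have "plookup (coeff_in x j p) b =
      (\<Sum>a\<in>?A. if a = b + psingle x j then
         (if plookup b x = 0 then plookup p (b + psingle x j) else 0) else 0)"
    unfolding coeff_in_def lookup_sum
    by (intro sum.cong) (auto simp: lookup_single when_def)
  also have "\<dots> = (if plookup b x = 0 then plookup p (b + psingle x j) else 0)"
    by (simp add: in_keys_iff lookup_add)
  finally show ?thesis .
qed

lemma keys_coeff_in: "a \<in> pkeys (coeff_in x j p) \<longleftrightarrow>
    plookup a x = 0 \<and> a + psingle x j \<in> pkeys p"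
  by (auto simp: in_keys_iff lookup_coeff_in)

lemma degree_in_coeff_in [simp]: "degree_in x (coeff_in x j p) = 0"
proof -
  have "degree_in x (coeff_in x j p) \<le> 0"
    unfolding degree_in_le_iff by (simp add: keys_coeff_in)
  then show ?thesis by simp
qed

lemma coeff_in_expansion: "p = (\<Sum>j\<le>degree_in x p. coeff_in x j p * var_poly x ^ j)"
proof -
  have var: "var_poly x ^ j = psingle (psingle x j) 1" for j
    by (induction j) (simp_all add: var_poly_def mult_single flip: single_add)
  have "(\<Sum>j\<le>degree_in x p. coeff_in x j p * var_poly x ^ j) =
      (\<Sum>j\<le>degree_in x p. \<Sum>a\<in>{a\<in>pkeys p. plookup a x = j}. psingle a (plookup p a))"
    by (auto simp: coeff_in_def sum_distrib_right var mult_single diff_single_add_cancel intro!: sum.cong)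
  also have "\<dots> = (\<Sum>a\<in>pkeys p. psingle a (plookup p a))"
    using degree_in_le_iff[of x p "degree_in x p"]
    by (intro sum.group) auto
  finally show ?thesis by (simp add: sum_single_keys)
qed

lemma degree_in_attained:
  assumes "p \<noteq> 0" obtains a where "a \<in> pkeys p" "plookup a x = degree_in x p"
proof -
  have "degree_in x p \<in> insert 0 ((\<lambda>a. plookup a x) ` pkeys p)"
    unfolding degree_in_def by (intro Max_in) auto
  moreover obtain b where "b \<in> pkeys p" using assms keys_eq_empty by blast
  moreover have "plookup b x \<le> degree_in x p"
    using degree_in_le_iff[of x p] \<open>b \<in> pkeys p\<close> by blast
  ultimately show ?thesis using that by auto
qed

lemma lead_in_nonzero: assumes "p \<noteq> 0" shows "lead_in x p \<noteq> 0"
proof -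
  obtain a where a: "a \<in> pkeys p" "plookup a x = degree_in x p"
    using degree_in_attained[OF assms] .
  have "a - psingle x (degree_in x p) + psingle x (degree_in x p) = a"
    using a diff_single_add_cancel[of a x] by simp
  then have "a - psingle x (degree_in x p) \<in> pkeys (lead_in x p)"
    using a by (simp add: lead_in_def keys_coeff_in lookup_minus)
  then show ?thesis by auto
qed

section \<open>Polynomials in a given set of variables\<close>

definition vars_in :: "'m::finite set \<Rightarrow> 'm cpoly set" where
  "vars_in V = {p. \<forall>x. x \<notin> V \<longrightarrow> degree_in x p = 0}"

lemma vars_in_alt: "p \<in> vars_in V \<longleftrightarrow> (\<forall>a\<in>pkeys p. \<forall>x. x \<notin> V \<longrightarrow> plookup a x = 0)"
proof -
  have "degree_in x p = 0 \<longleftrightarrow> (\<forall>a\<in>pkeys p. plookup a x = 0)" for x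
    using degree_in_le_iff[of x p 0] by simp
  then show ?thesis by (auto simp: vars_in_def)
qed

lemma degree_in_add_le: "degree_in x p \<le> n \<Longrightarrow> degree_in x q \<le> n \<Longrightarrow> degree_in x (p + q) \<le> n"
  using keys_add[of p q] unfolding degree_in_le_iff by blast

lemma degree_in_mult_le: "degree_in x (p * q) \<le> degree_in x p + degree_in x q"
  unfolding degree_in_le_iff
proof
  fix a assume "a \<in> pkeys (p * q)"
  then obtain b c where "a = b + c" "b \<in> pkeys p" "c \<in> pkeys q"
    using keys_mult by blast
  then show "plookup a x \<le> degree_in x p + degree_in x q"
    using degree_in_le_iff[of x p] degree_in_le_iff[of x q]
    by (auto simp: lookup_add intro!: add_mono)
qed

lemma keys_uminus: "pkeys (- p) = pkeys (p :: 'm::finite cpoly)"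
  by (intro set_eqI) (simp add: in_keys_iff)

lemma degree_in_uminus [simp]: "degree_in x (- p) = degree_in x p"
  unfolding degree_in_def by (subst keys_uminus) (rule refl)

lemma degree_in_const [simp]: "degree_in x (const_poly c) = 0"
  by (simp add: const_poly_def degree_in_def)

lemma degree_in_one [simp]: "degree_in x 1 = 0"
  by (simp add: degree_in_def)

lemma degree_in_var: "degree_in x (var_poly y) = (if x = y then 1 else 0)"
  by (simp add: degree_in_def var_poly_def lookup_single)

lemma vars_in_UNIV [simp]: "p \<in> vars_in UNIV"
  by (simp add: vars_in_def)

lemma vars_in_mono: "p \<in> vars_in V \<Longrightarrow> V \<subseteq> W \<Longrightarrow> p \<in> vars_in W"
  by (auto simp: vars_in_def)

lemma vars_in_add: "p \<in> vars_in V \<Longrightarrow> q \<in> vars_in V \<Longrightarrow> p + q \<in> vars_in V"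
  unfolding vars_in_def using degree_in_add_le[of _ p 0 q] by simp

lemma vars_in_uminus: "p \<in> vars_in V \<Longrightarrow> - p \<in> vars_in V"
  by (simp add: vars_in_def)

lemma vars_in_diff: "p \<in> vars_in V \<Longrightarrow> q \<in> vars_in V \<Longrightarrow> p - q \<in> vars_in V"
  using vars_in_add[of p V "- q"] vars_in_uminus[of q V] by simp

lemma vars_in_mult: "p \<in> vars_in V \<Longrightarrow> q \<in> vars_in V \<Longrightarrow> p * q \<in> vars_in V"
  unfolding vars_in_def mem_Collect_eq
proof (intro allI impI)
  fix x assume "\<forall>x. x \<notin> V \<longrightarrow> degree_in x p = 0" "\<forall>x. x \<notin> V \<longrightarrow> degree_in x q = 0" "x \<notin> V"
  then show "degree_in x (p * q) = 0" using degree_in_mult_le[of x p q] by simp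
qed

lemma vars_in_zero [simp]: "0 \<in> vars_in V"
  and vars_in_one [simp]: "1 \<in> vars_in V"
  and vars_in_const [simp]: "const_poly c \<in> vars_in V"
  by (auto simp: vars_in_def)

lemma vars_in_sum: "(\<And>j. j \<in> A \<Longrightarrow> f j \<in> vars_in V) \<Longrightarrow> (\<Sum>j\<in>A. f j) \<in> vars_in V"
  by (induction A rule: infinite_finite_induct) (auto intro: vars_in_add)

lemma vars_in_var: "x \<in> V \<Longrightarrow> var_poly x \<in> vars_in V"
  by (auto simp: vars_in_def degree_in_var)

lemma vars_in_power: "p \<in> vars_in V \<Longrightarrow> p ^ n \<in> vars_in V"
  by (induction n) (auto intro: vars_in_mult)

lemma vars_in_coeff_in: "p \<in> vars_in (insert x V) \<Longrightarrow> coeff_in x j p \<in> vars_in V"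
  unfolding vars_in_alt
proof (intro ballI allI impI)
  fix a z assume p: "\<forall>a\<in>pkeys p. \<forall>z. z \<notin> insert x V \<longrightarrow> plookup a z = 0"
    and a: "a \<in> pkeys (coeff_in x j p)" and "z \<notin> V"
  then show "plookup a z = 0"
    using bspec[OF p, of "a + psingle x j"]
    by (cases "z = x") (simp_all add: keys_coeff_in lookup_add lookup_single)
qed

lemma vars_in_cong:
  assumes "p \<in> vars_in V" "\<And>i. i \<in> V \<Longrightarrow> y $ i = z $ i"
  shows "peval p y = peval p z"
  unfolding peval_def
proof (intro sum.cong refl arg_cong2[where f = times] prod.cong)
  fix a i assume "a \<in> pkeys p"
  then have "i \<notin> V \<Longrightarrow> plookup a i = 0"
    using assms(1) by (simp add: vars_in_alt)
  then show "(y $ i) ^ plookup a i = (z $ i) ^ plookup a i"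
    using assms(2) by (cases "i \<in> V") simp_all
qed

section \<open>Slices along a coordinate and polynomial identities\<close>

definition set_coord :: "'m::finite \<Rightarrow> complex \<Rightarrow> complex ^ 'm \<Rightarrow> complex ^ 'm" where
  "set_coord x t y = (\<chi> i. if i = x then t else y $ i)"

lemma set_coord_nth [simp]: "set_coord x t y $ i = (if i = x then t else y $ i)"
  by (simp add: set_coord_def)

lemma peval_coeff_in_set_coord [simp]: "peval (coeff_in x j p) (set_coord x t y) = peval (coeff_in x j p) y"
  by (rule vars_in_cong[of _ "- {x}"]) (auto simp: vars_in_alt keys_coeff_in)

text \<open>Degrees, leading coefficients and derivatives in x are read off from this univariate
  polynomial in t, at points y where the leading coefficient does not vanish.\<close>

definition slice_poly :: "'m::finite \<Rightarrow> 'm cpoly \<Rightarrow> complex ^ 'm \<Rightarrow> complex poly" where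
  "slice_poly x p y = (\<Sum>j\<le>degree_in x p. monom (peval (coeff_in x j p) y) j)"

lemma poly_slice_poly: "poly (slice_poly x p y) t = peval p (set_coord x t y)"
  by (subst (2) coeff_in_expansion[of p x]) (simp add: slice_poly_def poly_sum poly_monom)

lemma coeff_slice_poly: "coeff (slice_poly x p y) (degree_in x p) = peval (lead_in x p) y"
  by (simp add: slice_poly_def coeff_sum lead_in_def)

lemma degree_slice_le: "degree (slice_poly x p y) \<le> degree_in x p"
  unfolding slice_poly_def by (intro degree_sum_le) (auto intro: order_trans[OF degree_monom_le])

lemma degree_slice_poly:
  assumes "peval (lead_in x p) y \<noteq> 0"
  shows "degree (slice_poly x p y) = degree_in x p"
proof (rule antisym)
  show "degree (slice_poly x p y) \<le> degree_in x p" by (rule degree_slice_le)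
  show "degree_in x p \<le> degree (slice_poly x p y)"
    using assms by (intro le_degree) (simp add: coeff_slice_poly)
qed

text \<open>By induction the leading coefficient in the new variable is nonzero at some point; the
  slice through it is a nonzero univariate polynomial and has a non-root.\<close>

lemma peval_nonzero_vars_in:
  assumes "finite V"
  shows "p \<in> vars_in V \<Longrightarrow> p \<noteq> 0 \<Longrightarrow> \<exists>y. peval p y \<noteq> 0"
  using assms
proof (induction V arbitrary: p rule: finite_induct)
  case empty
  then have "pkeys p \<subseteq> {0}"
    by (auto simp: vars_in_alt intro!: poly_mapping_eqI)
  then have "peval p y = plookup p 0" for y
    by (subst peval_superset[of "{0}"]) auto
  moreover have "plookup p 0 \<noteq> 0"
    using \<open>pkeys p \<subseteq> {0}\<close> empty.prems(2) by (metis in_keys_iff keys_eq_empty subset_singletonD insertI1)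
  ultimately show ?case by auto
next
  case (insert x V)
  have "lead_in x p \<in> vars_in V"
    unfolding lead_in_def by (rule vars_in_coeff_in) (fact insert.prems)
  then obtain y where y: "peval (lead_in x p) y \<noteq> 0"
    using insert.IH lead_in_nonzero insert.prems by blast
  then have "slice_poly x p y \<noteq> 0"
    using coeff_slice_poly by (metis coeff_0)
  then obtain t where "poly (slice_poly x p y) t \<noteq> 0"
    using poly_all_0_iff_0 by blast
  then show ?case unfolding poly_slice_poly by blast
qed

lemma peval_nonzero: "p \<noteq> 0 \<Longrightarrow> \<exists>y. peval p y \<noteq> 0"
  using peval_nonzero_vars_in[of UNIV p] by simp

lemma peval_eqI: "(\<And>y. peval p y = peval q y) \<Longrightarrow> p = q"
  using peval_nonzero[of "p - q"] by fastforce

lemma peval_nonzeroD: "peval p y \<noteq> 0 \<Longrightarrow> p \<noteq> 0"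
  by auto

lemma var_poly_nonzero: "var_poly i \<noteq> 0"
  by (rule peval_nonzeroD[of _ "vec 1"]) simp

text \<open>The line joining a point where p does not vanish to one where q does not reduces the
  claim to univariate polynomials.\<close>

lemma cpoly_mult_eq_0_iff: "p * q = 0 \<longleftrightarrow> p = 0 \<or> q = (0 :: 'm::finite cpoly)"
proof
  assume pq: "p * q = 0"
  show "p = 0 \<or> q = 0"
  proof (rule ccontr)
    assume "\<not> (p = 0 \<or> q = 0)"
    then obtain a b where ab: "peval p a \<noteq> 0" "peval q b \<noteq> 0"
      using peval_nonzero by blast
    obtain P where P: "\<And>t. poly P t = peval p (a + t *s (b - a))"
      using polyfun_on_line by blast
    obtain Q where Q: "\<And>t. poly Q t = peval q (a + t *s (b - a))"
      using polyfun_on_line by blast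
    have "poly (P * Q) t = peval (p * q) (a + t *s (b - a))" for t
      by (simp add: P Q)
    then have "P * Q = 0" unfolding pq peval_zero using poly_all_0_iff_0 by blast
    then have "P = 0 \<or> Q = 0" by simp
    moreover have "a + 0 *s (b - a) = a" "a + 1 *s (b - a) = b"
      by (simp_all add: vec_eq_iff)
    then have "poly P 0 \<noteq> 0" "poly Q 1 \<noteq> 0" unfolding P Q using ab by metis+
    ultimately show False by fastforce
  qed
qed auto

lemma cpoly_mult_cancel: "p * q = p * r \<Longrightarrow> p \<noteq> 0 \<Longrightarrow> q = (r :: 'm::finite cpoly)"
  using cpoly_mult_eq_0_iff[of p "q - r"] unfolding right_diff_distrib by simp

lemma cpoly_prod_eq_0_iff:
  "finite A \<Longrightarrow> (\<Prod>a\<in>A. f a) = (0 :: 'm::finite cpoly) \<longleftrightarrow> (\<exists>a\<in>A. f a = 0)"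
  by (induction A rule: finite_induct) (simp_all add: cpoly_mult_eq_0_iff)

section \<open>Unique factorization\<close>

text \<open>\<open>degree_in\<close> of 0 is 0, so remainders need a separate notion of being
  smaller, under which 0 lies below every bound, even n = 0.\<close>

definition below_in :: "'m::finite \<Rightarrow> nat \<Rightarrow> 'm cpoly \<Rightarrow> bool" where
  "below_in x n p \<longleftrightarrow> p = 0 \<or> degree_in x p < n"

lemma below_in_alt: "below_in x n p \<longleftrightarrow> (\<forall>a\<in>pkeys p. plookup a x < n)"
proof (cases "p = 0")
  case False
  then obtain a where "a \<in> pkeys p" "plookup a x = degree_in x p"
    using degree_in_attained by blast
  moreover have "\<forall>a\<in>pkeys p. plookup a x \<le> degree_in x p"
    using degree_in_le_iff[of x p] by blast
  ultimately show ?thesis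
    using False unfolding below_in_def by (metis order_le_less_trans)
qed (simp add: below_in_def)

lemma below_in_zero [simp]: "below_in x n 0"
  by (simp add: below_in_def)

lemma below_in_add: "below_in x n p \<Longrightarrow> below_in x n q \<Longrightarrow> below_in x n (p + q)"
  unfolding below_in_alt using keys_add[of p q] by blast

lemma below_in_uminus: "below_in x n p \<Longrightarrow> below_in x n (- p)"
  unfolding below_in_alt keys_uminus .

lemma below_in_diff: "below_in x n p \<Longrightarrow> below_in x n q \<Longrightarrow> below_in x n (p - q)"
  using below_in_add[of x n p "- q"] below_in_uminus[of x n q] by simp

lemma below_in_mult:
  assumes "degree_in x q \<le> k" "below_in x n p" shows "below_in x (k + n) (q * p)"
  unfolding below_in_alt
proof
  fix a assume "a \<in> pkeys (q * p)"
  then obtain b c where "a = b + c" "b \<in> pkeys q" "c \<in> pkeys p"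
    using keys_mult by blast
  then show "plookup a x < k + n"
    using assms by (auto simp: lookup_add below_in_alt degree_in_le_iff intro!: add_le_less_mono)
qed

lemma below_in_sum: "(\<And>j. j \<in> A \<Longrightarrow> below_in x n (f j)) \<Longrightarrow> below_in x n (\<Sum>j\<in>A. f j)"
  by (induction A rule: infinite_finite_induct) (auto intro: below_in_add)

lemma degree_in_var_power: "degree_in x (var_poly x ^ k) \<le> k"
proof (induction k)
  case (Suc k)
  then show ?case
    using degree_in_mult_le[of x "var_poly x" "var_poly x ^ k"] by (simp add: degree_in_var)
qed simp

definition tail_in :: "'m::finite \<Rightarrow> 'm cpoly \<Rightarrow> 'm cpoly" where
  "tail_in x p = p - lead_in x p * var_poly x ^ degree_in x p"

lemma lead_tail: "p = lead_in x p * var_poly x ^ degree_in x p + tail_in x p"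
  by (simp add: tail_in_def)

lemma below_tail: "below_in x (degree_in x p) (tail_in x p)"
proof -
  have "tail_in x p = (\<Sum>j<degree_in x p. coeff_in x j p * var_poly x ^ j)"
    unfolding tail_in_def lead_in_def diff_eq_eq
    using coeff_in_expansion[of p x] unfolding lessThan_Suc_atMost[symmetric] sum.lessThan_Suc .
  moreover have "below_in x (degree_in x p) (coeff_in x j p * var_poly x ^ j)"
    if "j < degree_in x p" for j
  proof -
    have "degree_in x (coeff_in x j p * var_poly x ^ j) \<le> j"
      using degree_in_mult_le[of x "coeff_in x j p" "var_poly x ^ j"] degree_in_var_power[of x j]
      by simp
    then show ?thesis using that by (simp add: below_in_def)
  qed
  ultimately show ?thesis by (auto intro: below_in_sum)
qed

lemma vars_in_lead: "p \<in> vars_in (insert x V) \<Longrightarrow> lead_in x p \<in> vars_in V"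
  unfolding lead_in_def by (rule vars_in_coeff_in)

lemma vars_in_tail: "p \<in> vars_in (insert x V) \<Longrightarrow> tail_in x p \<in> vars_in (insert x V)"
  unfolding tail_in_def
  by (intro vars_in_diff vars_in_mult vars_in_power vars_in_var)
    (auto intro: vars_in_mono[OF vars_in_lead])

lemma slice_poly_mult: "slice_poly x (p * q) y = slice_poly x p y * slice_poly x q y"
  by (simp add: poly_eq_poly_eq_iff[symmetric] fun_eq_iff poly_slice_poly)

text \<open>At a point where neither leading coefficient vanishes the slices have full degree, and
  univariate degrees add.\<close>

lemma degree_in_mult:
  assumes "p \<noteq> 0" "q \<noteq> 0"
  shows "degree_in x (p * q) = degree_in x p + degree_in x q"
proof (rule antisym[OF degree_in_mult_le])
  have "lead_in x p * lead_in x q \<noteq> 0"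
    using assms lead_in_nonzero cpoly_mult_eq_0_iff by blast
  then obtain y where "peval (lead_in x p * lead_in x q) y \<noteq> 0"
    using peval_nonzero by blast
  then have y: "peval (lead_in x p) y \<noteq> 0" "peval (lead_in x q) y \<noteq> 0"
    by auto
  then have "slice_poly x p y \<noteq> 0" "slice_poly x q y \<noteq> 0"
    using coeff_slice_poly[of x p y] coeff_slice_poly[of x q y] by auto
  then have "degree (slice_poly x (p * q) y) = degree_in x p + degree_in x q"
    using y by (simp add: slice_poly_mult degree_mult_eq degree_slice_poly)
  then show "degree_in x p + degree_in x q \<le> degree_in x (p * q)"
    using degree_slice_le[of x "p * q" y] by simp
qed

text \<open>In a slice of the product, the coefficient at the sum of the two degrees receives only
  the product of the two top coefficients. This holds at every point, so the polynomials
  agree.\<close>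

lemma lead_in_mult: "lead_in x (p * q) = lead_in x p * lead_in x q"
proof (cases "p = 0 \<or> q = 0")
  case True
  then show ?thesis by (auto simp: lead_in_def coeff_in_def)
next
  case False
  show ?thesis
  proof (rule peval_eqI)
    fix y
    let ?P = "slice_poly x p y" and ?Q = "slice_poly x q y"
    let ?d = "degree_in x p" and ?e = "degree_in x q"
    have zero: "coeff ?P i * coeff ?Q (?d + ?e - i) = 0" if "i \<le> ?d + ?e" "i \<noteq> ?d" for i
    proof (cases "i > ?d")
      case True
      then have "coeff ?P i = 0" using degree_slice_le[of x p y] by (intro coeff_eq_0) simp
      then show ?thesis by simp
    next
      case False
      then have "coeff ?Q (?d + ?e - i) = 0"
        using degree_slice_le[of x q y] that by (intro coeff_eq_0) simp
      then show ?thesis by simp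
    qed
    have "peval (lead_in x (p * q)) y = coeff (?P * ?Q) (?d + ?e)"
      using False by (simp add: coeff_slice_poly[symmetric] slice_poly_mult degree_in_mult)
    also have "\<dots> = (\<Sum>i\<le>?d + ?e. if i = ?d then coeff ?P ?d * coeff ?Q ?e else 0)"
      unfolding coeff_mult using zero by (intro sum.cong) auto
    also have "\<dots> = peval (lead_in x p * lead_in x q) y"
      by (simp add: coeff_slice_poly)
    finally show "peval (lead_in x (p * q)) y = peval (lead_in x p * lead_in x q) y" .
  qed
qed

lemma lead_in_free: "degree_in x p = 0 \<Longrightarrow> lead_in x p = p"
  using lead_tail[of p x] below_tail[of x p] by (simp add: below_in_def)

subsection \<open>Units and irreducible polynomials\<close>

text \<open>Like the total degree, this is additive on products; the additivity follows variable by variable.\<close>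

definition cnorm :: "'m::finite cpoly \<Rightarrow> nat" where
  "cnorm p = (\<Sum>x\<in>UNIV. degree_in x p)"

lemma cnorm_mult: "p \<noteq> 0 \<Longrightarrow> q \<noteq> 0 \<Longrightarrow> cnorm (p * q) = cnorm p + cnorm q"
  by (simp add: cnorm_def degree_in_mult sum.distrib)

lemma vars_in_empty: "p \<in> vars_in {} \<Longrightarrow> \<exists>c. p = const_poly c"
proof -
  assume "p \<in> vars_in {}"
  then have "peval p y = peval (const_poly (peval p 0)) y" for y
    using vars_in_cong[of p "{}" y 0] by simp
  then show ?thesis using peval_eqI by blast
qed

lemma cnorm_eq_0: "cnorm p = 0 \<Longrightarrow> \<exists>c. p = const_poly c"
  by (rule vars_in_empty) (simp add: cnorm_def vars_in_def)

lemma const_poly_0 [simp]: "const_poly 0 = 0"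
  by (simp add: const_poly_def)

lemma const_poly_mult: "const_poly (a * b) = const_poly a * const_poly b"
  by (simp add: const_poly_def mult_single)

lemma const_poly_1 [simp]: "const_poly 1 = 1"
  by (simp add: const_poly_def)

lemma const_poly_unit: "c \<noteq> 0 \<Longrightarrow> const_poly c dvd 1"
  by (rule dvdI[of _ _ "const_poly (1 / c)"]) (simp flip: const_poly_mult)

lemma cpoly_unit_iff: "p dvd 1 \<longleftrightarrow> p \<noteq> 0 \<and> cnorm p = 0"
proof
  assume "p dvd 1"
  then obtain q where q: "1 = p * q" by (elim dvdE)
  then have "p \<noteq> 0" "q \<noteq> 0" by auto
  then have "cnorm p + cnorm q = cnorm (1 :: 'a cpoly)"
    using q cnorm_mult by metis
  then show "p \<noteq> 0 \<and> cnorm p = 0" using \<open>p \<noteq> 0\<close> by (simp add: cnorm_def)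
next
  assume "p \<noteq> 0 \<and> cnorm p = 0"
  then obtain c where "p = const_poly c" "c \<noteq> 0" using cnorm_eq_0[of p] const_poly_0 by blast
  then show "p dvd 1" using const_poly_unit by simp
qed

lemma unit_inverse:
  assumes "c dvd (1 :: 'a::comm_ring_1)"
  obtains u where "c * u = 1" "\<And>p q. c * p = q \<Longrightarrow> p = u * q"
proof -
  obtain u where u: "1 = c * u" using assms by (elim dvdE)
  have "p = u * q" if "c * p = q" for p q
  proof -
    have "u * q = (c * u) * p" unfolding that[symmetric] by (simp add: mult_ac)
    then show ?thesis using u by simp
  qed
  then show ?thesis using that u by simp
qed

lemma irreducible_nonconstant:
  assumes "irreducible p" obtains x where "degree_in x p > 0"
proof -
  have "cnorm p \<noteq> 0" using assms cpoly_unit_iff[of p] by (auto simp: irreducible_def)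
  then show ?thesis using that by (auto simp: cnorm_def)
qed

text \<open>The strict drop of \<open>cnorm\<close> in the cofactor drives the later inductions that
  cancel one irreducible factor at a time.\<close>

lemma cpoly_irreducible_factor:
  assumes "p \<noteq> 0" "\<not> p dvd (1 :: 'm::finite cpoly)"
  shows "\<exists>q r. irreducible q \<and> p = q * r \<and> cnorm r < cnorm p"
  using assms
proof (induction "cnorm p" arbitrary: p rule: less_induct)
  case less
  show ?case
  proof (cases "irreducible p")
    case True
    moreover have "cnorm (1 :: 'm cpoly) < cnorm p"
      using less.prems cpoly_unit_iff[of p] cpoly_unit_iff[of "1 :: 'm cpoly"] by auto
    ultimately show ?thesis by (intro exI[of _ p] exI[of _ 1]) simp
  next
    case False
    then obtain a b where ab: "p = a * b" "\<not> a dvd 1" "\<not> b dvd 1"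
      using less.prems by (auto simp: irreducible_def)
    then have nz: "a \<noteq> 0" "b \<noteq> 0" using less.prems by auto
    then have "cnorm a < cnorm p" using ab cnorm_mult[of a b] cpoly_unit_iff[of b] by simp
    then obtain q r where qr: "irreducible q" "a = q * r" "cnorm r < cnorm a"
      using less.hyps nz ab by blast
    then have "r \<noteq> 0" using nz by auto
    then have "cnorm (r * b) < cnorm p"
      using qr ab nz cnorm_mult[of a b] cnorm_mult[of r b] by simp
    then show ?thesis using qr ab by (intro exI[of _ q] exI[of _ "r * b"]) (simp add: mult_ac)
  qed
qed

lemma dvd_vars_in:
  assumes "p * q \<in> vars_in V" "p * q \<noteq> 0"
  shows "p \<in> vars_in V" "q \<in> vars_in V"
proof -
  have "p \<noteq> 0" "q \<noteq> 0" using assms(2) by auto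
  then show "p \<in> vars_in V" "q \<in> vars_in V"
    using assms(1) degree_in_mult[of p q] by (auto simp: vars_in_def)
qed

text \<open>
  Since the number of variables is part of the type, the induction behind Gauss' lemma runs over the set \<open>V\<close> of
  the variables that occur.
\<close>

definition prime_relative :: "'m::finite set \<Rightarrow> 'm cpoly \<Rightarrow> bool" where
  "prime_relative V p \<longleftrightarrow>
     (\<forall>f\<in>vars_in V. \<forall>g\<in>vars_in V. p dvd f * g \<longrightarrow> p dvd f \<or> p dvd g)"

text \<open>As p is free of x, it divides the product of the leading coefficients of f and g in x,
  hence one of them. Replacing that polynomial by its tail keeps p a divisor of the product, and p
  divides a polynomial once it divides its leading coefficient and its tail.\<close>

lemma prime_relative_insert:
  assumes p: "p \<in> vars_in V" "x \<notin> V" "prime_relative V p"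
  shows "prime_relative (insert x V) p"
proof -
  \<comment> \<open>\<open>Suc\<close> puts 0 strictly below the nonzero polynomials free of x,
    whose tail is 0.\<close>
  define m where "m = (\<lambda>f :: 'a cpoly. if f = 0 then 0 else Suc (degree_in x f))"
  have m_tail: "m (tail_in x f) < m f" if "f \<noteq> 0" for f
    using below_tail[of x f] that by (auto simp: m_def below_in_def)
  have free: "lead_in x p = p" using p by (intro lead_in_free) (auto simp: vars_in_def)
  have dvd_tail: "p dvd f" if "p dvd lead_in x f" "p dvd tail_in x f" for f
    using dvd_add[OF dvd_mult2[OF that(1), of "var_poly x ^ degree_in x f"] that(2)]
    unfolding lead_tail[symmetric] .
  have "p dvd f \<or> p dvd g"
    if "f \<in> vars_in (insert x V)" "g \<in> vars_in (insert x V)" "p dvd f * g" for f g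
    using that
  proof (induction "m f + m g" arbitrary: f g rule: less_induct)
    case less
    show ?case
    proof (cases "f = 0 \<or> g = 0")
      case False
      obtain s where "f * g = p * s" using less.prems by (elim dvdE)
      then have "lead_in x f * lead_in x g = p * lead_in x s"
        using lead_in_mult[of x f g] lead_in_mult[of x p s] free by simp
      then have "p dvd lead_in x f \<or> p dvd lead_in x g"
        using p(3) vars_in_lead[OF less.prems(1)] vars_in_lead[OF less.prems(2)] dvd_triv_left[of p]
        unfolding prime_relative_def by simp
      then show ?thesis
      proof
        assume l: "p dvd lead_in x f"
        have "tail_in x f * g = f * g - lead_in x f * (var_poly x ^ degree_in x f * g)"
          by (simp add: tail_in_def algebra_simps)
        then have "p dvd tail_in x f * g" using l less.prems by (auto intro: dvd_diff dvd_mult2)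
        then have "p dvd tail_in x f \<or> p dvd g"
          using less.hyps[of "tail_in x f" g] m_tail[of f] False vars_in_tail[of f x V] less.prems(1,2)
          by simp
        then show ?thesis
          using dvd_tail[OF l] by blast
      next
        assume l: "p dvd lead_in x g"
        have "f * tail_in x g = f * g - lead_in x g * (var_poly x ^ degree_in x g * f)"
          by (simp add: tail_in_def algebra_simps)
        then have "p dvd f * tail_in x g" using l less.prems by (auto intro: dvd_diff dvd_mult2)
        then have "p dvd f \<or> p dvd tail_in x g"
          using less.hyps[of f "tail_in x g"] m_tail[of g] False vars_in_tail[of g x V] less.prems(1,2)
          by simp
        then show ?thesis
          using dvd_tail[OF l] by blast
      qed
    qed auto
  qed
  then show ?thesis by (auto simp: prime_relative_def)
qed

section \<open>Induction step of Gauss' lemma for polynomials in which the new variable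
  occurs\<close>

context
  fixes V :: "'m::finite set" and x :: 'm
  assumes primes: "\<And>p. p \<in> vars_in V \<Longrightarrow> irreducible p \<Longrightarrow> prime_relative (insert x V) p"
    and x: "x \<notin> V"
begin

text \<open>Each irreducible factor of c is prime and divides q * h, so it can be cancelled from q
  or from h. Only what is cancelled from h has to be recorded, in b.\<close>

lemma remove_content_factorization:
  assumes "c \<in> vars_in V" "c \<noteq> 0" "c * p = q * h" "p \<noteq> 0"
    "p \<in> vars_in (insert x V)"
  shows "\<exists>q' h' b. p = q' * h' \<and> h = b * h' \<and> b \<in> vars_in V \<and> b \<noteq> 0"
  using assms
proof (induction "cnorm c" arbitrary: c q h rule: less_induct)
  case less
  have W: "c * p \<in> vars_in (insert x V)" "c * p \<noteq> 0"
    using less.prems vars_in_mono[OF less.prems(1) subset_insertI, of x]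
    by (blast intro: vars_in_mult, metis cpoly_mult_eq_0_iff)
  then have qh: "q \<in> vars_in (insert x V)" "h \<in> vars_in (insert x V)"
    unfolding less.prems(3) using dvd_vars_in[of q h "insert x V"] by blast+
  show ?case
  proof (cases "c dvd 1")
    case True
    then obtain u where "p = u * (q * h)" using unit_inverse less.prems(3) by metis
    then have "p = (u * q) * h" by (simp add: mult_ac)
    then show ?thesis by (intro exI[of _ "u * q"] exI[of _ h] exI[of _ 1]) simp
  next
    case False
    then obtain \<pi> r where pr: "irreducible \<pi>" "c = \<pi> * r" "cnorm r < cnorm c"
      using cpoly_irreducible_factor less.prems by blast
    have V: "\<pi> \<in> vars_in V" "r \<in> vars_in V" "r \<noteq> 0" "\<pi> \<noteq> 0"
      using dvd_vars_in[of \<pi> r V] pr less.prems by auto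
    have "q * h = \<pi> * (r * p)" using pr less.prems(3) by (simp add: mult_ac)
    then have "\<pi> dvd q * h" by simp
    then have "\<pi> dvd q \<or> \<pi> dvd h"
      using primes[OF V(1) pr(1)] qh unfolding prime_relative_def by blast
    then show ?thesis
    proof
      assume "\<pi> dvd q"
      then obtain q2 where q2: "q = \<pi> * q2" by (elim dvdE)
      then have "\<pi> * (r * p) = \<pi> * (q2 * h)" using pr less.prems(3) by (simp add: mult_ac)
      then have "r * p = q2 * h" using cpoly_mult_cancel V(4) by blast
      then show ?thesis using less.hyps[of r q2 h] pr V less.prems by blast
    next
      assume "\<pi> dvd h"
      then obtain h2 where h2: "h = \<pi> * h2" by (elim dvdE)
      then have "\<pi> * (r * p) = \<pi> * (q * h2)" using pr less.prems(3) by (simp add: mult_ac)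
      then have "r * p = q * h2" using cpoly_mult_cancel V(4) by blast
      then obtain q' h' b where "p = q' * h'" "h2 = b * h'" "b \<in> vars_in V" "b \<noteq> 0"
        using less.hyps[of r q h2] pr V less.prems by blast
      then show ?thesis using h2 V
        by (intro exI[of _ q'] exI[of _ h'] exI[of _ "\<pi> * b"])
          (auto simp: mult_ac cpoly_mult_eq_0_iff intro: vars_in_mult)
    qed
  qed
qed

text \<open>Let c * f = p * s. An irreducible factor \<open>\<pi>\<close> of c divides p * s but not
  p: otherwise p, being irreducible, would be \<open>\<pi>\<close> up to a unit and hence free of x.
  So \<open>\<pi>\<close> can be cancelled from s.\<close>

lemma remove_content_dvd:
  assumes "c \<in> vars_in V" "c \<noteq> 0" "p dvd c * f"
    "irreducible p" "degree_in x p > 0" "p \<in> vars_in (insert x V)" "f \<in> vars_in (insert x V)"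
  shows "p dvd f"
  using assms
proof (induction "cnorm c" arbitrary: c rule: less_induct)
  case less
  show ?case
  proof (cases "f = 0")
    case False
    obtain s where s: "c * f = p * s" using less.prems by (elim dvdE)
    show ?thesis
    proof (cases "c dvd 1")
      case True
      then obtain u where "f = u * (p * s)" using unit_inverse s by metis
      then have "f = p * (u * s)" by (simp add: mult_ac)
      then show ?thesis by simp
    next
      case False
      then obtain \<pi> r where pr: "irreducible \<pi>" "c = \<pi> * r" "cnorm r < cnorm c"
        using cpoly_irreducible_factor less.prems by blast
      have V: "\<pi> \<in> vars_in V" "r \<in> vars_in V" "r \<noteq> 0" "\<pi> \<noteq> 0"
        using dvd_vars_in[of \<pi> r V] pr less.prems by auto
      have "c * f \<in> vars_in (insert x V)" "c * f \<noteq> 0"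
        using less.prems \<open>f \<noteq> 0\<close> vars_in_mono[OF less.prems(1) subset_insertI, of x]
        by (blast intro: vars_in_mult, metis cpoly_mult_eq_0_iff)
      then have "s \<in> vars_in (insert x V)"
        using dvd_vars_in[of p s "insert x V"] s by simp
      moreover have "p * s = \<pi> * (r * f)" using pr s by (simp add: mult_ac)
      then have "\<pi> dvd p * s" by simp
      ultimately have "\<pi> dvd p \<or> \<pi> dvd s"
        using primes[OF V(1) pr(1)] less.prems unfolding prime_relative_def by blast
      moreover have "\<not> \<pi> dvd p"
      proof
        assume "\<pi> dvd p"
        then obtain t where t: "p = \<pi> * t" by (elim dvdE)
        then have "t dvd 1" using less.prems(4) pr(1) by (auto simp: irreducible_def)
        then have "degree_in x t = 0" by (simp add: cpoly_unit_iff cnorm_def)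
        moreover have "t \<noteq> 0" using \<open>t dvd 1\<close> by auto
        moreover have "degree_in x \<pi> = 0" using V x by (simp add: vars_in_def)
        ultimately have "degree_in x p = 0" using t V degree_in_mult[of \<pi> t x] by simp
        then show False using less.prems by simp
      qed
      ultimately obtain s2 where "s = \<pi> * s2" by (auto elim: dvdE)
      then have "\<pi> * (r * f) = \<pi> * (p * s2)" using pr s by (simp add: mult_ac)
      then have "r * f = p * s2" using cpoly_mult_cancel V(4) by blast
      then have "p dvd r * f" by simp
      then show ?thesis using less.hyps[of r] pr V less.prems by blast
    qed
  qed simp
qed

text \<open>
  An element \<open>h\<close> of minimal degree in the ideal \<open>(p, f)\<close> divides \<open>p\<close> and \<open>f\<close> up to factors without \<open>x\<close>. As \<open>p\<close> is
  irreducible and does not divide \<open>f\<close>, the element \<open>h\<close> itself is free of \<open>x\<close> up to a unit.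
\<close>

lemma bezout_relative:
  assumes p: "irreducible p" "degree_in x p > 0" "p \<in> vars_in (insert x V)"
    and f: "f \<in> vars_in (insert x V)" "\<not> p dvd f"
  shows "\<exists>c a b. c \<in> vars_in V \<and> c \<noteq> 0 \<and> a \<in> vars_in (insert x V) \<and> b \<in> vars_in (insert x V)
    \<and> c = a * p + b * f"
proof -
  let ?W = "vars_in (insert x V)"
  define I where "I = {a * p + b * f | a b. a \<in> ?W \<and> b \<in> ?W}"
  have VW: "c \<in> ?W" if "c \<in> vars_in V" for c using that by (rule vars_in_mono) auto
  have IW: "I \<subseteq> ?W" using p f by (auto simp: I_def intro!: vars_in_add vars_in_mult)
  have I_diff: "e - e' \<in> I" if e: "e \<in> I" "e' \<in> I" for e e'
  proof -
    obtain a b a' b' where ab: "e = a * p + b * f" "e' = a' * p + b' * f"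
      "a \<in> ?W" "b \<in> ?W" "a' \<in> ?W" "b' \<in> ?W" using e unfolding I_def by blast
    then have "e - e' = (a - a') * p + (b - b') * f" by (simp add: algebra_simps)
    moreover have "a - a' \<in> ?W" "b - b' \<in> ?W" using ab by (auto intro: vars_in_diff)
    ultimately show ?thesis unfolding I_def by blast
  qed
  have I_mult: "s * e \<in> I" if e: "e \<in> I" "s \<in> ?W" for e s
  proof -
    obtain a b where ab: "e = a * p + b * f" "a \<in> ?W" "b \<in> ?W" using e unfolding I_def by blast
    then have "s * e = (s * a) * p + (s * b) * f" by (simp add: algebra_simps)
    moreover have "s * a \<in> ?W" "s * b \<in> ?W" using ab e by (auto intro: vars_in_mult)
    ultimately show ?thesis unfolding I_def by blast
  qed
  have "p = 1 * p + 0 * f" "f = 0 * p + 1 * f" by simp_all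
  then have "p \<in> I" "f \<in> I" unfolding I_def using vars_in_one vars_in_zero by blast+
  have "p \<noteq> 0" "f \<noteq> 0" using p f by (auto simp: irreducible_def)
  obtain h where h: "h \<in> I" "h \<noteq> 0" and min: "\<And>e. e \<in> I \<Longrightarrow> e \<noteq> 0 \<Longrightarrow> degree_in x h \<le> degree_in x e"
    using ex_has_least_nat[of "\<lambda>h. h \<in> I \<and> h \<noteq> 0" p "degree_in x"] \<open>p \<in> I\<close> \<open>p \<noteq> 0\<close> by blast
  have reduce: "\<exists>c\<in>vars_in V. c \<noteq> 0 \<and> h dvd c * e" if "e \<in> I" for e
    using that
  proof (induction "if e = 0 then 0 else Suc (degree_in x e)" arbitrary: e rule: less_induct)
    case less
    show ?case
    proof (cases "e = 0")
      case True
      then show ?thesis by (intro bexI[of _ 1]) auto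
    next
      case False
      define k where "k = degree_in x e - degree_in x h"
      have k: "degree_in x e = k + degree_in x h" using min[OF less.prems False] by (simp add: k_def)
      \<comment> \<open>Pseudo-division: multiplying e by the leading coefficient of h, which is
        free of x, lets the top terms cancel without dividing coefficients.\<close>
      define e' where "e' = lead_in x h * e - (lead_in x e * var_poly x ^ k) * h"
      have le: "lead_in x e \<in> vars_in V" "lead_in x h \<in> vars_in V"
        using vars_in_lead less.prems h IW by blast+
      have "e' \<in> I" unfolding e'_def
        using less.prems h le VW by (intro I_diff I_mult vars_in_mult vars_in_power vars_in_var) auto
      moreover have "below_in x (degree_in x e) e'"
      proof -
        have "e' = lead_in x h * tail_in x e - (lead_in x e * var_poly x ^ k) * tail_in x h"
          unfolding e'_def tail_in_def k power_add by (simp add: algebra_simps)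
        moreover have "below_in x (0 + degree_in x e) (lead_in x h * tail_in x e)"
          by (intro below_in_mult below_tail) (simp add: lead_in_def)
        moreover have "degree_in x (lead_in x e * var_poly x ^ k) \<le> k"
          using degree_in_mult_le[of x "lead_in x e" "var_poly x ^ k"] degree_in_var_power[of x k]
          by (simp add: lead_in_def)
        then have "below_in x (k + degree_in x h) ((lead_in x e * var_poly x ^ k) * tail_in x h)"
          by (intro below_in_mult below_tail)
        ultimately show ?thesis using below_in_diff k by simp
      qed
      ultimately obtain c where c: "c \<in> vars_in V" "c \<noteq> 0" "h dvd c * e'"
        using less.hyps[of e'] False by (cases "e' = 0") (auto simp: below_in_def)
      have "(c * lead_in x h) * e = c * e' + (c * (lead_in x e * var_poly x ^ k)) * h"
        by (simp add: e'_def algebra_simps)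
      then have "h dvd (c * lead_in x h) * e" using c by simp
      moreover have "c * lead_in x h \<noteq> 0" using c h lead_in_nonzero by (auto simp: cpoly_mult_eq_0_iff)
      ultimately show ?thesis using c le by (intro bexI[of _ "c * lead_in x h"]) (auto intro: vars_in_mult)
    qed
  qed
  obtain c1 q1 where c1: "c1 \<in> vars_in V" "c1 \<noteq> 0" "c1 * p = q1 * h"
    using reduce[OF \<open>p \<in> I\<close>] by (auto simp: mult.commute elim!: dvdE)
  obtain c2 where c2: "c2 \<in> vars_in V" "c2 \<noteq> 0" "h dvd c2 * f"
    using reduce[OF \<open>f \<in> I\<close>] by blast
  obtain q' h' b where fac: "p = q' * h'" "h = b * h'" "b \<in> vars_in V" "b \<noteq> 0"
    using remove_content_factorization[OF c1 \<open>p \<noteq> 0\<close> p(3)] by blast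
  have "q' dvd 1 \<or> h' dvd 1" using p(1) fac(1) by (auto simp: irreducible_def)
  then show ?thesis
  proof
    \<comment> \<open>Here \<open>h'\<close> is an associate of p, so p divides h and c2 * f, hence
      f: a contradiction.\<close>
    assume "q' dvd 1"
    then obtain u where "h' = u * p" using unit_inverse fac(1) by metis
    then have "p dvd h" using fac(2) by simp
    then have "p dvd c2 * f" using c2(3) by (rule dvd_trans)
    then have "p dvd f" using remove_content_dvd[OF c2(1,2)] p f by blast
    then show ?thesis using f by blast
  next
    assume "h' dvd 1"
    then obtain u where u: "h' * u = 1" "b = u * h"
      using unit_inverse fac(2) by (metis mult.commute)
    moreover have "u \<in> ?W" using dvd_vars_in(2)[of h' u] u by simp
    ultimately have "b \<in> I" using I_mult h by blast
    then show ?thesis unfolding I_def using fac by blast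
  qed
qed

end

text \<open>If x does not occur in p, primality is lifted from V. If it occurs and p does not divide
  f, some nonzero c = a * p + b * f is free of x; then p divides c * g, and c can be
  removed.\<close>

lemma irreducible_prime_relative:
  assumes "finite V"
  shows "p \<in> vars_in V \<Longrightarrow> irreducible p \<Longrightarrow> prime_relative V p"
  using assms
proof (induction V arbitrary: p rule: finite_induct)
  case empty
  \<comment> \<open>The base case is vacuous: an irreducible polynomial contains some
    variable.\<close>
  then obtain x where "degree_in x p > 0" using irreducible_nonconstant by blast
  then show ?case using empty by (auto simp: vars_in_def)
next
  case (insert x V)
  have primes: "prime_relative (insert x V) q" if "q \<in> vars_in V" "irreducible q" for q
    using insert.IH insert.hyps that by (intro prime_relative_insert) auto
  show ?case
  proof (cases "degree_in x p = 0")
    case True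
    then have "p \<in> vars_in V" using insert.prems(1) unfolding vars_in_def
      by simp (metis insert_iff)
    then show ?thesis using primes insert.prems by blast
  next
    case False
    have "p dvd g" if fg: "f \<in> vars_in (insert x V)" "g \<in> vars_in (insert x V)" "p dvd f * g"
      and "\<not> p dvd f" for f g
    proof -
      obtain c a b where c: "c \<in> vars_in V" "c \<noteq> 0" "c = a * p + b * f"
        using bezout_relative[of V x p f] primes insert.hyps insert.prems False fg(1) \<open>\<not> p dvd f\<close>
        by auto
      have "c * g = p * (a * g) + b * (f * g)" by (simp add: c algebra_simps)
      then have "p dvd c * g" using fg by simp
      then show ?thesis using remove_content_dvd[of V x c p g] primes insert.hyps insert.prems False fg c(1,2)
        by auto
    qed
    then show ?thesis unfolding prime_relative_def by blast
  qed
qed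

theorem cpoly_irreducible_prime:
  fixes p :: "'m::finite cpoly"
  assumes "irreducible p" "p dvd f * g" shows "p dvd f \<or> p dvd g"
  using irreducible_prime_relative[of UNIV p] assms by (auto simp: prime_relative_def)

text \<open>Elimination of x: the combination c does the work of the resultant of p and f.\<close>

theorem cpoly_bezout:
  fixes p :: "'m::finite cpoly"
  assumes "irreducible p" "degree_in x p > 0" "\<not> p dvd f"
  shows "\<exists>c a b. c \<noteq> 0 \<and> degree_in x c = 0 \<and> c = a * p + b * f"
proof -
  have "\<exists>c a b. c \<in> vars_in (UNIV - {x}) \<and> c \<noteq> 0 \<and> a \<in> vars_in (insert x (UNIV - {x})) \<and>
      b \<in> vars_in (insert x (UNIV - {x})) \<and> c = a * p + b * f"
  proof (rule bezout_relative)
    show "prime_relative (insert x (UNIV - {x})) q" if "irreducible q" for q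
      using irreducible_prime_relative[of UNIV q] that by (simp add: insert_absorb)
  qed (use assms in \<open>simp_all add: insert_absorb\<close>)
  then show ?thesis by (auto simp: vars_in_def)
qed

section \<open>Hypersurfaces\<close>

text \<open>The coordinates other than x are chosen so that neither c nor the leading coefficient of
  p in x vanishes. Then x is taken as a root of a nonconstant univariate polynomial, and moving x
  does not affect c.\<close>

lemma point_on_hypersurface:
  assumes "degree_in x p > 0" "c \<noteq> 0" "degree_in x c = 0"
  shows "\<exists>y. peval p y = 0 \<and> peval c y \<noteq> 0"
proof -
  have "p \<noteq> 0" using assms(1) by auto
  then have "c * lead_in x p \<noteq> 0"
    using assms(2) lead_in_nonzero cpoly_mult_eq_0_iff by blast
  then obtain y where "peval (c * lead_in x p) y \<noteq> 0" using peval_nonzero by blast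
  then have y: "peval c y \<noteq> 0" "peval (lead_in x p) y \<noteq> 0" by auto
  have "degree (slice_poly x p y) > 0" using degree_slice_poly[OF y(2)] assms(1) by simp
  then have "\<not> constant (poly (slice_poly x p y))" by (simp add: constant_degree)
  then obtain t where t: "poly (slice_poly x p y) t = 0"
    using fundamental_theorem_of_algebra by blast
  have "peval c (set_coord x t y) = peval c y"
    using assms(3) by (intro vars_in_cong[of c "- {x}"]) (auto simp: vars_in_def)
  then show ?thesis using t y(1) unfolding poly_slice_poly by metis
qed

text \<open>If p did not divide f, eliminating a variable x of p would give a nonzero c = a * p + b
  * f free of x. It would vanish wherever p does, but some zero of p is not a zero of c.\<close>

theorem hypersurface_nullstellensatz:
  assumes "irreducible p" "\<And>y. peval p y = 0 \<Longrightarrow> peval f y = 0"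
  shows "p dvd f"
proof (rule ccontr)
  assume "\<not> p dvd f"
  obtain x where x: "degree_in x p > 0" using irreducible_nonconstant assms(1) by blast
  obtain c a b where c: "c \<noteq> 0" "degree_in x c = 0" "c = a * p + b * f"
    using cpoly_bezout[OF assms(1) x \<open>\<not> p dvd f\<close>] by blast
  obtain y where "peval p y = 0" "peval c y \<noteq> 0"
    using point_on_hypersurface[OF x c(1,2)] by blast
  then show False using assms(2) c(3) by simp
qed

lemma vanishes_iff_dvd:
  assumes "irreducible p"
  shows "(\<forall>y\<in>hypersurface p. peval f y = 0) \<longleftrightarrow> p dvd f"
proof
  assume "p dvd f"
  then obtain r where "f = p * r" by (elim dvdE)
  then show "\<forall>y\<in>hypersurface p. peval f y = 0" by (auto simp: hypersurface_def)
qed (auto intro!: hypersurface_nullstellensatz[OF assms] simp: hypersurface_def)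

text \<open>Irreducibility of the hypersurface in terms of points: nonempty relatively open subsets
  meet because p is prime.\<close>

lemma hypersurface_generic_point:
  assumes "irreducible p" "y1 \<in> hypersurface p" "peval f y1 \<noteq> 0" "y2 \<in> hypersurface p" "peval g y2 \<noteq> 0"
  shows "\<exists>y\<in>hypersurface p. peval f y \<noteq> 0 \<and> peval g y \<noteq> 0"
proof -
  have "\<not> p dvd f" "\<not> p dvd g"
    using assms vanishes_iff_dvd[OF assms(1)] by blast+
  then have "\<not> p dvd f * g" using cpoly_irreducible_prime assms(1) by blast
  then show ?thesis using vanishes_iff_dvd[OF assms(1), of "f * g"] by auto
qed

section \<open>Derivatives\<close>

text \<open>Each summand is kept as one product with a lowered exponent, to match the monomials of
  \<open>partial_deriv\<close>. If n i = 0, the factor \<open>of_nat (n i)\<close> removes the term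
  with the truncated exponent.\<close>

lemma DERIV_prod_power:
  fixes f :: "'i \<Rightarrow> complex \<Rightarrow> complex"
  assumes "\<And>i. i \<in> A \<Longrightarrow> (f i has_field_derivative f' i) (at t)"
  shows "((\<lambda>s. \<Prod>i\<in>A. f i s ^ n i) has_field_derivative
    (\<Sum>i\<in>A. of_nat (n i) * (\<Prod>j\<in>A. f j t ^ (if j = i then n i - 1 else n j)) * f' i)) (at t)"
proof (cases "finite A")
  case True
  have "((\<lambda>s. f i s ^ n i) has_field_derivative of_nat (n i) * f i t ^ (n i - 1) * f' i) (at t)"
    if "i \<in> A" for i
    using DERIV_power[OF assms[OF that], of "n i"] by (simp add: mult_ac)
  then have "((\<lambda>s. \<Prod>i\<in>A. f i s ^ n i) has_field_derivative
      (\<Sum>i\<in>A. of_nat (n i) * f i t ^ (n i - 1) * f' i * (\<Prod>j\<in>A - {i}. f j t ^ n j))) (at t)"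
    by (rule has_field_derivative_prod)
  moreover have "(\<Prod>j\<in>A. f j t ^ (if j = i then n i - 1 else n j)) =
      f i t ^ (n i - 1) * (\<Prod>j\<in>A - {i}. f j t ^ n j)" if "i \<in> A" for i
    using True that by (subst prod.remove[of _ i]) (auto intro!: prod.cong)
  ultimately show ?thesis by (simp add: mult_ac cong: sum.cong)
qed simp

lemma peval_partial_deriv:
  "peval (partial_deriv i p) y = (\<Sum>a\<in>pkeys p. plookup p a *
     (of_nat (plookup a i) * (\<Prod>j\<in>UNIV. y $ j ^ (if j = i then plookup a i - 1 else plookup a j))))"
  unfolding partial_deriv_def
  by (auto simp: monomial_value_def lookup_minus lookup_single when_def intro!: sum.cong prod.cong)

lemma DERIV_peval:
  assumes "\<And>i. ((\<lambda>t. y t $ i) has_field_derivative y' i) (at t)"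
  shows "((\<lambda>t. peval p (y t)) has_field_derivative
    (\<Sum>i\<in>UNIV. peval (partial_deriv i p) (y t) * y' i)) (at t)"
proof -
  have "((\<lambda>s. peval p (y s)) has_field_derivative
      (\<Sum>a\<in>pkeys p. plookup p a * (\<Sum>i\<in>UNIV. of_nat (plookup a i) *
        (\<Prod>j\<in>UNIV. y t $ j ^ (if j = i then plookup a i - 1 else plookup a j)) * y' i))) (at t)"
    unfolding peval_def using assms by (intro DERIV_sum DERIV_cmult DERIV_prod_power)
  moreover have "(\<Sum>i\<in>UNIV. peval (partial_deriv i p) (y t) * y' i) =
      (\<Sum>a\<in>pkeys p. plookup p a * (\<Sum>i\<in>UNIV. of_nat (plookup a i) *
        (\<Prod>j\<in>UNIV. y t $ j ^ (if j = i then plookup a i - 1 else plookup a j)) * y' i))"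
    unfolding peval_partial_deriv sum_distrib_right sum_distrib_left
    by (subst sum.swap) (simp add: mult_ac)
  ultimately show ?thesis by simp
qed

lemma DERIV_peval_line:
  "((\<lambda>t. peval p (a + t *s b)) has_field_derivative
    (\<Sum>i\<in>UNIV. peval (partial_deriv i p) (a + t *s b) * b $ i)) (at t)"
  by (rule DERIV_peval) (auto intro!: derivative_eq_intros)

text \<open>Both sides have as values the derivative of p along the i-th coordinate.\<close>

lemma slice_poly_partial_deriv: "slice_poly i (partial_deriv i p) y = pderiv (slice_poly i p y)"
proof -
  have "poly (slice_poly i (partial_deriv i p) y) t = poly (pderiv (slice_poly i p y)) t" for t
  proof -
    have "((\<lambda>t. peval p (set_coord i t y)) has_field_derivative
        (\<Sum>j\<in>UNIV. peval (partial_deriv j p) (set_coord i t y) * (if j = i then 1 else 0))) (at t)"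
      by (rule DERIV_peval) (auto intro!: derivative_eq_intros)
    moreover have "(\<Sum>j\<in>UNIV. peval (partial_deriv j p) (set_coord i t y) * (if j = i then 1 else 0)) =
        peval (partial_deriv i p) (set_coord i t y)"
      by (simp add: if_distrib cong: if_cong)
    ultimately show ?thesis
      using poly_DERIV[of "slice_poly i p y" t] DERIV_unique unfolding poly_slice_poly by fastforce
  qed
  then show ?thesis by (simp add: poly_eq_poly_eq_iff[symmetric] fun_eq_iff)
qed

text \<open>Through a point where the leading coefficient in i does not vanish, the slice is
  nonconstant, so in characteristic 0 its derivative is nonzero.\<close>

lemma partial_deriv_degree_less:
  assumes "degree_in i p > 0"
  shows "partial_deriv i p \<noteq> 0" "degree_in i (partial_deriv i p) < degree_in i p"
proof -
  show nz: "partial_deriv i p \<noteq> 0"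
  proof
    assume 0: "partial_deriv i p = 0"
    have "p \<noteq> 0" using assms by auto
    then obtain y where y: "peval (lead_in i p) y \<noteq> 0" using lead_in_nonzero peval_nonzero by blast
    have "slice_poly i (0 :: 'a cpoly) y = 0" by (simp add: slice_poly_def coeff_in_def)
    then have "pderiv (slice_poly i p y) = 0" using slice_poly_partial_deriv[of i p y] 0 by simp
    then show False using degree_slice_poly[OF y] assms by (simp add: pderiv_eq_0_iff)
  qed
  then obtain y where y: "peval (lead_in i (partial_deriv i p)) y \<noteq> 0"
    using lead_in_nonzero peval_nonzero by blast
  have "degree_in i (partial_deriv i p) = degree (slice_poly i p y) - 1"
    using degree_slice_poly[OF y] by (simp add: slice_poly_partial_deriv degree_pderiv)
  then show "degree_in i (partial_deriv i p) < degree_in i p"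
    using degree_slice_le[of i p y] assms by linarith
qed

lemma not_dvd_partial_deriv:
  assumes "degree_in i p > 0" shows "\<not> p dvd partial_deriv i p"
proof
  assume "p dvd partial_deriv i p"
  then obtain r where r: "partial_deriv i p = p * r" by (elim dvdE)
  then have "p \<noteq> 0" "r \<noteq> 0" using partial_deriv_degree_less(1)[OF assms] by auto
  then show False
    using degree_in_mult[of p r i] r partial_deriv_degree_less(2)[OF assms] by simp
qed

section \<open>The Zariski topologies\<close>

text \<open>Intersections of two basic sets are basic, with the product as equation, so generated
  open sets are unions of basic ones.\<close>

lemma openin_zariski:
  "openin zariski U \<longleftrightarrow> (\<forall>x\<in>U. \<exists>p. peval p x \<noteq> 0 \<and> {y. peval p y \<noteq> 0} \<subseteq> U)"
proof
  let ?B = "{{y. peval p y \<noteq> 0} | p. True}"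
  assume "openin zariski U"
  then have "generate_topology_on ?B U"
    unfolding zariski_def by (rule openin_topology_generated_by)
  then show "\<forall>x\<in>U. \<exists>p. peval p x \<noteq> 0 \<and> {y. peval p y \<noteq> 0} \<subseteq> U"
  proof induction
    case (Int a b)
    show ?case
    proof
      fix x assume "x \<in> a \<inter> b"
      then obtain p q where "peval p x \<noteq> 0" "{y. peval p y \<noteq> 0} \<subseteq> a" "peval q x \<noteq> 0" "{y. peval q y \<noteq> 0} \<subseteq> b"
        using Int.IH by blast
      then show "\<exists>p. peval p x \<noteq> 0 \<and> {y. peval p y \<noteq> 0} \<subseteq> a \<inter> b"
        by (intro exI[of _ "p * q"]) auto
    qed
  next
    case (UN K)
    show ?case
    proof
      fix x assume "x \<in> \<Union>K"
      then obtain k where "k \<in> K" "x \<in> k" by blast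
      then show "\<exists>p. peval p x \<noteq> 0 \<and> {y. peval p y \<noteq> 0} \<subseteq> \<Union>K" using UN.IH by blast
    qed
  qed auto
next
  assume *: "\<forall>x\<in>U. \<exists>p. peval p x \<noteq> 0 \<and> {y. peval p y \<noteq> 0} \<subseteq> U"
  have "openin zariski {y. peval p y \<noteq> 0}" for p :: "'a cpoly"
    unfolding zariski_def by (rule topology_generated_by_Basis) auto
  then have "\<exists>T. openin zariski T \<and> x \<in> T \<and> T \<subseteq> U" if "x \<in> U" for x
    using *[rule_format, OF that] by (metis (mono_tags, lifting) mem_Collect_eq)
  then show "openin zariski U" by (intro openin_subopen[THEN iffD2] ballI)
qed

lemma topspace_zariski [simp]: "topspace zariski = UNIV"
proof -
  have "openin zariski (UNIV :: (complex ^ 'a) set)" by (auto simp: openin_zariski intro: exI[of _ 1])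
  then show ?thesis using openin_subset by blast
qed

lemma closedin_zariski:
  "closedin zariski Z \<longleftrightarrow> (\<forall>x. x \<notin> Z \<longrightarrow> (\<exists>p. peval p x \<noteq> 0 \<and> (\<forall>y\<in>Z. peval p y = 0)))"
proof -
  have "closedin zariski Z \<longleftrightarrow> openin zariski (- Z)" by (simp add: closedin_def Compl_eq_Diff_UNIV)
  moreover have "{y. peval p y \<noteq> 0} \<subseteq> - Z \<longleftrightarrow> (\<forall>y\<in>Z. peval p y = 0)" for p by auto
  ultimately show ?thesis by (simp add: openin_zariski Ball_def)
qed

lemma closure_of_zariski:
  "zariski closure_of A = {x. \<forall>p. (\<forall>y\<in>A. peval p y = 0) \<longrightarrow> peval p x = 0}" (is "_ = ?C")
proof (rule closure_of_unique)
  show "A \<subseteq> ?C" by auto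
  show "closedin zariski ?C" unfolding closedin_zariski by blast
  fix T assume T: "A \<subseteq> T" "closedin zariski T"
  show "?C \<subseteq> T"
  proof
    fix x assume x: "x \<in> ?C"
    show "x \<in> T"
    proof (rule ccontr)
      assume "x \<notin> T"
      then obtain p where "peval p x \<noteq> 0" "\<forall>y\<in>T. peval p y = 0" using T(2) closedin_zariski by blast
      then show False using x T(1) by blast
    qed
  qed
qed

lemma openin_subtopology_zariski:
  "openin (subtopology zariski S) U \<longleftrightarrow>
     U \<subseteq> S \<and> (\<forall>x\<in>U. \<exists>p. peval p x \<noteq> 0 \<and> {y\<in>S. peval p y \<noteq> 0} \<subseteq> U)"
proof
  assume "openin (subtopology zariski S) U"
  then obtain T where T: "openin zariski T" "U = T \<inter> S" unfolding openin_subtopology by blast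
  show "U \<subseteq> S \<and> (\<forall>x\<in>U. \<exists>p. peval p x \<noteq> 0 \<and> {y\<in>S. peval p y \<noteq> 0} \<subseteq> U)"
    using T by (fastforce simp: openin_zariski)
next
  assume *: "U \<subseteq> S \<and> (\<forall>x\<in>U. \<exists>p. peval p x \<noteq> 0 \<and> {y\<in>S. peval p y \<noteq> 0} \<subseteq> U)"
  have "openin (subtopology zariski S) {y\<in>S. peval p y \<noteq> 0}" for p
    unfolding openin_subtopology
    by (intro exI[of _ "{y. peval p y \<noteq> 0}"]) (auto simp: openin_zariski)
  then show "openin (subtopology zariski S) U"
    using * by (intro openin_subopen[THEN iffD2]) blast
qed

section \<open>Homogeneous polynomials and the topology of projective space\<close>

definition proj_basic :: "'m::finite cpoly \<Rightarrow> 'm proj set" where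
  "proj_basic p = {L \<in> proj_space. \<forall>v\<in>L - {0}. peval p v \<noteq> 0}"

lemma homogeneous_0 [simp]: "homogeneous d 0"
  by (simp add: homogeneous_def)

lemma homogeneous_const [simp]: "homogeneous 0 (const_poly c)"
  by (auto simp: homogeneous_def const_poly_def)

lemma homogeneous_1 [simp]: "homogeneous 0 1"
  using homogeneous_const[of 1] by simp

lemma homogeneous_var: "homogeneous 1 (var_poly i)"
  by (simp add: homogeneous_def var_poly_def lookup_single when_def)

lemma homogeneous_add: "homogeneous d p \<Longrightarrow> homogeneous d q \<Longrightarrow> homogeneous d (p + q)"
  using keys_add[of p q] unfolding homogeneous_def by blast

lemma homogeneous_mult:
  assumes "homogeneous d p" "homogeneous e q" shows "homogeneous (d + e) (p * q)"
  unfolding homogeneous_def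
proof
  fix a assume "a \<in> pkeys (p * q)"
  then obtain b c where "a = b + c" "b \<in> pkeys p" "c \<in> pkeys q" using keys_mult by blast
  then show "(\<Sum>i\<in>UNIV. plookup a i) = d + e"
    using assms by (simp add: lookup_add sum.distrib homogeneous_def)
qed

lemma homogeneous_power: "homogeneous d p \<Longrightarrow> homogeneous (n * d) (p ^ n)"
  by (induction n) (auto intro: homogeneous_mult)

lemma homogeneous_prod:
  "(\<And>i. i \<in> A \<Longrightarrow> homogeneous (d i) (f i)) \<Longrightarrow> homogeneous (\<Sum>i\<in>A. d i) (\<Prod>i\<in>A. f i)"
  by (induction A rule: infinite_finite_induct) (auto intro: homogeneous_mult)

lemma homogeneous_sum: "(\<And>i. i \<in> A \<Longrightarrow> homogeneous d (f i)) \<Longrightarrow> homogeneous d (\<Sum>i\<in>A. f i)"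
  by (induction A rule: infinite_finite_induct) (auto intro: homogeneous_add)

lemma in_proj_point: "v \<in> proj_point v"
  unfolding proj_point_def by (rule range_eqI[of _ _ 1]) simp

lemma proj_point_in_space [simp]: "proj_point v \<in> proj_space \<longleftrightarrow> v \<noteq> 0"
proof
  assume "proj_point v \<in> proj_space"
  then obtain w where w: "proj_point v = proj_point w" "w \<noteq> 0" by (auto simp: proj_space_def)
  have "w \<in> proj_point v" unfolding w(1) by (rule in_proj_point)
  then show "v \<noteq> 0" using w(2) by (auto simp: proj_point_def)
qed (simp add: proj_space_def)

lemma proj_point_scale: "c \<noteq> 0 \<Longrightarrow> proj_point (c *s v) = proj_point v"
  unfolding proj_point_def
proof (intro set_eqI iffI)
  fix x assume "c \<noteq> 0" "x \<in> range (\<lambda>t. t *s v)"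
  then obtain t where "x = t *s v" by blast
  then have "x = (t / c) *s (c *s v)" using \<open>c \<noteq> 0\<close> by simp
  then show "x \<in> range (\<lambda>t. t *s (c *s v))" by blast
next
  fix x assume "x \<in> range (\<lambda>t. t *s (c *s v))"
  then obtain t where "x = t *s (c *s v)" by blast
  then have "x = (t * c) *s v" by simp
  then show "x \<in> range (\<lambda>t. t *s v)" by blast
qed

lemma proj_point_eqD:
  assumes "proj_point v = proj_point w" "v \<noteq> 0" obtains c where "c \<noteq> 0" "v = c *s w"
  using in_proj_point[of v] assms by (auto simp: proj_point_def)

lemma proj_point_in_basic:
  assumes "homogeneous d p" "v \<noteq> 0"
  shows "proj_point v \<in> proj_basic p \<longleftrightarrow> peval p v \<noteq> 0"
proof
  show "proj_point v \<in> proj_basic p \<Longrightarrow> peval p v \<noteq> 0"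
    using in_proj_point[of v] assms(2) by (auto simp: proj_basic_def)
  show "peval p v \<noteq> 0 \<Longrightarrow> proj_point v \<in> proj_basic p"
    using assms peval_homogeneous_scale[of d p] proj_point_in_space[of v]
    unfolding proj_basic_def by (auto simp: proj_point_def)
qed

lemma proj_basic_mult: "proj_basic (p * q) = proj_basic p \<inter> proj_basic q"
  by (auto simp: proj_basic_def)

lemma openin_proj_zariski:
  "openin proj_zariski U \<longleftrightarrow>
     (\<forall>L\<in>U. \<exists>p d. homogeneous d p \<and> L \<in> proj_basic p \<and> proj_basic p \<subseteq> U)"
proof
  let ?B = "{{L \<in> proj_space. \<forall>v\<in>L - {0}. peval p v \<noteq> 0} | p d. homogeneous d p}"
  assume "openin proj_zariski U"
  then have "generate_topology_on ?B U"
    unfolding proj_zariski_def by (rule openin_topology_generated_by)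
  then show "\<forall>L\<in>U. \<exists>p d. homogeneous d p \<and> L \<in> proj_basic p \<and> proj_basic p \<subseteq> U"
  proof induction
    case (Int a b)
    show ?case
    proof
      fix L assume "L \<in> a \<inter> b"
      then obtain p d q e where "homogeneous d p" "L \<in> proj_basic p" "proj_basic p \<subseteq> a"
        "homogeneous e q" "L \<in> proj_basic q" "proj_basic q \<subseteq> b"
        using Int.IH by blast
      then show "\<exists>p d. homogeneous d p \<and> L \<in> proj_basic p \<and> proj_basic p \<subseteq> a \<inter> b"
        using homogeneous_mult by (intro exI[of _ "p * q"] exI[of _ "d + e"]) (auto simp: proj_basic_mult)
    qed
  next
    case (UN K)
    show ?case
    proof
      fix L assume "L \<in> \<Union>K"
      then obtain k where "k \<in> K" "L \<in> k" by blast
      then show "\<exists>p d. homogeneous d p \<and> L \<in> proj_basic p \<and> proj_basic p \<subseteq> \<Union>K"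
        using UN.IH by (meson Sup_upper subset_trans)
    qed
  next
    case (Basis s)
    then show ?case by (auto simp: proj_basic_def)
  qed auto
next
  assume *: "\<forall>L\<in>U. \<exists>p d. homogeneous d p \<and> L \<in> proj_basic p \<and> proj_basic p \<subseteq> U"
  have "openin proj_zariski (proj_basic p)" if "homogeneous d p" for p :: "'a cpoly" and d
    unfolding proj_zariski_def proj_basic_def using that by (intro topology_generated_by_Basis) auto
  then have "\<forall>L\<in>U. \<exists>T. openin proj_zariski T \<and> L \<in> T \<and> T \<subseteq> U"
    using * by meson
  then show "openin proj_zariski U" by (rule openin_subopen[THEN iffD2])
qed

lemma openin_proj_basic: "homogeneous d p \<Longrightarrow> openin proj_zariski (proj_basic p)"
  unfolding openin_proj_zariski by blast

lemma topspace_proj_zariski [simp]: "topspace (proj_zariski :: 'm::finite proj topology) = proj_space"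
proof
  show "topspace proj_zariski \<subseteq> (proj_space :: 'm proj set)"
    using openin_topspace[of proj_zariski] unfolding openin_proj_zariski proj_basic_def by blast
  have "proj_basic (1 :: 'm cpoly) = proj_space" by (simp add: proj_basic_def)
  then show "(proj_space :: 'm proj set) \<subseteq> topspace proj_zariski"
    using openin_proj_basic[OF homogeneous_1] openin_subset by metis
qed

section \<open>Algebraic dependence of rational functions\<close>

text \<open>Gaussian elimination: a nonzero entry in column b serves as pivot, the other rows are
  cleared in that column, and a relation among the cleared rows extends to the pivot row.\<close>

lemma nontrivial_linear_relation:
  fixes M :: "'a \<Rightarrow> 'b \<Rightarrow> 'c::field"
  assumes "finite B" "finite A" "card B < card A"
  shows "\<exists>c. (\<exists>a\<in>A. c a \<noteq> 0) \<and> (\<forall>b\<in>B. (\<Sum>a\<in>A. c a * M a b) = 0)"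
  using assms
proof (induction B arbitrary: A M rule: finite_induct)
  case empty
  then obtain a where "a \<in> A" by fastforce
  then show ?case by (intro exI[of _ "\<lambda>a. 1"]) auto
next
  case (insert b B)
  show ?case
  proof (cases "\<forall>a\<in>A. M a b = 0")
    case True
    then have "(\<Sum>a\<in>A. c a * M a b) = 0" for c by simp
    moreover obtain c where "\<exists>a\<in>A. c a \<noteq> 0" "\<forall>b\<in>B. (\<Sum>a\<in>A. c a * M a b) = 0"
      using insert.IH[of A M] insert.prems insert.hyps by auto
    ultimately show ?thesis by auto
  next
    case False
    then obtain a0 where a0: "a0 \<in> A" "M a0 b \<noteq> 0" by blast
    define M' where "M' a b' = M a b' - M a b / M a0 b * M a0 b'" for a b'
    have "card B < card (A - {a0})" using insert a0 by simp
    then obtain c where c: "\<exists>a\<in>A - {a0}. c a \<noteq> 0" "\<forall>b'\<in>B. (\<Sum>a\<in>A - {a0}. c a * M' a b') = 0"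
      using insert.IH[of "A - {a0}" M'] insert.prems by auto
    define c' where "c' a = (if a = a0 then - (\<Sum>a\<in>A - {a0}. c a * (M a b / M a0 b)) else c a)" for a
    have sum: "(\<Sum>a\<in>A. c' a * M a b') = (\<Sum>a\<in>A - {a0}. c a * M' a b')" for b'
    proof -
      have "(\<Sum>a\<in>A. c' a * M a b') = c' a0 * M a0 b' + (\<Sum>a\<in>A - {a0}. c a * M a b')"
        using insert.prems a0 by (subst sum.remove[of A a0]) (auto simp: c'_def intro!: sum.cong)
      also have "\<dots> = (\<Sum>a\<in>A - {a0}. c a * M' a b')"
        by (simp add: c'_def M'_def algebra_simps sum_subtractf sum_distrib_left)
      finally show ?thesis .
    qed
    have "(\<Sum>a\<in>A. c' a * M a b) = 0" unfolding sum using a0 by (simp add: M'_def)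
    moreover have "\<exists>a\<in>A. c' a \<noteq> 0" using c(1) by (auto simp: c'_def)
    ultimately show ?thesis using c(2) sum by (intro exI[of _ c']) auto
  qed
qed

section \<open>Polynomials composed with rational functions\<close>

abbreviation quotient_point ::
  "('n::finite \<Rightarrow> 'm::finite cpoly) \<Rightarrow> ('n \<Rightarrow> 'm cpoly) \<Rightarrow> complex ^ 'm \<Rightarrow> complex ^ 'n" where
  "quotient_point G H u \<equiv> \<chi> i. peval (G i) u / peval (H i) u"

text \<open>The monomial a in the fractions \<open>p i / q i\<close>, times the N-th power of the
  product of all denominators. The same power serves for every a with exponents at most N, so sums
  of monomials get one denominator.\<close>

definition clear_denominators ::
  "('n::finite \<Rightarrow> 'm::finite cpoly) \<Rightarrow> ('n \<Rightarrow> 'm cpoly) \<Rightarrow> nat \<Rightarrow> ('n \<Rightarrow>\<^sub>0 nat) \<Rightarrow> 'm cpoly" where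
  "clear_denominators p q N a = (\<Prod>i\<in>UNIV. p i ^ plookup a i * q i ^ (N - plookup a i))"

lemma peval_clear_denominators:
  assumes "\<And>i. plookup a i \<le> N" "\<And>i. peval (q i) u \<noteq> 0"
  shows "peval (clear_denominators p q N a) u =
    (\<Prod>i\<in>UNIV. peval (q i) u) ^ N * monomial_value a (quotient_point p q u)"
proof -
  have "peval (p i) u ^ plookup a i * peval (q i) u ^ (N - plookup a i) =
      peval (q i) u ^ N * (peval (p i) u / peval (q i) u) ^ plookup a i" for i
    using assms(1)[of i] assms(2)[of i] by (simp add: power_divide power_diff)
  then show ?thesis
    by (simp add: clear_denominators_def monomial_value_def prod_power_distrib flip: prod.distrib)
qed

lemma homogeneous_clear_denominators:
  assumes "\<And>i. homogeneous (e i) (p i)" "\<And>i. homogeneous (e i) (q i)" "\<And>i. plookup a i \<le> N"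
  shows "homogeneous (\<Sum>i\<in>UNIV. N * e i) (clear_denominators p q N a)"
  unfolding clear_denominators_def
proof (rule homogeneous_prod)
  fix i
  have "homogeneous (plookup a i * e i + (N - plookup a i) * e i) (p i ^ plookup a i * q i ^ (N - plookup a i))"
    using assms by (intro homogeneous_mult homogeneous_power)
  then show "homogeneous (N * e i) (p i ^ plookup a i * q i ^ (N - plookup a i))"
    using assms(3)[of i] by (simp flip: add_mult_distrib)
qed

text \<open>Values and degrees are asserted together because they concern the same A and C: on
  affine sets the values suffice, on projective space A and C must also have equal degrees.\<close>

lemma compose_rational:
  fixes G H :: "'n::finite \<Rightarrow> 'm::finite cpoly"
  shows "\<exists>A C. (\<forall>u. (\<forall>i. peval (H i) u \<noteq> 0) \<longrightarrow> peval C u \<noteq> 0 \<and>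
      peval p (quotient_point G H u) = peval A u / peval C u) \<and>
    (\<forall>e. (\<forall>i. homogeneous (e i) (G i) \<and> homogeneous (e i) (H i)) \<longrightarrow>
      (\<exists>d. homogeneous d A \<and> homogeneous d C))"
proof -
  define N where "N = (\<Sum>i\<in>UNIV. degree_in i p)"
  have N: "plookup a i \<le> N" if "a \<in> pkeys p" for a i
  proof -
    have "plookup a i \<le> degree_in i p" using that degree_in_le_iff[of i p] by blast
    also have "\<dots> \<le> N" unfolding N_def by (rule member_le_sum) auto
    finally show ?thesis .
  qed
  define A where "A = (\<Sum>a\<in>pkeys p. const_poly (plookup p a) * clear_denominators G H N a)"
  define C where "C = (\<Prod>i\<in>UNIV. H i) ^ N"
  have "peval C u \<noteq> 0 \<and> peval p (quotient_point G H u) = peval A u / peval C u"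
    if nz: "\<forall>i. peval (H i) u \<noteq> 0" for u
  proof -
    have C: "peval C u \<noteq> 0" using nz by (simp add: C_def)
    have "peval A u = peval C u * peval p (quotient_point G H u)"
      unfolding peval_superset[OF finite_keys order_refl, of p] using nz N
      by (simp add: A_def C_def sum_distrib_left peval_clear_denominators mult_ac cong: sum.cong)
    then show ?thesis using C by simp
  qed
  moreover have "\<exists>d. homogeneous d A \<and> homogeneous d C"
    if e: "\<forall>i. homogeneous (e i) (G i) \<and> homogeneous (e i) (H i)" for e
  proof -
    have "homogeneous (0 + (\<Sum>i\<in>UNIV. N * e i)) A"
      unfolding A_def using e N
      by (intro homogeneous_sum homogeneous_mult homogeneous_const homogeneous_clear_denominators) auto
    moreover have "homogeneous (N * (\<Sum>i\<in>UNIV. e i)) C"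
      unfolding C_def using e by (intro homogeneous_power homogeneous_prod) auto
    ultimately show ?thesis by (auto simp: sum_distrib_left)
  qed
  ultimately show ?thesis by blast
qed

text \<open>Composed with G / H, f becomes a fraction whose numerator A vanishes wherever E * p does
  not. So A * (E * p) = 0, and A = 0.\<close>

lemma rational_vanishing_extends:
  assumes "E \<noteq> 0" "p \<noteq> 0" "\<And>v k. peval p v \<noteq> 0 \<Longrightarrow> peval (H k) v \<noteq> 0"
    and zero: "\<And>v. peval E v \<noteq> 0 \<Longrightarrow> peval p v \<noteq> 0 \<Longrightarrow> peval f (quotient_point G H v) = 0"
    and v: "peval p v \<noteq> 0"
  shows "peval f (quotient_point G H v) = 0"
proof -
  obtain A D where "\<And>v. \<forall>k. peval (H k) v \<noteq> 0 \<Longrightarrow> peval D v \<noteq> 0 \<and>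
      peval f (quotient_point G H v) = peval A v / peval D v"
    using compose_rational[of H f G] by blast
  then have AD: "peval D v \<noteq> 0 \<and> peval f (quotient_point G H v) = peval A v / peval D v"
    if "peval p v \<noteq> 0" for v
    using assms(3)[OF that] by blast
  have "peval (A * (E * p)) u = 0" for u
    using AD[of u] zero[of u] by auto
  then have "A * (E * p) = 0" using peval_nonzero by blast
  then have "A = 0" using assms(1,2) by (simp add: cpoly_mult_eq_0_iff)
  then show ?thesis using AD[OF v] by simp
qed

lemma degree_in_power_le: "degree_in x p \<le> d \<Longrightarrow> degree_in x (p ^ n) \<le> n * d"
proof (induction n)
  case (Suc n)
  then show ?case using degree_in_mult_le[of x p "p ^ n"] by fastforce
qed simp

lemma degree_in_prod_le:
  "(\<And>i. i \<in> A \<Longrightarrow> degree_in x (f i) \<le> d) \<Longrightarrow> degree_in x (\<Prod>i\<in>A. f i) \<le> card A * d"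
proof (induction A rule: infinite_finite_induct)
  case (insert a A)
  then have "degree_in x (f a) \<le> d" "degree_in x (\<Prod>i\<in>A. f i) \<le> card A * d" by auto
  then show ?case
    using degree_in_mult_le[of x "f a" "\<Prod>i\<in>A. f i"] insert.hyps by simp
qed auto

lemma lookup_Abs_finite [simp]: "plookup (Abs_poly_mapping f) = (f :: 'n::finite \<Rightarrow> nat)"
  by simp

text \<open>
  The products \<open>\<Prod>\<^sub>i (p\<^sub>i/q\<^sub>i)\<^bsup>a i\<^esup>\<close> with all \<open>a i < N\<close> have a common denominator and numerators of degree
  \<open>O(N)\<close>, so for large \<open>N\<close> there are more of them than monomials available for the numerators.
\<close>

theorem rational_functions_dependent:
  fixes p q :: "'n::finite \<Rightarrow> 'm::finite cpoly"
  assumes "CARD('m) < CARD('n)"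
  shows "\<exists>P. P \<noteq> 0 \<and> (\<forall>u. (\<forall>i. peval (q i) u \<noteq> 0) \<longrightarrow>
    peval P (quotient_point p q u) = 0)"
proof -
  let ?m = "CARD('m)" and ?n = "CARD('n)"
  define d where "d = (\<Sum>i\<in>UNIV. \<Sum>x\<in>UNIV. degree_in x (p i) + degree_in x (q i))"
  have d: "degree_in x (p i) \<le> d" "degree_in x (q i) \<le> d" for x i
  proof -
    have "degree_in x (p i) + degree_in x (q i) \<le> (\<Sum>x\<in>UNIV. degree_in x (p i) + degree_in x (q i))"
      by (rule member_le_sum) auto
    also have "\<dots> \<le> d" unfolding d_def
      by (rule member_le_sum[of i UNIV "\<lambda>i. \<Sum>x\<in>UNIV. degree_in x (p i) + degree_in x (q i)"]) auto
    finally show "degree_in x (p i) \<le> d" "degree_in x (q i) \<le> d" by simp_all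
  qed
  \<comment> \<open>Write m and n for the two cardinalities. The numerators have degree at most K =
    n N d in each variable, which leaves (K + 1)^m \<le> (n d + 1)^m N^m monomials. As N > (n d +
    1)^m and n \<ge> m + 1, this is less than N^n, the number of products.\<close>
  define N where "N = (?n * d + 1) ^ ?m + 1"
  define K where "K = ?n * (N * d)"
  define A where "A = (UNIV :: 'n set) \<rightarrow>\<^sub>E {..<N}"
  define B where "B = (UNIV :: 'm set) \<rightarrow>\<^sub>E {..K}"
  define T where "T f = clear_denominators p q N (Abs_poly_mapping f)" for f
  have "N \<ge> 1" by (simp add: N_def)
  have "K + 1 \<le> (?n * d + 1) * N" using \<open>N \<ge> 1\<close> by (simp add: K_def algebra_simps)
  then have "(K + 1) ^ ?m \<le> ((?n * d + 1) * N) ^ ?m" by (rule power_mono) simp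
  also have "\<dots> = (?n * d + 1) ^ ?m * N ^ ?m" by (rule power_mult_distrib)
  also have "\<dots> < N * N ^ ?m" using \<open>N \<ge> 1\<close> by (intro mult_strict_right_mono) (simp_all add: N_def)
  also have "\<dots> \<le> N ^ ?n" using assms \<open>N \<ge> 1\<close> power_increasing[of "Suc ?m" ?n N] by simp
  finally have "card B < card A" by (simp add: A_def B_def card_funcsetE)
  moreover have fin: "finite A" "finite B" by (simp_all add: A_def B_def finite_PiE)
  ultimately obtain c where c: "\<exists>f\<in>A. c f \<noteq> 0"
    "\<forall>b\<in>B. (\<Sum>f\<in>A. c f * plookup (T f) (Abs_poly_mapping b)) = 0"
    using nontrivial_linear_relation[of B A "\<lambda>f b. plookup (T f) (Abs_poly_mapping b)"] by blast
  have T_degree: "degree_in x (T f) \<le> K" if "f \<in> A" for x f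
    unfolding T_def clear_denominators_def K_def
  proof (rule degree_in_prod_le)
    fix i
    have "f i < N" using that by (auto simp: A_def)
    have "degree_in x (p i ^ f i * q i ^ (N - f i)) \<le> f i * d + (N - f i) * d"
      using degree_in_mult_le[of x "p i ^ f i" "q i ^ (N - f i)"]
        degree_in_power_le[OF d(1)[of x i], of "f i"] degree_in_power_le[OF d(2)[of x i], of "N - f i"] by simp
    also have "\<dots> = N * d" using \<open>f i < N\<close> by (simp flip: add_mult_distrib)
    finally show "degree_in x (p i ^ plookup (Abs_poly_mapping f) i * q i ^ (N - plookup (Abs_poly_mapping f) i)) \<le> N * d"
      by simp
  qed
  have relation: "(\<Sum>f\<in>A. const_poly (c f) * T f) = 0"
  proof (rule poly_mapping_eqI)
    fix b :: "'m \<Rightarrow>\<^sub>0 nat"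
    have lookup: "plookup (\<Sum>f\<in>A. const_poly (c f) * T f) b = (\<Sum>f\<in>A. c f * plookup (T f) b)"
      unfolding lookup_sum const_poly_def mult_map_scale_conv_mult[symmetric]
      by (intro sum.cong) (simp_all add: map.rep_eq when_def)
    show "plookup (\<Sum>f\<in>A. const_poly (c f) * T f) b = plookup 0 b"
    proof (cases "\<forall>x. plookup b x \<le> K")
      case True
      then have "plookup b \<in> B" by (auto simp: B_def)
      then show ?thesis unfolding lookup using c(2) by fastforce
    next
      case False
      then obtain x where "plookup b x > K" by (auto simp: not_le)
      then have "b \<notin> pkeys (T f)" if "f \<in> A" for f
        using T_degree[OF that, of x] degree_in_le_iff[of x "T f" K] by auto
      then show ?thesis unfolding lookup by (simp add: in_keys_iff)
    qed
  qed
  define P where "P = (\<Sum>f\<in>A. psingle (Abs_poly_mapping f) (c f))"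
  have "P \<noteq> 0"
  proof -
    obtain f where f: "f \<in> A" "c f \<noteq> 0" using c(1) by blast
    have "plookup P (Abs_poly_mapping f) = (\<Sum>g\<in>A. if g = f then c f else 0)"
      unfolding P_def lookup_sum
      by (intro sum.cong) (auto simp: lookup_single when_def poly_mapping_eq_iff)
    then have "plookup P (Abs_poly_mapping f) \<noteq> 0" using f fin by simp
    then show ?thesis by auto
  qed
  moreover have "peval P (quotient_point p q u) = 0"
    if nz: "\<forall>i. peval (q i) u \<noteq> 0" for u
  proof -
    let ?z = "quotient_point p q u"
    have T: "peval (T f) u = (\<Prod>i\<in>UNIV. peval (q i) u) ^ N * monomial_value (Abs_poly_mapping f) ?z"
      if "f \<in> A" for f
      unfolding T_def using that nz
      by (intro peval_clear_denominators) (auto simp: A_def PiE_def Pi_def less_imp_le)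
    have "0 = (\<Sum>f\<in>A. c f * peval (T f) u)"
      using arg_cong[OF relation, of "\<lambda>r. peval r u"] by simp
    also have "\<dots> = (\<Prod>i\<in>UNIV. peval (q i) u) ^ N * peval P ?z"
      by (simp add: T P_def sum_distrib_left mult_ac cong: sum.cong)
    finally show ?thesis using nz by simp
  qed
  ultimately show ?thesis by blast
qed

section \<open>Generic rank of a parametrization\<close>

lemma eventually_peval_line:
  assumes "peval p u \<noteq> 0" shows "eventually (\<lambda>t. peval p (u + t *s v) \<noteq> 0) (nhds 0)"
proof -
  let ?f = "\<lambda>t. peval p (u + t *s v)"
  have "isCont ?f 0" using DERIV_peval_line DERIV_isCont by blast
  then have "(?f \<longlongrightarrow> ?f 0) (nhds 0)" 
    unfolding isCont_def by (rule tendsto_at_iff_tendsto_nhds[THEN iffD1])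
  moreover have "?f 0 \<noteq> 0" using assms by simp
  ultimately show ?thesis by (rule tendsto_imp_eventually_ne)
qed

lemma DERIV_eventually_zero:
  assumes "(f has_field_derivative D) (at 0)" "eventually (\<lambda>t. f t = 0) (nhds 0)"
  shows "D = (0 :: complex)"
proof -
  have "((\<lambda>t. 0) has_field_derivative D) (at 0)"
    using assms DERIV_cong_ev[of 0 0 f "\<lambda>t. 0" D D] by simp
  then show ?thesis using DERIV_const DERIV_unique by blast
qed

lemma coord_specialization:
  "\<exists>c. degree_in x c = 0 \<and> (\<forall>y. peval c y = peval p (set_coord x s y))"
proof -
  define c where "c = (\<Sum>j\<le>degree_in x p. coeff_in x j p * const_poly (s ^ j))"
  have "c \<in> vars_in (- {x})"
  proof -
    have "coeff_in x j p * const_poly (s ^ j) \<in> vars_in (- {x})" for j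
      by (intro vars_in_mult) (auto simp: vars_in_def)
    then show ?thesis unfolding c_def by (intro vars_in_sum)
  qed
  moreover have "peval c y = peval p (set_coord x s y)" for y
    unfolding poly_slice_poly[symmetric] by (simp add: c_def slice_poly_def poly_sum poly_monom)
  ultimately show ?thesis by (auto simp: vars_in_def)
qed

text \<open>Scaling u moves a nonzero \<open>u $ j\<close> to any s \<noteq> 0 and keeps
  \<open>\<Phi> u\<close>. So Q with s put for the coordinate k0 vanishes on the image, hence on the
  hypersurface, which is impossible for a nonzero polynomial free of k0. In other words,
  \<open>u $ j\<close> and the coordinates of \<open>\<Phi> u\<close> other than k0 are
  algebraically independent.\<close>

lemma rational_parametrization_independent:
  assumes k0: "degree_in k0 \<Delta> > 0" and B: "B \<noteq> 0"
    and dense: "\<And>f E. E \<noteq> 0 \<Longrightarrow> (\<And>u. peval E u \<noteq> 0 \<Longrightarrow> peval B u \<noteq> 0 \<Longrightarrow> peval f (\<Phi> u) = 0) \<Longrightarrow>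
      \<forall>y\<in>hypersurface \<Delta>. peval f y = 0"
    and scale: "\<And>u t. peval B u \<noteq> 0 \<Longrightarrow> t \<noteq> 0 \<Longrightarrow> peval B (t *s u) \<noteq> 0 \<and> \<Phi> (t *s u) = \<Phi> u"
    and Q: "\<And>u. peval B u \<noteq> 0 \<Longrightarrow> peval Q (set_coord k0 (u $ j) (\<Phi> u)) = 0"
  shows "Q = 0"
proof (rule ccontr)
  assume "Q \<noteq> 0"
  \<comment> \<open>The value s comes from a point where Q does not vanish; it must be nonzero to be
    reached by scaling.\<close>
  have "Q * var_poly k0 \<noteq> 0" using \<open>Q \<noteq> 0\<close> var_poly_nonzero cpoly_mult_eq_0_iff by blast
  then obtain y0 where "peval (Q * var_poly k0) y0 \<noteq> 0" using peval_nonzero by blast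
  then have y0: "peval Q y0 \<noteq> 0" "y0 $ k0 \<noteq> 0" by auto
  define s where "s = y0 $ k0"
  obtain c where c: "degree_in k0 c = 0" "\<And>y. peval c y = peval Q (set_coord k0 s y)"
    using coord_specialization by blast
  have "set_coord k0 s y0 = y0" by (simp add: vec_eq_iff s_def)
  then have "c \<noteq> 0" using c(2)[of y0] y0(1) by auto
  have "\<forall>y\<in>hypersurface \<Delta>. peval c y = 0"
  proof (rule dense)
    show "var_poly j \<noteq> 0" by (rule var_poly_nonzero)
    fix u assume u: "peval (var_poly j) u \<noteq> 0" "peval B u \<noteq> 0"
    let ?t = "s / u $ j"
    have "?t \<noteq> 0" using y0(2) u(1) by (simp add: s_def)
    then have "peval B (?t *s u) \<noteq> 0" "\<Phi> (?t *s u) = \<Phi> u" using scale u(2) by blast+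
    then show "peval c (\<Phi> u) = 0" using Q[of "?t *s u"] u(1) c(2) by simp
  qed
  then show False
    using point_on_hypersurface[OF k0 \<open>c \<noteq> 0\<close> c(1)] by (auto simp: hypersurface_def)
qed

lemma finite_prod_cpoly_nonzero:
  assumes "\<And>i. f i \<noteq> 0" shows "(\<Prod>i\<in>(UNIV :: 'i::finite set). f i) \<noteq> (0 :: 'm::finite cpoly)"
  using assms cpoly_prod_eq_0_iff[of UNIV f] by simp

text \<open>
  Together with the coordinate \<open>u\<^sub>j\<close> (which is not invariant under scaling), all coordinates of \<open>\<Phi>\<close>
  but one form a transcendence basis; each \<open>u\<^sub>i\<close> is algebraic over it, and differentiating a minimal
  equation for \<open>u\<^sub>i\<close> bounds the kernel of the Jacobian.
\<close>

theorem rational_parametrization_rank: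
  fixes \<Delta> B :: "'m::finite cpoly" and G H :: "'m \<Rightarrow> 'm cpoly"
  defines "\<Phi> \<equiv> \<lambda>u. quotient_point G H u"
  assumes irr: "irreducible \<Delta>" and B: "B \<noteq> 0"
    and H: "\<And>u k. peval B u \<noteq> 0 \<Longrightarrow> peval (H k) u \<noteq> 0"
    and dense: "\<And>f E. E \<noteq> 0 \<Longrightarrow> (\<And>u. peval E u \<noteq> 0 \<Longrightarrow> peval B u \<noteq> 0 \<Longrightarrow> peval f (\<Phi> u) = 0) \<Longrightarrow>
      \<forall>y\<in>hypersurface \<Delta>. peval f y = 0"
    and scale: "\<And>u t. peval B u \<noteq> 0 \<Longrightarrow> t \<noteq> 0 \<Longrightarrow> peval B (t *s u) \<noteq> 0 \<and> \<Phi> (t *s u) = \<Phi> u"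
  shows "\<exists>E. E \<noteq> 0 \<and> (\<forall>u. peval E u \<noteq> 0 \<longrightarrow> (\<forall>w. w $ j = 0 \<longrightarrow>
      (\<forall>k. ((\<lambda>t. \<Phi> (u + t *s w) $ k) has_field_derivative 0) (at 0)) \<longrightarrow> w = 0))"
proof -
  obtain k0 where k0: "degree_in k0 \<Delta> > 0" using irreducible_nonconstant irr by blast
  have "\<exists>E. E \<noteq> 0 \<and> (\<forall>u. peval E u \<noteq> 0 \<longrightarrow> (\<forall>w. w $ j = 0 \<longrightarrow>
      (\<forall>k. ((\<lambda>t. \<Phi> (u + t *s w) $ k) has_field_derivative 0) (at 0)) \<longrightarrow> w $ i = 0))" for i
  proof -
    \<comment> \<open>These are m + 1 functions of m variables, hence dependent: \<open>None\<close>
      carries \<open>u $ i\<close>, and the slot k0, whose coordinate is algebraic over the others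
      on the hypersurface, carries \<open>u $ j\<close>.\<close>
    define G' where "G' o' = (case o' of None \<Rightarrow> var_poly i | Some k \<Rightarrow> if k = k0 then var_poly j else G k)" for o'
    define H' where "H' o' = (case o' of None \<Rightarrow> 1 | Some k \<Rightarrow> if k = k0 then 1 else H k)" for o'
    define z where "z u = (quotient_point G' H' u)" for u
    have z: "z u $ None = u $ i" "z u $ Some k = set_coord k0 (u $ j) (\<Phi> u) $ k" for u k
      by (simp_all add: z_def G'_def H'_def \<Phi>_def)
    have H': "peval (H' o') u \<noteq> 0" if "peval B u \<noteq> 0" for u o'
      using H[OF that] by (auto simp: H'_def split: option.split)
    define good where "good P \<longleftrightarrow> P \<noteq> 0 \<and> (\<forall>u. peval B u \<noteq> 0 \<longrightarrow> peval P (z u) = 0)" for P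
    have "\<exists>P. good P"
      using rational_functions_dependent[of H' G'] H' unfolding good_def z_def by fastforce
    \<comment> \<open>The degree in \<open>None\<close> is minimal, so that the derivative of P in
      this variable is not again a relation.\<close>
    then obtain P where P: "good P" and min: "\<And>R. good R \<Longrightarrow> degree_in None P \<le> degree_in None R"
      using ex_has_least_nat[of good _ "degree_in None"] by blast
    have "degree_in None P > 0"
    proof (rule ccontr)
      assume "\<not> degree_in None P > 0"
      then have P0: "P \<in> vars_in (- {None})" by (simp add: vars_in_def)
      \<comment> \<open>As P is free of \<open>None\<close>, it comes from a polynomial in m
        variables, to which the independence applies; the value 0 is arbitrary.\<close>
      define lift where "lift y = (\<chi> o'. case o' of None \<Rightarrow> 0 | Some k \<Rightarrow> y $ k)" for y :: "complex ^ 'm"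
      have "polyfun (\<lambda>y. peval P (lift y))"
      proof (rule polyfun_compose)
        show "polyfun (\<lambda>y. lift y $ o')" for o' by (cases o') (simp_all add: lift_def)
      qed
      then obtain Q where Q: "\<And>y. peval Q y = peval P (lift y)" by (auto simp: polyfun_def)
      have "Q = 0"
      proof (rule rational_parametrization_independent[OF k0 B dense scale])
        fix u assume u: "peval B u \<noteq> 0"
        have "peval P (lift (set_coord k0 (u $ j) (\<Phi> u))) = peval P (z u)"
          using P0 by (rule vars_in_cong) (auto simp: lift_def z split: option.split)
        then show "peval Q (set_coord k0 (u $ j) (\<Phi> u)) = 0" using P u Q by (simp add: good_def)
      qed
      have "peval P w = 0" for w
      proof -
        have "peval P w = peval P (lift (\<chi> k. w $ Some k))"
          using P0 by (rule vars_in_cong) (auto simp: lift_def split: option.split)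
        then show ?thesis using Q \<open>Q = 0\<close> by simp
      qed
      then have "P = 0" by (intro peval_eqI) simp
      then show False using P by (simp add: good_def)
    qed
    define R where "R = partial_deriv None P"
    have "R \<noteq> 0" "degree_in None R < degree_in None P"
      unfolding R_def using partial_deriv_degree_less \<open>degree_in None P > 0\<close> by blast+
    then have "\<not> good R" using min by fastforce
    then obtain u0 where u0: "peval B u0 \<noteq> 0" "peval R (z u0) \<noteq> 0"
      using \<open>R \<noteq> 0\<close> unfolding good_def by blast
    obtain A C where AC: "\<And>u. \<forall>o'. peval (H' o') u \<noteq> 0 \<Longrightarrow> peval C u \<noteq> 0 \<and> peval R (z u) = peval A u / peval C u"
      using compose_rational[of H' R G'] unfolding z_def by blast
    have "peval (A * B) u0 \<noteq> 0" using u0 AC[of u0] H' by auto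
    then have "A * B \<noteq> 0" by (rule peval_nonzeroD)
    moreover have "w $ i = 0" if u: "peval (A * B) u \<noteq> 0" and w: "w $ j = 0"
      and d: "\<forall>k. ((\<lambda>t. \<Phi> (u + t *s w) $ k) has_field_derivative 0) (at 0)" for u w
    proof -
      \<comment> \<open>Along w all slots but \<open>None\<close> are stationary: those of
        \<open>\<Phi>\<close> by assumption, the slot k0 because w $ j = 0. So the derivative of
        P(z) reduces to R(z) times w $ i.\<close>
      define z' where "z' o' = (case o' of None \<Rightarrow> w $ i | Some k \<Rightarrow> 0)" for o' :: "'m option"
      have "((\<lambda>t. z (u + t *s w) $ o') has_field_derivative z' o') (at 0)" for o'
      proof (cases o')
        case None
        then show ?thesis unfolding None z z'_def by (auto intro!: derivative_eq_intros)
      next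
        case (Some k)
        then show ?thesis unfolding Some z z'_def using d w
          by (cases "k = k0") (auto intro!: derivative_eq_intros)
      qed
      then have "((\<lambda>t. peval P (z (u + t *s w))) has_field_derivative
          (\<Sum>o'\<in>UNIV. peval (partial_deriv o' P) (z (u + 0 *s w)) * z' o')) (at 0)"
        by (rule DERIV_peval)
      moreover have "eventually (\<lambda>t. peval P (z (u + t *s w)) = 0) (nhds 0)"
      proof (rule eventually_mono)
        show "eventually (\<lambda>t. peval B (u + t *s w) \<noteq> 0) (nhds 0)"
          using u by (intro eventually_peval_line) auto
      qed (use P in \<open>simp add: good_def\<close>)
      ultimately have "(\<Sum>o'\<in>UNIV. peval (partial_deriv o' P) (z (u + 0 *s w)) * z' o') = 0"
        by (rule DERIV_eventually_zero)
      moreover have "(\<Sum>o'\<in>UNIV. peval (partial_deriv o' P) (z (u + 0 *s w)) * z' o') = peval R (z u) * (w $ i)"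
        unfolding UNIV_option_conv by (simp add: sum.reindex z'_def R_def)
      moreover have "peval R (z u) \<noteq> 0" using u AC[of u] H'[of u] by auto
      ultimately show ?thesis by simp
    qed
    ultimately show ?thesis by blast
  qed
  then obtain E where E: "\<And>i. E i \<noteq> 0" "\<And>i u w. peval (E i) u \<noteq> 0 \<Longrightarrow> w $ j = 0 \<Longrightarrow>
      \<forall>k. ((\<lambda>t. \<Phi> (u + t *s w) $ k) has_field_derivative 0) (at 0) \<Longrightarrow> w $ i = 0"
    by metis
  have "w = 0" if "peval (\<Prod>i\<in>UNIV. E i) u \<noteq> 0" "w $ j = 0"
    "\<forall>k. ((\<lambda>t. \<Phi> (u + t *s w) $ k) has_field_derivative 0) (at 0)" for u w
  proof -
    have "w $ i = 0" for i using that E(2)[of i u w] by simp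
    then show ?thesis by (simp add: vec_eq_iff)
  qed
  moreover have "(\<Prod>i\<in>UNIV. E i) \<noteq> 0" using E(1) by (rule finite_prod_cpoly_nonzero)
  ultimately show ?thesis by blast
qed

section \<open>Morphisms between affine and projective varieties\<close>

lemma vtop_affine [simp]: "vtop (affine_variety S) = subtopology zariski S"
  by (simp add: affine_variety_def)

lemma vtop_projective [simp]: "vtop projective_space_variety = proj_zariski"
  by (simp add: projective_space_variety_def)

lemma regular_on_affine: "f \<in> regular_on (affine_variety S) U \<longleftrightarrow> (\<forall>x\<in>U. \<exists>V g h.
    openin (subtopology zariski S) V \<and> x \<in> V \<and> V \<subseteq> U \<and>
    (\<forall>y\<in>V. peval h y \<noteq> 0 \<and> f y = peval g y / peval h y))"
  by (simp add: affine_variety_def)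

lemma regular_on_projective: "f \<in> regular_on projective_space_variety U \<longleftrightarrow> (\<forall>x\<in>U. \<exists>V g h d.
    openin proj_zariski V \<and> x \<in> V \<and> V \<subseteq> U \<and> homogeneous d g \<and> homogeneous d h \<and>
    (\<forall>L\<in>V. \<forall>v\<in>L - {0}. peval h v \<noteq> 0 \<and> f L = peval g v / peval h v))"
  by (simp add: projective_space_variety_def)

text \<open>Substituting the \<open>\<gamma> i\<close> turns polynomials into polynomials, so basic
  open sets and local fractions pull back to sets and fractions of the same form.\<close>

lemma morphism_to_projective:
  fixes \<phi> :: "complex ^ 'm::finite \<Rightarrow> 'n::finite proj" and \<gamma> :: "'n \<Rightarrow> 'm cpoly"
  assumes U: "openin (subtopology zariski S) U"
    and \<phi>: "\<And>y. y \<in> U \<Longrightarrow> \<phi> y = proj_point (\<chi> i. peval (\<gamma> i) y)"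
    and nz: "\<And>y. y \<in> U \<Longrightarrow> (\<chi> i. peval (\<gamma> i) y) \<noteq> 0"
  shows "morphism_on (affine_variety S) U projective_space_variety \<phi>"
proof -
  let ?g = "\<lambda>y. \<chi> i. peval (\<gamma> i) y"
  have US: "U \<subseteq> S" using U openin_subset by fastforce
  have pull: "\<exists>q. \<forall>y. peval q y = peval p (?g y)" for p :: "'n cpoly"
    using polyfun_compose[of "\<lambda>y. ?g y" p] by (auto simp: polyfun_def)
  have pre: "openin (subtopology zariski S) {y \<in> U. \<phi> y \<in> V}" if V: "openin proj_zariski V" for V :: "'n proj set"
    unfolding openin_subtopology_zariski
  proof (intro conjI ballI)
    show "{y \<in> U. \<phi> y \<in> V} \<subseteq> S" using US by auto
    fix x assume x: "x \<in> {y \<in> U. \<phi> y \<in> V}"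
    then obtain p d where p: "homogeneous d p" "\<phi> x \<in> proj_basic p" "proj_basic p \<subseteq> V"
      using V unfolding openin_proj_zariski by blast
    obtain q where q: "\<And>y. peval q y = peval p (?g y)" using pull by blast
    obtain r where r: "peval r x \<noteq> 0" "{y\<in>S. peval r y \<noteq> 0} \<subseteq> U"
      using U x unfolding openin_subtopology_zariski by blast
    have basic: "\<phi> y \<in> proj_basic p \<longleftrightarrow> peval q y \<noteq> 0" if "y \<in> U" for y
      using proj_point_in_basic[OF p(1) nz[OF that]] \<phi>[OF that] q by simp
    have "peval (q * r) x \<noteq> 0" using basic p(2) x r(1) by simp
    moreover have "{y \<in> S. peval (q * r) y \<noteq> 0} \<subseteq> {y \<in> U. \<phi> y \<in> V}"
      using r(2) basic p(3) by auto
    ultimately show "\<exists>p. peval p x \<noteq> 0 \<and> {y \<in> S. peval p y \<noteq> 0} \<subseteq> {y \<in> U. \<phi> y \<in> V}" by blast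
  qed
  have "continuous_map (subtopology (subtopology zariski S) U) proj_zariski \<phi>"
    unfolding continuous_map_def
  proof (intro conjI allI impI)
    show "\<phi> \<in> topspace (subtopology (subtopology zariski S) U) \<rightarrow> topspace proj_zariski"
      using \<phi> nz by auto
    fix V :: "'n proj set" assume V: "openin proj_zariski V"
    have top: "topspace (subtopology (subtopology zariski S) U) = U" using US by auto
    show "openin (subtopology (subtopology zariski S) U)
        {x \<in> topspace (subtopology (subtopology zariski S) U). \<phi> x \<in> V}"
      unfolding top
      by (rule openin_subtopology[THEN iffD2], rule exI[of _ "{x \<in> U. \<phi> x \<in> V}"])
        (use pre[OF V] in blast)
  qed
  moreover have "f \<circ> \<phi> \<in> regular_on (affine_variety S) (U \<inter> \<phi> -` V)"
    if V: "openin proj_zariski V" and f: "f \<in> regular_on projective_space_variety V" for V f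
    unfolding regular_on_affine
  proof
    fix x assume x: "x \<in> U \<inter> \<phi> -` V"
    then have "\<phi> x \<in> V" by simp
    from bspec[OF f[unfolded regular_on_projective] this]
    obtain V' g h d where V': "openin proj_zariski V'" "\<phi> x \<in> V'" "V' \<subseteq> V"
      "homogeneous d g" "homogeneous d h" "\<forall>L\<in>V'. \<forall>v\<in>L - {0}. peval h v \<noteq> 0 \<and> f L = peval g v / peval h v"
      by (elim exE conjE) (rule that)
    obtain g' where g': "\<And>y. peval g' y = peval g (?g y)" using pull by blast
    obtain h' where h': "\<And>y. peval h' y = peval h (?g y)" using pull by blast
    have "peval h' y \<noteq> 0 \<and> (f \<circ> \<phi>) y = peval g' y / peval h' y" if y: "y \<in> {y \<in> U. \<phi> y \<in> V'}" for y
    proof -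
      have "?g y \<in> \<phi> y - {0}" using y nz in_proj_point[of "?g y"] \<phi> by simp
      moreover have "\<phi> y \<in> V'" using y by simp
      ultimately have "peval h (?g y) \<noteq> 0 \<and> f (\<phi> y) = peval g (?g y) / peval h (?g y)"
        using V'(6) by blast
      then show ?thesis using g' h' by simp
    qed
    then show "\<exists>W g h. openin (subtopology zariski S) W \<and> x \<in> W \<and> W \<subseteq> U \<inter> \<phi> -` V \<and>
        (\<forall>y\<in>W. peval h y \<noteq> 0 \<and> (f \<circ> \<phi>) y = peval g y / peval h y)"
      using pre[OF V'(1)] x V'(2,3)
      by (intro exI[of _ "{y \<in> U. \<phi> y \<in> V'}"] exI[of _ g'] exI[of _ h'] conjI) auto
  qed
  ultimately show ?thesis unfolding morphism_on_def by simp
qed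

text \<open>A polynomial composed with \<open>\<phi>\<close> is a quotient of two forms of equal
  degree, hence a function of the line alone. Its numerator describes the preimage of a basic open
  set, and a quotient of two such functions is again one.\<close>

lemma morphism_from_projective:
  fixes \<phi> :: "'n::finite proj \<Rightarrow> complex ^ 'm::finite" and G H :: "'m \<Rightarrow> 'n cpoly"
  assumes U: "openin proj_zariski U"
    and \<phi>: "\<And>v. v \<noteq> 0 \<Longrightarrow> proj_point v \<in> U \<Longrightarrow> \<phi> (proj_point v) = (quotient_point G H v)"
    and nz: "\<And>v k. v \<noteq> 0 \<Longrightarrow> proj_point v \<in> U \<Longrightarrow> peval (H k) v \<noteq> 0"
    and hom: "\<And>k. homogeneous (e k) (G k)" "\<And>k. homogeneous (e k) (H k)"
    and S: "\<And>L. L \<in> U \<Longrightarrow> \<phi> L \<in> S"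
  shows "morphism_on projective_space_variety U (affine_variety S) \<phi>"
proof -
  have UP: "U \<subseteq> proj_space" using openin_subset[OF U] by simp
  have pull: "\<exists>A C d. homogeneous d A \<and> homogeneous d C \<and> (\<forall>v. v \<noteq> 0 \<longrightarrow> proj_point v \<in> U \<longrightarrow>
      peval C v \<noteq> 0 \<and> peval p (\<phi> (proj_point v)) = peval A v / peval C v)" for p :: "'m cpoly"
  proof -
    obtain A C where AC: "\<And>u. \<forall>i. peval (H i) u \<noteq> 0 \<Longrightarrow> peval C u \<noteq> 0 \<and>
        peval p (quotient_point G H u) = peval A u / peval C u"
      "\<exists>d. homogeneous d A \<and> homogeneous d C"
      using compose_rational[of H p G] hom by blast
    have "peval C v \<noteq> 0 \<and> peval p (\<phi> (proj_point v)) = peval A v / peval C v"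
      if v: "v \<noteq> 0" "proj_point v \<in> U" for v
      using AC(1)[of v] nz[OF v] \<phi>[OF v] by simp
    then show ?thesis using AC(2) by blast
  qed
  have points: "\<exists>v. v \<noteq> 0 \<and> L = proj_point v" if "L \<in> U" for L
    using that UP by (auto simp: proj_space_def)
  have pre: "openin proj_zariski {L \<in> U. \<phi> L \<in> V}" if V: "openin (subtopology zariski S) V" for V :: "(complex ^ 'm) set"
    unfolding openin_proj_zariski
  proof
    fix L assume L: "L \<in> {L \<in> U. \<phi> L \<in> V}"
    then obtain p where p: "peval p (\<phi> L) \<noteq> 0" "{y \<in> S. peval p y \<noteq> 0} \<subseteq> V"
      using V unfolding openin_subtopology_zariski by blast
    obtain A C d where AC: "homogeneous d A" "\<And>v. v \<noteq> 0 \<Longrightarrow> proj_point v \<in> U \<Longrightarrow>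
      peval C v \<noteq> 0 \<and> peval p (\<phi> (proj_point v)) = peval A v / peval C v" using pull[of p] by blast
    obtain r d' where r: "homogeneous d' r" "L \<in> proj_basic r" "proj_basic r \<subseteq> U"
      using U L unfolding openin_proj_zariski by blast
    have basic: "L \<in> proj_basic A \<longleftrightarrow> peval p (\<phi> L) \<noteq> 0" if L: "L \<in> U" for L
    proof -
      obtain v where v: "v \<noteq> 0" "L = proj_point v" using points[OF L] by blast
      then show ?thesis using proj_point_in_basic[OF AC(1) v(1)] AC(2)[OF v(1)] L by auto
    qed
    have "L \<in> proj_basic (A * r)" using basic L p(1) r(2) by (simp add: proj_basic_mult)
    moreover have "proj_basic (A * r) \<subseteq> {L \<in> U. \<phi> L \<in> V}"
      using basic r(3) p(2) S by (auto simp: proj_basic_mult)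
    ultimately show "\<exists>p d. homogeneous d p \<and> L \<in> proj_basic p \<and> proj_basic p \<subseteq> {L \<in> U. \<phi> L \<in> V}"
      using homogeneous_mult[OF AC(1) r(1)] by blast
  qed
  have "continuous_map (subtopology proj_zariski U) (subtopology zariski S) \<phi>"
    unfolding continuous_map_def
  proof (intro conjI allI impI)
    show "\<phi> \<in> topspace (subtopology proj_zariski U) \<rightarrow> topspace (subtopology zariski S)"
      using S by auto
    fix V assume V: "openin (subtopology zariski S) V"
    have top: "topspace (subtopology proj_zariski U) = U" using UP by auto
    show "openin (subtopology proj_zariski U) {x \<in> topspace (subtopology proj_zariski U). \<phi> x \<in> V}"
      unfolding top
      by (rule openin_subtopology[THEN iffD2], rule exI[of _ "{x \<in> U. \<phi> x \<in> V}"])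
        (use pre[OF V] in blast)
  qed
  moreover have "f \<circ> \<phi> \<in> regular_on projective_space_variety (U \<inter> \<phi> -` V)"
    if V: "openin (subtopology zariski S) V" and f: "f \<in> regular_on (affine_variety S) V" for V f
    unfolding regular_on_projective
  proof
    fix L assume L: "L \<in> U \<inter> \<phi> -` V"
    then have "\<phi> L \<in> V" by simp
    from bspec[OF f[unfolded regular_on_affine] this]
    obtain V' g h where V': "openin (subtopology zariski S) V'" "\<phi> L \<in> V'" "V' \<subseteq> V"
      "\<forall>y\<in>V'. peval h y \<noteq> 0 \<and> f y = peval g y / peval h y"
      by (elim exE conjE) (rule that)
    obtain A C d where AC: "homogeneous d A" "homogeneous d C" "\<And>v. v \<noteq> 0 \<Longrightarrow> proj_point v \<in> U \<Longrightarrow>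
      peval C v \<noteq> 0 \<and> peval g (\<phi> (proj_point v)) = peval A v / peval C v" using pull[of g] by blast
    obtain A' C' d' where AC': "homogeneous d' A'" "homogeneous d' C'" "\<And>v. v \<noteq> 0 \<Longrightarrow> proj_point v \<in> U \<Longrightarrow>
      peval C' v \<noteq> 0 \<and> peval h (\<phi> (proj_point v)) = peval A' v / peval C' v" using pull[of h] by blast
    let ?W = "{L \<in> U. \<phi> L \<in> V'}"
    have hom: "homogeneous (d + d') (A * C')" "homogeneous (d + d') (C * A')"
      using AC AC' homogeneous_mult by blast+
    have "peval (C * A') v \<noteq> 0 \<and> (f \<circ> \<phi>) L = peval (A * C') v / peval (C * A') v"
      if L: "L \<in> ?W" and vL: "v \<in> L - {0}" for L v
    proof -
      obtain w where w: "w \<noteq> 0" "L = proj_point w" using points L by blast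
      then obtain c where c: "v = c *s w" "c \<noteq> 0" using vL by (auto simp: proj_point_def)
      then have v: "v \<noteq> 0" "L = proj_point v" using vL proj_point_scale[of c w] w by auto
      have U: "proj_point v \<in> U" using v L by simp
      have "peval h (\<phi> (proj_point v)) \<noteq> 0" "f (\<phi> (proj_point v)) = peval g (\<phi> (proj_point v)) / peval h (\<phi> (proj_point v))"
        using V'(4) L v by auto
      then show ?thesis using AC(3)[OF v(1) U] AC'(3)[OF v(1) U] v(2) by simp
    qed
    moreover have "openin proj_zariski ?W" "L \<in> ?W" "?W \<subseteq> U \<inter> \<phi> -` V"
      using pre[OF V'(1)] L V'(2,3) by auto
    ultimately show "\<exists>W g h d. openin proj_zariski W \<and> L \<in> W \<and> W \<subseteq> U \<inter> \<phi> -` V \<and>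
        homogeneous d g \<and> homogeneous d h \<and>
        (\<forall>L\<in>W. \<forall>v\<in>L - {0}. peval h v \<noteq> 0 \<and> (f \<circ> \<phi>) L = peval g v / peval h v)"
      using hom by blast
  qed
  ultimately show ?thesis unfolding morphism_on_def by simp
qed

section \<open>The logarithmic Gauss map and the Horn-Kapranov map are rational\<close>

definition log_gradient :: "'m::finite cpoly \<Rightarrow> 'm \<Rightarrow> 'm cpoly" where
  "log_gradient \<Delta> i = var_poly i * partial_deriv i \<Delta>"

definition log_gauss_vec :: "'m::finite cpoly \<Rightarrow> complex ^ 'm \<Rightarrow> complex ^ 'm" where
  "log_gauss_vec \<Delta> y = (\<chi> i. peval (log_gradient \<Delta> i) y)"

lemma log_gauss_vec_nth [simp]: "log_gauss_vec \<Delta> y $ i = y $ i * peval (partial_deriv i \<Delta>) y"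
  by (simp add: log_gauss_vec_def log_gradient_def)

lemma log_gauss_eq: "log_gauss \<Delta> y = Some L \<longleftrightarrow>
   y \<in> hypersurface \<Delta> \<and> y \<in> torus \<and> log_gauss_vec \<Delta> y \<noteq> 0 \<and> L = proj_point (log_gauss_vec \<Delta> y)"
proof -
  have "log_gauss_vec \<Delta> y \<noteq> 0 \<longleftrightarrow> (\<exists>i. peval (partial_deriv i \<Delta>) y \<noteq> 0)" if "y \<in> torus"
    using that by (auto simp: vec_eq_iff torus_def)
  moreover have "(\<chi> i. y $ i * peval (partial_deriv i \<Delta>) y) = log_gauss_vec \<Delta> y"
    by (simp add: vec_eq_iff)
  ultimately show ?thesis unfolding log_gauss_def by auto
qed

definition torus_poly :: "'m::finite cpoly" where
  "torus_poly = (\<Prod>i\<in>UNIV. var_poly i)"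

lemma peval_torus_poly: "peval torus_poly y \<noteq> 0 \<longleftrightarrow> y \<in> torus"
  by (simp add: torus_poly_def torus_def)

lemma dom_log_gauss: "dom (log_gauss \<Delta>) = {y \<in> hypersurface \<Delta>. y \<in> torus \<and> log_gauss_vec \<Delta> y \<noteq> 0}"
  unfolding dom_def using log_gauss_eq[of \<Delta>] by blast

lemma openin_dom_log_gauss: "openin (subtopology zariski (hypersurface \<Delta>)) (dom (log_gauss \<Delta>))"
  unfolding openin_subtopology_zariski dom_log_gauss
proof (intro conjI ballI)
  fix y assume "y \<in> {y \<in> hypersurface \<Delta>. y \<in> torus \<and> log_gauss_vec \<Delta> y \<noteq> 0}"
  then obtain i where "peval (torus_poly * log_gradient \<Delta> i) y \<noteq> 0"
    by (auto simp: vec_eq_iff log_gauss_vec_def peval_torus_poly)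
  moreover have "{y \<in> hypersurface \<Delta>. peval (torus_poly * log_gradient \<Delta> i) y \<noteq> 0} \<subseteq>
      {y \<in> hypersurface \<Delta>. y \<in> torus \<and> log_gauss_vec \<Delta> y \<noteq> 0}"
    by (auto simp: vec_eq_iff log_gauss_vec_def peval_torus_poly)
  ultimately show "\<exists>p. peval p y \<noteq> 0 \<and> {y \<in> hypersurface \<Delta>. peval p y \<noteq> 0} \<subseteq>
      {y \<in> hypersurface \<Delta>. y \<in> torus \<and> log_gauss_vec \<Delta> y \<noteq> 0}" by blast
qed auto

text \<open>For a variable i of \<open>\<Delta>\<close>, the partial derivative has smaller degree
  in i, so \<open>\<Delta>\<close> does not divide it and it is nonzero somewhere on S. By
  irreducibility this open condition can be met inside the torus.\<close>

lemma log_gradient_nonzero_point: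
  assumes "irreducible \<Delta>" "hypersurface \<Delta> \<inter> torus \<noteq> {}"
  shows "\<exists>i. \<exists>y\<in>hypersurface \<Delta>. peval (torus_poly * log_gradient \<Delta> i) y \<noteq> 0"
proof -
  obtain i where "degree_in i \<Delta> > 0" using irreducible_nonconstant assms(1) by blast
  then have "\<not> \<Delta> dvd partial_deriv i \<Delta>" by (rule not_dvd_partial_deriv)
  then obtain y2 where y2: "y2 \<in> hypersurface \<Delta>" "peval (partial_deriv i \<Delta>) y2 \<noteq> 0"
    using vanishes_iff_dvd[OF assms(1)] by blast
  obtain y1 where y1: "y1 \<in> hypersurface \<Delta>" "peval torus_poly y1 \<noteq> 0"
    using assms(2) peval_torus_poly by blast
  obtain y where "y \<in> hypersurface \<Delta>" "peval torus_poly y \<noteq> 0" "peval (partial_deriv i \<Delta>) y \<noteq> 0"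
    using hypersurface_generic_point[OF assms(1) y1 y2] by blast
  then show ?thesis by (auto simp: log_gradient_def peval_torus_poly torus_def)
qed

lemma rational_map_log_gauss:
  assumes "irreducible \<Delta>" "hypersurface \<Delta> \<inter> torus \<noteq> {}"
  shows "rational_map (affine_variety (hypersurface \<Delta>)) projective_space_variety (log_gauss \<Delta>)"
  unfolding rational_map_def
proof (intro conjI)
  show "openin (vtop (affine_variety (hypersurface \<Delta>))) (dom (log_gauss \<Delta>))"
    using openin_dom_log_gauss by simp
  obtain i y where "y \<in> hypersurface \<Delta>" "peval (torus_poly * log_gradient \<Delta> i) y \<noteq> 0"
    using log_gradient_nonzero_point[OF assms] by blast
  then have "y \<in> dom (log_gauss \<Delta>)"
    by (auto simp: dom_log_gauss peval_torus_poly vec_eq_iff log_gauss_vec_def)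
  then show "dom (log_gauss \<Delta>) \<noteq> {}" by blast
  show "morphism_on (affine_variety (hypersurface \<Delta>)) (dom (log_gauss \<Delta>)) projective_space_variety (the \<circ> log_gauss \<Delta>)"
  proof (rule morphism_to_projective[OF openin_dom_log_gauss])
    fix y assume "y \<in> dom (log_gauss \<Delta>)"
    then obtain L where L: "log_gauss \<Delta> y = Some L" by blast
    then have "log_gauss_vec \<Delta> y \<noteq> 0" "L = proj_point (log_gauss_vec \<Delta> y)"
      unfolding log_gauss_eq by blast+
    then show "(the \<circ> log_gauss \<Delta>) y = proj_point (\<chi> i. peval (log_gradient \<Delta> i) y)"
      "(\<chi> i. peval (log_gradient \<Delta> i) y) \<noteq> 0"
      unfolding log_gauss_vec_def by (simp_all add: L)
  qed
qed

section \<open>Row forms and the Horn-Kapranov map as a quotient of forms\<close>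

definition row_poly :: "int ^ 'm::finite \<Rightarrow> 'm cpoly" where
  "row_poly c = (\<Sum>k\<in>UNIV. const_poly (of_int (c $ k)) * var_poly k)"

lemma peval_row_poly [simp]: "peval (row_poly c) u = row_form c u"
  by (simp add: row_poly_def row_form_def)

lemma homogeneous_row_poly: "homogeneous 1 (row_poly c)"
proof -
  have "homogeneous (0 + 1) (const_poly (of_int (c $ k)) * var_poly k)" for k
    by (intro homogeneous_mult homogeneous_const homogeneous_var)
  then show ?thesis unfolding row_poly_def by (intro homogeneous_sum) simp
qed

lemma row_poly_nonzero: assumes "c \<noteq> 0" shows "row_poly c \<noteq> 0"
proof -
  obtain k where k: "c $ k \<noteq> 0" using assms by (auto simp: vec_eq_iff)
  have "row_form c (axis k 1) = of_int (c $ k)"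
    unfolding row_form_def by (simp add: axis_def if_distrib cong: if_cong)
  then have "peval (row_poly c) (axis k 1) \<noteq> 0" using k by simp
  then show ?thesis by (rule peval_nonzeroD)
qed

definition rows_poly :: "'m::finite int_matrix \<Rightarrow> 'm cpoly" where
  "rows_poly C = (\<Prod>i<length C. row_poly (C ! i))"

lemma peval_rows_poly: "peval (rows_poly C) u \<noteq> 0 \<longleftrightarrow> (\<forall>c\<in>set C. row_form c u \<noteq> 0)"
  by (auto simp: rows_poly_def all_set_conv_all_nth)

lemma homogeneous_rows_poly: "homogeneous (length C) (rows_poly C)"
  using homogeneous_prod[of "{..<length C}" "\<lambda>i. 1" "\<lambda>i. row_poly (C ! i)"] homogeneous_row_poly
  unfolding rows_poly_def by fastforce

lemma rows_poly_nonzero: "0 \<notin> set C \<Longrightarrow> rows_poly C \<noteq> 0"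
  unfolding rows_poly_def using cpoly_prod_eq_0_iff[of "{..<length C}" "\<lambda>i. row_poly (C ! i)"]
  by (metis finite_lessThan lessThan_iff nth_mem row_poly_nonzero)

text \<open>\<open>nat\<close> cuts exponents off at 0, so this and \<open>hk_den\<close> collect
  the positive and the negative parts of the exponents.\<close>

definition hk_num :: "complex ^ 'm::finite \<Rightarrow> 'm int_matrix \<Rightarrow> 'm \<Rightarrow> 'm cpoly" where
  "hk_num l C k = const_poly (l $ k) * (\<Prod>i<length C. row_poly (C ! i) ^ nat (C ! i $ k))"

definition hk_den :: "'m::finite int_matrix \<Rightarrow> 'm \<Rightarrow> 'm cpoly" where
  "hk_den C k = (\<Prod>i<length C. row_poly (C ! i) ^ nat (- (C ! i $ k)))"

lemma hk_den_nonzero: "peval (rows_poly C) u \<noteq> 0 \<Longrightarrow> peval (hk_den C k) u \<noteq> 0"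
  by (auto simp: rows_poly_def hk_den_def)

lemma scaled_hk_vec_eq:
  assumes "peval (rows_poly C) u \<noteq> 0"
  shows "l * horn_kapranov_vec C u = (quotient_point (hk_num l C) (hk_den C) u)"
proof -
  have "row_form (C ! i) u powi (C ! i $ k) =
      row_form (C ! i) u ^ nat (C ! i $ k) / row_form (C ! i) u ^ nat (- (C ! i $ k))" for i k
    by (simp add: power_int_def field_simps)
  then show ?thesis
    by (simp add: vec_eq_iff horn_kapranov_vec_def hk_num_def hk_den_def prod_dividef)
qed

lemma regular_matrix_column_sum:
  assumes "regular_matrix C" shows "(\<Sum>i<length C. C ! i $ k) = 0"
proof -
  have "(\<Sum>i<length C. C ! i) = 0"
    using assms by (simp add: regular_matrix_def sum_list_sum_nth atLeast0LessThan)
  then show ?thesis by (metis sum_component zero_index)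
qed

text \<open>The column sums vanish, so the positive and the negative parts of a column have the same
  sum.\<close>

lemma homogeneous_hk:
  assumes "regular_matrix C"
  shows "homogeneous (\<Sum>i<length C. nat (C ! i $ k)) (hk_num l C k)"
    "homogeneous (\<Sum>i<length C. nat (C ! i $ k)) (hk_den C k)"
proof -
  have pow: "homogeneous n (row_poly c ^ n)" for n and c :: "int ^ 'a"
    using homogeneous_power[OF homogeneous_row_poly, of n c] by simp
  have "homogeneous (0 + (\<Sum>i<length C. nat (C ! i $ k))) (hk_num l C k)"
    unfolding hk_num_def by (intro homogeneous_mult homogeneous_const homogeneous_prod pow)
  then show "homogeneous (\<Sum>i<length C. nat (C ! i $ k)) (hk_num l C k)" by simp
  have "int (\<Sum>i<length C. nat (C ! i $ k)) - int (\<Sum>i<length C. nat (- (C ! i $ k))) =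
      (\<Sum>i<length C. C ! i $ k)"
    unfolding of_nat_sum sum_subtractf[symmetric] by (intro sum.cong) auto
  then have "(\<Sum>i<length C. nat (C ! i $ k)) = (\<Sum>i<length C. nat (- (C ! i $ k)))"
    using regular_matrix_column_sum[OF assms, of k] by linarith
  then show "homogeneous (\<Sum>i<length C. nat (C ! i $ k)) (hk_den C k)"
    unfolding hk_den_def by (simp only:) (intro homogeneous_prod pow)
qed

lemma dom_horn_kapranov: "dom (horn_kapranov C) = proj_basic (rows_poly C)"
proof -
  have "L \<in> dom (horn_kapranov C) \<longleftrightarrow> L \<in> proj_basic (rows_poly C)" for L
    unfolding horn_kapranov_def proj_basic_def dom_def peval_rows_poly by simp
  then show ?thesis by blast
qed

lemma scaled_horn_kapranov_eq:
  assumes "regular_matrix C" "u \<noteq> 0" "peval (rows_poly C) u \<noteq> 0"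
  shows "scaled_horn_kapranov l C (proj_point u) = Some (l * horn_kapranov_vec C u)"
  using horn_kapranov_proj_point[OF assms(1,2)] assms(3)
  by (simp add: scaled_horn_kapranov_def peval_rows_poly)

lemma dom_scaled_horn_kapranov: "dom (scaled_horn_kapranov l C) = proj_basic (rows_poly C)"
  using dom_horn_kapranov[of C] unfolding scaled_horn_kapranov_def dom_def by simp

lemma exists_generic_nonzero:
  fixes p :: "'m::finite cpoly" assumes "p \<noteq> 0" shows "\<exists>u. u \<noteq> 0 \<and> peval p u \<noteq> 0"
proof -
  \<comment> \<open>\<open>undefined\<close> is just some index: the extra factor forces this
    coordinate, hence u, to be nonzero.\<close>
  have "p * var_poly undefined \<noteq> 0" using assms var_poly_nonzero cpoly_mult_eq_0_iff by blast
  then obtain u where "peval (p * var_poly undefined) u \<noteq> 0" using peval_nonzero by blast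
  then show ?thesis by (intro exI[of _ u]) auto
qed

lemma ran_horn_kapranov:
  assumes C: "regular_matrix C" and x: "x \<in> ran (horn_kapranov C)"
  shows "\<exists>u. peval (rows_poly C) u \<noteq> 0 \<and> x = horn_kapranov_vec C u"
proof -
  obtain L where L: "horn_kapranov C L = Some x" using x by (auto simp: ran_def)
  then have "L \<in> proj_basic (rows_poly C)" using dom_horn_kapranov by blast
  then obtain u where u: "u \<noteq> 0" "L = proj_point u" by (auto simp: proj_basic_def proj_space_def)
  then have "peval (rows_poly C) u \<noteq> 0"
    using \<open>L \<in> proj_basic (rows_poly C)\<close> proj_point_in_basic homogeneous_rows_poly by blast
  then show ?thesis using L u horn_kapranov_proj_point[OF C u(1)] by (auto simp: peval_rows_poly)
qed

lemma horn_kapranov_vec_in_ran: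
  assumes "regular_matrix C" "u \<noteq> 0" "peval (rows_poly C) u \<noteq> 0"
  shows "horn_kapranov_vec C u \<in> ran (horn_kapranov C)"
  using horn_kapranov_proj_point[OF assms(1,2)] assms(3) unfolding peval_rows_poly ran_def by blast

lemma rational_map_scaled_horn_kapranov:
  assumes C: "regular_matrix C" "0 \<notin> set C"
    and S: "\<And>u. peval (rows_poly C) u \<noteq> 0 \<Longrightarrow> l * horn_kapranov_vec C u \<in> S"
  shows "rational_map projective_space_variety (affine_variety S) (scaled_horn_kapranov l C)"
  unfolding rational_map_def dom_scaled_horn_kapranov
proof (intro conjI)
  show "openin (vtop projective_space_variety) (proj_basic (rows_poly C))"
    using openin_proj_basic[OF homogeneous_rows_poly] by simp
  obtain u where "u \<noteq> 0" "peval (rows_poly C) u \<noteq> 0"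
    using exists_generic_nonzero[OF rows_poly_nonzero[OF C(2)]] by blast
  then show "proj_basic (rows_poly C) \<noteq> {}"
    using proj_point_in_basic[OF homogeneous_rows_poly] by blast
  have eq: "(the \<circ> scaled_horn_kapranov l C) (proj_point v) = l * horn_kapranov_vec C v" "peval (rows_poly C) v \<noteq> 0"
    if "v \<noteq> 0" "proj_point v \<in> proj_basic (rows_poly C)" for v
    using that scaled_horn_kapranov_eq[OF C(1), of v l]
      proj_point_in_basic[OF homogeneous_rows_poly, of v C] by simp_all
  show "morphism_on projective_space_variety (proj_basic (rows_poly C)) (affine_variety S) (the \<circ> scaled_horn_kapranov l C)"
  proof (rule morphism_from_projective[where G = "hk_num l C" and H = "hk_den C"])
    show "openin proj_zariski (proj_basic (rows_poly C))"
      by (rule openin_proj_basic[OF homogeneous_rows_poly])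
    show "homogeneous (\<Sum>i<length C. nat (C ! i $ k)) (hk_num l C k)"
      "homogeneous (\<Sum>i<length C. nat (C ! i $ k)) (hk_den C k)" for k
      using homogeneous_hk[OF C(1)] by blast+
    show "(the \<circ> scaled_horn_kapranov l C) (proj_point v) = (quotient_point (hk_num l C) (hk_den C) v)"
      if "v \<noteq> 0" "proj_point v \<in> proj_basic (rows_poly C)" for v
      using eq[OF that] scaled_hk_vec_eq by simp
    show "peval (hk_den C k) v \<noteq> 0" if "v \<noteq> 0" "proj_point v \<in> proj_basic (rows_poly C)" for v k
      using eq[OF that] hk_den_nonzero by blast
    show "(the \<circ> scaled_horn_kapranov l C) L \<in> S" if L: "L \<in> proj_basic (rows_poly C)" for L
    proof -
      obtain v where "v \<noteq> 0" "L = proj_point v" using L by (auto simp: proj_basic_def proj_space_def)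
      then show ?thesis using eq[of v] S L by simp
    qed
  qed
qed

section \<open>The Horn-Kapranov map inverts the logarithmic Gauss map\<close>

lemma DERIV_prod_power_int:
  fixes f :: "'i \<Rightarrow> complex \<Rightarrow> complex"
  assumes "\<And>i. i \<in> A \<Longrightarrow> f i t \<noteq> 0" "\<And>i. i \<in> A \<Longrightarrow> (f i has_field_derivative f' i) (at t)"
  shows "((\<lambda>s. \<Prod>i\<in>A. f i s powi n i) has_field_derivative
    (\<Prod>i\<in>A. f i t powi n i) * (\<Sum>i\<in>A. of_int (n i) * f' i / f i t)) (at t)"
proof -
  have nz: "f i t powi n i \<noteq> 0" if "i \<in> A" for i
    using assms(1)[OF that] by simp
  have d: "((\<lambda>s. f i s powi n i) has_field_derivative of_int (n i) * f i t powi (n i - 1) * f' i) (at t)"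
    if "i \<in> A" for i
    using assms that by (intro DERIV_power_int) auto
  have "of_int (n i) * f i t powi (n i - 1) * f' i / (f i t powi n i) = of_int (n i) * f' i / f i t"
    if "i \<in> A" for i
    using assms(1)[OF that] by (simp add: power_int_diff)
  then have "(\<Sum>i\<in>A. of_int (n i) * f i t powi (n i - 1) * f' i / (f i t powi n i)) =
      (\<Sum>i\<in>A. of_int (n i) * f' i / f i t)"
    by (intro sum.cong) auto
  moreover have "((\<lambda>s. \<Prod>i\<in>A. f i s powi n i) has_field_derivative
      (\<Prod>i\<in>A. f i t powi n i) *
      (\<Sum>i\<in>A. of_int (n i) * f i t powi (n i - 1) * f' i / (f i t powi n i))) (at t)"
    using nz d by (rule has_field_derivative_prod')
  ultimately show ?thesis by simp
qed

lemma row_form_add: "row_form c (u + v) = row_form c u + row_form c v"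
  by (simp add: row_form_def sum.distrib algebra_simps)

lemma row_form_diff: "row_form c (u - v) = row_form c u - row_form c v"
  by (simp add: row_form_def sum_subtractf algebra_simps)

lemma row_form_axis: "row_form c (axis k 1) = of_int (c $ k)"
  unfolding row_form_def by (simp add: axis_def if_distrib cong: if_cong)

text \<open>The k-th entry of M(u) w, that is, the logarithmic derivative of the k-th coordinate of
  \<open>\<psi>\<close> in the direction w.\<close>

definition hk_log_deriv :: "'m::finite int_matrix \<Rightarrow> complex ^ 'm \<Rightarrow> complex ^ 'm \<Rightarrow> 'm \<Rightarrow> complex" where
  "hk_log_deriv C u w k = (\<Sum>i<length C. of_int (C ! i $ k) * row_form (C ! i) w / row_form (C ! i) u)"

lemma hk_log_deriv_linear:
  "hk_log_deriv C u (v - c *s w) k = hk_log_deriv C u v k - c * hk_log_deriv C u w k"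
  unfolding hk_log_deriv_def row_form_diff row_form_scale right_diff_distrib diff_divide_distrib
    sum_subtractf sum_distrib_left
  by (simp only: mult_ac times_divide_eq_right)

lemma DERIV_horn_kapranov:
  assumes "peval (rows_poly C) u \<noteq> 0"
  shows "((\<lambda>t. (l * horn_kapranov_vec C (u + t *s w)) $ k) has_field_derivative
    (l * horn_kapranov_vec C u) $ k * hk_log_deriv C u w k) (at 0)"
proof -
  have nz: "row_form (C ! i) (u + 0 *s w) \<noteq> 0" if "i \<in> {..<length C}" for i
    using assms that by (simp add: peval_rows_poly)
  have d: "((\<lambda>t. row_form (C ! i) (u + t *s w)) has_field_derivative row_form (C ! i) w) (at 0)" for i
    by (auto simp: row_form_add row_form_scale intro!: derivative_eq_intros)
  have "((\<lambda>t. l $ k * (\<Prod>i<length C. row_form (C ! i) (u + t *s w) powi (C ! i $ k))) has_field_derivative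
      l $ k * ((\<Prod>i<length C. row_form (C ! i) (u + 0 *s w) powi (C ! i $ k)) *
        (\<Sum>i<length C. of_int (C ! i $ k) * row_form (C ! i) w / row_form (C ! i) (u + 0 *s w)))) (at 0)"
    by (intro DERIV_cmult DERIV_prod_power_int nz d)
  then show ?thesis by (simp add: horn_kapranov_vec_def hk_log_deriv_def mult.assoc)
qed

text \<open>
  Open subsets of projective space need homogeneous equations, while generic conditions are given by arbitrary
  polynomials. For conditions invariant under scaling this is enough to pass from the latter to the former.
\<close>

lemma homogeneous_component:
  assumes "D \<noteq> 0"
  shows "\<exists>D' d. homogeneous d D' \<and> D' \<noteq> 0 \<and> (\<forall>u. peval D' u \<noteq> 0 \<longrightarrow> (\<exists>t. t \<noteq> 0 \<and> peval D (t *s u) \<noteq> 0))"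
proof -
  define deg where "deg a = (\<Sum>i\<in>UNIV. plookup a i)" for a :: "'a \<Rightarrow>\<^sub>0 nat"
  obtain a0 where a0: "a0 \<in> pkeys D" using assms keys_eq_empty by blast
  let ?A = "{a \<in> pkeys D. deg a = deg a0}"
  define D' where "D' = (\<Sum>a\<in>?A. psingle a (plookup D a))"
  have "homogeneous (deg a0) D'"
    unfolding D'_def by (rule homogeneous_sum) (auto simp: homogeneous_def deg_def)
  moreover have "D' \<noteq> 0"
  proof -
    have "plookup D' a0 = (\<Sum>a\<in>?A. if a = a0 then plookup D a0 else 0)"
      unfolding D'_def lookup_sum by (intro sum.cong) (auto simp: lookup_single when_def)
    then have "plookup D' a0 \<noteq> 0" using a0 by (simp add: in_keys_iff)
    then show ?thesis by auto
  qed
  moreover have "\<exists>t. t \<noteq> 0 \<and> peval D (t *s u) \<noteq> 0" if u: "peval D' u \<noteq> 0" for u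
  proof -
    \<comment> \<open>As a polynomial in t this is D(t u), and its coefficient at the degree of
      \<open>a0\<close> is the value of \<open>D'\<close> at u.\<close>
    define Q where "Q = (\<Sum>a\<in>pkeys D. monom (plookup D a * monomial_value a u) (deg a))"
    have "coeff Q (deg a0) = (\<Sum>a\<in>?A. plookup D a * monomial_value a u)"
      by (simp add: Q_def coeff_sum sum.inter_filter)
    also have "\<dots> = peval D' u" by (simp add: D'_def)
    finally have "Q \<noteq> 0" using u by auto
    then have "Q * [:0, 1:] \<noteq> 0" by simp
    then obtain t where "poly (Q * [:0, 1:]) t \<noteq> 0" using poly_all_0_iff_0 by blast
    then have t: "t \<noteq> 0" "poly Q t \<noteq> 0" by auto
    have "monomial_value a (t *s u) = t ^ deg a * monomial_value a u" for a
      by (simp add: monomial_value_def deg_def power_mult_distrib prod.distrib power_sum)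
    then have "poly Q t = peval D (t *s u)"
      by (simp add: Q_def poly_sum poly_monom peval_superset[OF finite_keys order_refl, of D] mult_ac)
    then show ?thesis using t by auto
  qed
  ultimately show ?thesis by blast
qed

section \<open>A hypersurface presented by a matrix C and a constant l\<close>

locale horn_kapranov_presented =
  fixes \<Delta> :: "'m::finite cpoly" and C :: "'m int_matrix" and l :: "complex ^ 'm"
  assumes irr: "irreducible \<Delta>" and torus: "hypersurface \<Delta> \<inter> torus \<noteq> {}"
    and pres: "horn_kapranov_presentation (hypersurface \<Delta>) C l"
begin

definition \<Psi> :: "complex ^ 'm \<Rightarrow> complex ^ 'm" where
  "\<Psi> u = l * horn_kapranov_vec C u"

abbreviation "B \<equiv> rows_poly C"

lemma C: "regular_matrix C" "0 \<notin> set C" "length C > 0"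
  using pres by (auto simp: horn_kapranov_presentation_def intro: order_less_le_trans[OF zero_less_card_finite])

lemma S_eq: "hypersurface \<Delta> = (\<lambda>y. l * y) ` (zariski closure_of ran (horn_kapranov C))"
  using pres by (simp add: horn_kapranov_presentation_def horn_kapranov_variety_def)

lemma B_nonzero: "B \<noteq> 0"
  using rows_poly_nonzero C by blast

lemma B_0: "peval B u \<noteq> 0 \<Longrightarrow> u \<noteq> 0"
  using C(3) unfolding peval_rows_poly by (auto simp: row_form_def)

lemma \<Psi>_in_S: "peval B u \<noteq> 0 \<Longrightarrow> \<Psi> u \<in> hypersurface \<Delta>"
proof -
  assume u: "peval B u \<noteq> 0"
  then have "horn_kapranov C (proj_point u) = Some (horn_kapranov_vec C u)"
    using horn_kapranov_proj_point C(1) B_0 peval_rows_poly by blast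
  then have "horn_kapranov_vec C u \<in> zariski closure_of ran (horn_kapranov C)"
    using closure_of_subset[of "ran (horn_kapranov C)" zariski] by (auto simp: ran_def)
  then show ?thesis unfolding S_eq \<Psi>_def by blast
qed

lemma \<Psi>_rational: "peval B u \<noteq> 0 \<Longrightarrow> \<Psi> u = (quotient_point (hk_num l C) (hk_den C) u)"
  unfolding \<Psi>_def by (rule scaled_hk_vec_eq)

lemma compose_\<Psi>: "\<exists>A D. \<forall>u. peval B u \<noteq> 0 \<longrightarrow> peval D u \<noteq> 0 \<and> peval f (\<Psi> u) = peval A u / peval D u"
proof -
  obtain A D where "\<And>u. \<forall>i. peval (hk_den C i) u \<noteq> 0 \<Longrightarrow> peval D u \<noteq> 0 \<and>
      peval f (quotient_point (hk_num l C) (hk_den C) u) = peval A u / peval D u"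
    using compose_rational[of "hk_den C" f "hk_num l C"] by blast
  then have "\<forall>u. peval B u \<noteq> 0 \<longrightarrow> peval D u \<noteq> 0 \<and> peval f (\<Psi> u) = peval A u / peval D u"
    by (simp add: hk_den_nonzero \<Psi>_rational)
  then show ?thesis by blast
qed

text \<open>Vanishing for generic u spreads to the whole domain of \<open>\<Psi>\<close>, and from
  the image of \<open>\<psi>\<close> to its closure. So the image stays dense when u is restricted
  to generic points.\<close>

lemma \<Psi>_dense:
  assumes E: "E \<noteq> 0" "\<And>u. peval E u \<noteq> 0 \<Longrightarrow> peval B u \<noteq> 0 \<Longrightarrow> peval f (\<Psi> u) = 0"
  shows "\<forall>y\<in>hypersurface \<Delta>. peval f y = 0"
proof
  fix y assume "y \<in> hypersurface \<Delta>"
  then obtain z where z: "y = l * z" "z \<in> zariski closure_of ran (horn_kapranov C)"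
    unfolding S_eq by blast
  have zero: "peval f (\<Psi> u) = 0" if u: "peval B u \<noteq> 0" for u
    using rational_vanishing_extends[OF E(1) B_nonzero hk_den_nonzero, where f = f and G = "hk_num l C"] E(2) u
    by (simp add: \<Psi>_rational)
  obtain f' where f': "\<And>z. peval f' z = peval f (l * z)" using polyfun_rescale by blast
  have "peval f' x = 0" if x: "x \<in> ran (horn_kapranov C)" for x
    using ran_horn_kapranov[OF C(1) x] zero f' by (auto simp: \<Psi>_def)
  then have "peval f' z = 0" using z(2) unfolding closure_of_zariski by blast
  then show "peval f y = 0" using z(1) f' by simp
qed

lemma \<Psi>_scale: "peval B u \<noteq> 0 \<Longrightarrow> t \<noteq> 0 \<Longrightarrow> peval B (t *s u) \<noteq> 0 \<and> \<Psi> (t *s u) = \<Psi> u"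
  using peval_homogeneous_scale[OF homogeneous_rows_poly, of C t u] horn_kapranov_vec_scale[OF C(1)]
  by (simp add: \<Psi>_def)

text \<open>Differentiating \<open>\<Delta> (\<Psi> u) = 0\<close> along the k-th axis shows that
  the gradient annihilates column k of M(u), which by symmetry is also row k.\<close>

lemma \<Psi>_conormal:
  assumes u: "peval B u \<noteq> 0"
  shows "hk_log_deriv C u (log_gauss_vec \<Delta> (\<Psi> u)) k = 0"
proof -
  let ?g = "log_gauss_vec \<Delta> (\<Psi> u)"
  define w where "w = (axis k 1 :: complex ^ 'm)"
  have "((\<lambda>t. peval \<Delta> (\<Psi> (u + t *s w))) has_field_derivative
      (\<Sum>j\<in>UNIV. peval (partial_deriv j \<Delta>) (\<Psi> (u + 0 *s w)) * (\<Psi> u $ j * hk_log_deriv C u w j))) (at 0)"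
    using DERIV_horn_kapranov[OF u] unfolding \<Psi>_def by (intro DERIV_peval)
  moreover have "eventually (\<lambda>t. peval \<Delta> (\<Psi> (u + t *s w)) = 0) (nhds 0)"
    using eventually_peval_line[OF u, of w]
    by (rule eventually_mono) (use \<Psi>_in_S in \<open>auto simp: hypersurface_def\<close>)
  ultimately have "(\<Sum>j\<in>UNIV. peval (partial_deriv j \<Delta>) (\<Psi> (u + 0 *s w)) * (\<Psi> u $ j * hk_log_deriv C u w j)) = 0"
    by (rule DERIV_eventually_zero)
  then have "(\<Sum>j\<in>UNIV. ?g $ j * hk_log_deriv C u w j) = 0" by (simp add: mult_ac)
  \<comment> \<open>Symmetry of M(u): with l_i the form of row i and g the gradient, both sides are
    the sum over i of l_i(g) l_i(w) / l_i(u), because l_i(w) is the k-th entry of row i.\<close>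
  moreover have "(\<Sum>j\<in>UNIV. ?g $ j * hk_log_deriv C u w j) = hk_log_deriv C u ?g k"
  proof -
    have "(\<Sum>j\<in>UNIV. ?g $ j * hk_log_deriv C u w j) =
        (\<Sum>i<length C. \<Sum>j\<in>UNIV. ?g $ j * (of_int (C ! i $ j) * row_form (C ! i) w / row_form (C ! i) u))"
      unfolding hk_log_deriv_def sum_distrib_left by (rule sum.swap)
    also have "\<dots> = (\<Sum>i<length C. row_form (C ! i) ?g * row_form (C ! i) w / row_form (C ! i) u)"
      by (intro sum.cong refl)
        (simp add: row_form_def[of _ ?g] sum_distrib_left sum_distrib_right sum_divide_distrib mult_ac
          del: log_gauss_vec_nth)
    also have "\<dots> = hk_log_deriv C u ?g k"
      by (simp add: hk_log_deriv_def w_def row_form_axis mult_ac)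
    finally show ?thesis .
  qed
  ultimately show ?thesis by simp
qed

text \<open>Each quotient l_i(u) / l_i(u) is 1, which leaves a column sum of C.\<close>

lemma hk_log_deriv_radial:
  assumes "peval B u \<noteq> 0" shows "hk_log_deriv C u u k = 0"
proof -
  have "hk_log_deriv C u u k = (\<Sum>i<length C. of_int (C ! i $ k))"
    unfolding hk_log_deriv_def using assms by (intro sum.cong) (auto simp: peval_rows_poly)
  also have "\<dots> = of_int (\<Sum>i<length C. C ! i $ k)" by simp
  finally show ?thesis using regular_matrix_column_sum[OF C(1)] by simp
qed

lemma generic_left_inverse:
  "\<exists>D. D \<noteq> 0 \<and> (\<forall>u. peval D u \<noteq> 0 \<longrightarrow> peval B u \<noteq> 0 \<and> \<Psi> u \<in> torus \<and>
    (\<exists>c. c \<noteq> 0 \<and> log_gauss_vec \<Delta> (\<Psi> u) = c *s u))"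
proof -
  fix j :: 'm
  let ?\<Phi> = "\<lambda>u. quotient_point (hk_num l C) (hk_den C) u"
  have "\<exists>E. E \<noteq> 0 \<and> (\<forall>u. peval E u \<noteq> 0 \<longrightarrow> (\<forall>w. w $ j = 0 \<longrightarrow>
      (\<forall>k. ((\<lambda>t. ?\<Phi> (u + t *s w) $ k) has_field_derivative 0) (at 0)) \<longrightarrow> w = 0))"
  proof (rule rational_parametrization_rank[OF irr B_nonzero])
    show "peval (hk_den C k) u \<noteq> 0" if "peval B u \<noteq> 0" for u k using hk_den_nonzero that .
    show "\<forall>y\<in>hypersurface \<Delta>. peval f y = 0"
      if "E \<noteq> 0" "\<And>u. peval E u \<noteq> 0 \<Longrightarrow> peval B u \<noteq> 0 \<Longrightarrow> peval f (?\<Phi> u) = 0" for f E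
      using that \<Psi>_rational by (intro \<Psi>_dense[of E]) auto
    show "peval B (t *s u) \<noteq> 0 \<and> ?\<Phi> (t *s u) = ?\<Phi> u" if "peval B u \<noteq> 0" "t \<noteq> 0" for u t
      using \<Psi>_scale[OF that] \<Psi>_rational[OF that(1)] \<Psi>_rational[of "t *s u"] by simp
  qed
  then obtain E where E: "E \<noteq> 0" "\<And>u w. peval E u \<noteq> 0 \<Longrightarrow> w $ j = 0 \<Longrightarrow>
      \<forall>k. ((\<lambda>t. ?\<Phi> (u + t *s w) $ k) has_field_derivative 0) (at 0) \<Longrightarrow> w = 0" by blast
  obtain i y where y: "y \<in> hypersurface \<Delta>" "peval (torus_poly * log_gradient \<Delta> i) y \<noteq> 0"
    using log_gradient_nonzero_point[OF irr torus] by blast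
  obtain A A' where A: "\<And>u. peval B u \<noteq> 0 \<Longrightarrow>
      peval A' u \<noteq> 0 \<and> peval (torus_poly * log_gradient \<Delta> i) (\<Psi> u) = peval A u / peval A' u"
    using compose_\<Psi> by blast
  have "A \<noteq> 0"
  proof
    assume "A = 0"
    then have "\<forall>y\<in>hypersurface \<Delta>. peval (torus_poly * log_gradient \<Delta> i) y = 0"
      using A by (intro \<Psi>_dense[of 1]) auto
    then show False using y by blast
  qed
  \<comment> \<open>One factor per requirement: E for the rank, B for the domain of
    \<open>\<Psi>\<close>, \<open>var_poly j\<close> for dividing by u $ j, and A for
    \<open>\<Psi> u\<close> to lie in the torus with nonzero logarithmic gradient.\<close>
  define D where "D = E * B * var_poly j * A"
  have "D \<noteq> 0" unfolding D_def using E(1) B_nonzero var_poly_nonzero[of j] \<open>A \<noteq> 0\<close>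
    by (simp add: cpoly_mult_eq_0_iff)
  moreover have "peval B u \<noteq> 0 \<and> \<Psi> u \<in> torus \<and> (\<exists>c. c \<noteq> 0 \<and> log_gauss_vec \<Delta> (\<Psi> u) = c *s u)"
    if D: "peval D u \<noteq> 0" for u
  proof -
    have u: "peval E u \<noteq> 0" "peval B u \<noteq> 0" "u $ j \<noteq> 0" "peval A u \<noteq> 0"
      using D by (auto simp: D_def)
    then have "peval (torus_poly * log_gradient \<Delta> i) (\<Psi> u) \<noteq> 0" using A[of u] by auto
    then have "peval torus_poly (\<Psi> u) \<noteq> 0" and nz: "log_gauss_vec \<Delta> (\<Psi> u) $ i \<noteq> 0"
      by (auto simp: log_gradient_def)
    then have torus: "\<Psi> u \<in> torus" using peval_torus_poly by blast
    let ?g = "log_gauss_vec \<Delta> (\<Psi> u)"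
    \<comment> \<open>This choice makes the j-th coordinate of w vanish. M(u) annihilates the
      gradient and u, hence w, and the rank statement then gives w = 0.\<close>
    define c where "c = ?g $ j / u $ j"
    define w where "w = ?g - c *s u"
    have "w $ j = 0" using u(3) by (simp add: w_def c_def)
    have "hk_log_deriv C u w k = hk_log_deriv C u ?g k - c * hk_log_deriv C u u k" for k
      unfolding w_def by (rule hk_log_deriv_linear)
    then have w0: "hk_log_deriv C u w k = 0" for k
      using \<Psi>_conormal[OF u(2)] hk_log_deriv_radial[OF u(2)] by simp
    have "((\<lambda>t. ?\<Phi> (u + t *s w) $ k) has_field_derivative 0) (at 0)" for k
    proof -
      have "((\<lambda>t. \<Psi> (u + t *s w) $ k) has_field_derivative 0) (at 0)"
        using DERIV_horn_kapranov[OF u(2), of l w k] w0 by (simp add: \<Psi>_def)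
      moreover have "eventually (\<lambda>t. \<Psi> (u + t *s w) $ k = ?\<Phi> (u + t *s w) $ k) (nhds 0)"
        using eventually_peval_line[OF u(2), of w] by (rule eventually_mono) (simp add: \<Psi>_rational)
      ultimately show ?thesis by (rule DERIV_cong_ev[OF refl _ refl, THEN iffD1, rotated])
    qed
    then have "w = 0" using E(2)[OF u(1) \<open>w $ j = 0\<close>] by blast
    then have g: "?g = c *s u" by (simp add: w_def)
    have "c \<noteq> 0" using nz unfolding g by auto
    then show ?thesis using u(2) torus g by blast
  qed
  ultimately show ?thesis by blast
qed

theorem rational_inverse_log_gauss:
  "rational_inverse projective_space_variety (affine_variety (hypersurface \<Delta>))
     (scaled_horn_kapranov l C) (log_gauss \<Delta>)"
proof -
  let ?S = "hypersurface \<Delta>"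
  obtain D where D: "D \<noteq> 0" "\<And>u. peval D u \<noteq> 0 \<Longrightarrow> peval B u \<noteq> 0" "\<And>u. peval D u \<noteq> 0 \<Longrightarrow> \<Psi> u \<in> torus"
    "\<And>u. peval D u \<noteq> 0 \<Longrightarrow> \<exists>c. c \<noteq> 0 \<and> log_gauss_vec \<Delta> (\<Psi> u) = c *s u"
    using generic_left_inverse by blast
  have scaled: "scaled_horn_kapranov l C (proj_point u) = Some (\<Psi> u)" if "peval B u \<noteq> 0" for u
    using scaled_horn_kapranov_eq[OF C(1) B_0[OF that] that] by (simp add: \<Psi>_def)
  have "generically_identity projective_space_variety (log_gauss \<Delta> \<circ>\<^sub>m scaled_horn_kapranov l C)"
  proof -
    \<comment> \<open>Open sets of projective space come from forms, so D is replaced by a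
      homogeneous component. This suffices because the identity depends only on the line, on which
      some vector has D nonzero.\<close>
    obtain D' d where D': "homogeneous d D'" "D' \<noteq> 0" "\<And>u. peval D' u \<noteq> 0 \<Longrightarrow> \<exists>t. t \<noteq> 0 \<and> peval D (t *s u) \<noteq> 0"
      using homogeneous_component[OF D(1)] by blast
    have "(log_gauss \<Delta> \<circ>\<^sub>m scaled_horn_kapranov l C) L = Some L" if L: "L \<in> proj_basic D'" for L
    proof -
      obtain u where u: "u \<noteq> 0" "L = proj_point u" using L by (auto simp: proj_basic_def proj_space_def)
      then obtain t where t: "t \<noteq> 0" "peval D (t *s u) \<noteq> 0"
        using D'(3) L proj_point_in_basic[OF D'(1)] by blast
      define v where "v = t *s u"
      have v: "peval D v \<noteq> 0" "L = proj_point v" using t u proj_point_scale[OF t(1), of u] by (simp_all add: v_def)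
      obtain c where c: "c \<noteq> 0" "log_gauss_vec \<Delta> (\<Psi> v) = c *s v" using D(4) v(1) by blast
      have "v \<noteq> 0" using B_0 D(2) v(1) by blast
      then have "log_gauss \<Delta> (\<Psi> v) = Some (proj_point v)"
        unfolding log_gauss_eq using c \<Psi>_in_S D(2,3)[OF v(1)] proj_point_scale by auto
      then show ?thesis using scaled[OF D(2)[OF v(1)]] v(2) by (simp add: map_comp_def)
    qed
    moreover have "proj_basic D' \<noteq> {}"
      using exists_generic_nonzero[OF D'(2)] proj_point_in_basic[OF D'(1)] by blast
    ultimately show ?thesis
      unfolding generically_identity_def using openin_proj_basic[OF D'(1)] by auto
  qed
  moreover have "generically_identity (affine_variety ?S) (scaled_horn_kapranov l C \<circ>\<^sub>m log_gauss \<Delta>)"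
  proof -
    have pull: "\<exists>q. \<forall>y. peval q y = peval p (log_gauss_vec \<Delta> y)" for p
      using polyfun_compose[of "log_gauss_vec \<Delta>" p] unfolding polyfun_def log_gauss_vec_def by simp blast
    obtain q where q: "\<And>y. peval q y = peval B (log_gauss_vec \<Delta> y)" using pull by blast
    \<comment> \<open>On U the composite is defined: y lies in the torus, and its gradient lies in
      the domain of \<open>\<Psi>\<close>.\<close>
    define U where "U = {y \<in> ?S. peval (torus_poly * q) y \<noteq> 0}"
    have eq: "\<Psi> (log_gauss_vec \<Delta> y) = y" if y: "y \<in> U" for y
    proof -
      \<comment> \<open>With the denominator cleared, the identity to be shown is a polynomial
        equation in y. It holds at \<open>\<Psi> u\<close> for generic u, hence on all of S by
        density.\<close>
      have "peval (hk_num l C k) (log_gauss_vec \<Delta> y) = y $ k * peval (hk_den C k) (log_gauss_vec \<Delta> y)" for k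
      proof -
        obtain n where n: "\<And>y. peval n y = peval (hk_num l C k) (log_gauss_vec \<Delta> y)" using pull by blast
        obtain d where d: "\<And>y. peval d y = peval (hk_den C k) (log_gauss_vec \<Delta> y)" using pull by blast
        have "peval (n - var_poly k * d) (\<Psi> u) = 0" if u: "peval D u \<noteq> 0" for u
        proof -
          obtain c where c: "c \<noteq> 0" "log_gauss_vec \<Delta> (\<Psi> u) = c *s u" using D(4) u by blast
          have "peval B (c *s u) \<noteq> 0" "\<Psi> (c *s u) = \<Psi> u" using \<Psi>_scale D(2)[OF u] c(1) by blast+
          then have "\<Psi> u $ k = peval (hk_num l C k) (c *s u) / peval (hk_den C k) (c *s u)"
            using \<Psi>_rational[of "c *s u"] by (auto simp: vec_eq_iff)
          then show ?thesis using hk_den_nonzero[OF \<open>peval B (c *s u) \<noteq> 0\<close>] n d c(2) by simp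
        qed
        then have "\<forall>y\<in>?S. peval (n - var_poly k * d) y = 0" using D(1) by (intro \<Psi>_dense[of D]) auto
        then show ?thesis using y n d by (auto simp: U_def)
      qed
      moreover have "peval B (log_gauss_vec \<Delta> y) \<noteq> 0" using y q by (simp add: U_def)
      ultimately show ?thesis by (simp add: \<Psi>_rational vec_eq_iff hk_den_nonzero)
    qed
    have "(scaled_horn_kapranov l C \<circ>\<^sub>m log_gauss \<Delta>) y = Some y" if y: "y \<in> U" for y
    proof -
      have B: "peval B (log_gauss_vec \<Delta> y) \<noteq> 0" "y \<in> ?S" "y \<in> torus"
        using y q peval_torus_poly by (auto simp: U_def)
      then have "log_gauss \<Delta> y = Some (proj_point (log_gauss_vec \<Delta> y))"
        unfolding log_gauss_eq using B_0 by blast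
      then show ?thesis using scaled[OF B(1)] eq[OF y] by (simp add: map_comp_def)
    qed
    moreover have "openin (subtopology zariski ?S) U"
      unfolding openin_subtopology_zariski U_def by blast
    moreover have "U \<noteq> {}"
    proof -
      obtain u where u: "peval D u \<noteq> 0" using peval_nonzero D(1) by blast
      then obtain c where c: "c \<noteq> 0" "log_gauss_vec \<Delta> (\<Psi> u) = c *s u" using D(4) by blast
      have "peval torus_poly (\<Psi> u) \<noteq> 0" using D(3)[OF u] peval_torus_poly by blast
      moreover have "peval B (c *s u) \<noteq> 0" using \<Psi>_scale D(2)[OF u] c(1) by blast
      ultimately have "\<Psi> u \<in> U" using \<Psi>_in_S[OF D(2)[OF u]] c(2) q by (simp add: U_def)
      then show ?thesis by blast
    qed
    ultimately show ?thesis unfolding generically_identity_def by auto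
  qed
  moreover have "rational_map projective_space_variety (affine_variety ?S) (scaled_horn_kapranov l C)"
    using C \<Psi>_in_S unfolding \<Psi>_def by (intro rational_map_scaled_horn_kapranov) auto
  moreover have "rational_map (affine_variety ?S) projective_space_variety (log_gauss \<Delta>)"
    using irr torus by (rule rational_map_log_gauss)
  ultimately show ?thesis unfolding rational_inverse_def by blast
qed

end

section \<open>Codimension of a rescaled hypersurface\<close>

lemma split_off_power:
  assumes "irreducible p" "f \<noteq> 0"
  shows "\<exists>n g. f = p ^ n * g \<and> \<not> p dvd (g :: 'm::finite cpoly)"
  using assms(2)
proof (induction "cnorm f" arbitrary: f rule: less_induct)
  case less
  show ?case
  proof (cases "p dvd f")
    case True
    then obtain h where h: "f = p * h" by (elim dvdE)
    have nz: "p \<noteq> 0" "h \<noteq> 0" using less.prems h by auto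
    have "\<not> p dvd 1" using assms(1) by (simp add: irreducible_def)
    then have "cnorm h < cnorm f" using h nz cnorm_mult[of p h] cpoly_unit_iff[of p] by simp
    then obtain n g where "h = p ^ n * g" "\<not> p dvd g" using less.hyps nz(2) by blast
    then show ?thesis using h by (intro exI[of _ "Suc n"] exI[of _ g]) (simp add: mult_ac)
  next
    case False
    then show ?thesis by (intro exI[of _ 0] exI[of _ f]) simp
  qed
qed

text \<open>Rescaling by l is invertible with inverse \<open>l'\<close>, so the claim comes down to
  two open conditions on the hypersurface of \<open>\<Delta>\<close> itself.\<close>

lemma rescaled_hypersurface_irreducible:
  assumes irr: "irreducible \<Delta>" and ne: "hypersurface \<Delta> \<noteq> {}" and l: "\<And>z. l * (l' * z) = z"
  shows "irreducible_closed {z. l * z \<in> hypersurface \<Delta>}" (is "irreducible_closed ?Z")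
  unfolding irreducible_closed_def
proof (intro conjI allI impI)
  obtain \<Delta>' where "\<And>z. peval \<Delta>' z = peval \<Delta> (l * z)" using polyfun_rescale by blast
  then show "closedin zariski ?Z"
    unfolding closedin_zariski by (auto simp: hypersurface_def intro!: exI[of _ \<Delta>'])
  obtain y where "y \<in> hypersurface \<Delta>" using ne by blast
  then have "l' * y \<in> ?Z" using l by simp
  then show "?Z \<noteq> {}" by blast
  fix A B assume AB: "closedin zariski A \<and> closedin zariski B \<and> ?Z \<subseteq> A \<union> B"
  show "?Z \<subseteq> A \<or> ?Z \<subseteq> B"
  proof (rule ccontr)
    assume "\<not> (?Z \<subseteq> A \<or> ?Z \<subseteq> B)"
    then obtain a b where a: "a \<in> ?Z" "a \<notin> A" and b: "b \<in> ?Z" "b \<notin> B" by blast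
    obtain f where f: "peval f a \<noteq> 0" "\<forall>y\<in>A. peval f y = 0"
      using AB a(2) unfolding closedin_zariski by blast
    obtain g where g: "peval g b \<noteq> 0" "\<forall>y\<in>B. peval g y = 0"
      using AB b(2) unfolding closedin_zariski by blast
    obtain f' where f': "\<And>z. peval f' z = peval f (l' * z)" using polyfun_rescale by blast
    obtain g' where g': "\<And>z. peval g' z = peval g (l' * z)" using polyfun_rescale by blast
    have l': "l' * (l * z) = z" for z using l[of z] by (simp add: mult.left_commute)
    obtain y where y: "y \<in> hypersurface \<Delta>" "peval f' y \<noteq> 0" "peval g' y \<noteq> 0"
      using hypersurface_generic_point[OF irr, of "l * a" f' "l * b" g'] a(1) b(1) f(1) g(1) f' g' l'
      by auto
    then have "l' * y \<in> ?Z" using l by simp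
    then have "l' * y \<in> A \<union> B" using AB by blast
    then show False using f(2) g(2) f' g' y by auto
  qed
qed

text \<open>An irreducible closed set strictly above Z is the whole space. Otherwise a nonzero
  polynomial vanishes on it; after rescaling, split off the power of \<open>\<Delta>\<close>,
  leaving g with \<open>\<Delta>\<close> not dividing g. The set is not contained in Z, so g
  vanishes on it, in particular on the hypersurface, a contradiction.\<close>

lemma rescaled_hypersurface_codim:
  assumes irr: "irreducible \<Delta>" and ne: "hypersurface \<Delta> \<noteq> {}" and l: "\<And>z. l * (l' * z) = z"
  shows "codim {z. l * z \<in> hypersurface \<Delta>} \<le> 1" (is "codim ?Z \<le> 1")
proof -
  have Z: "irreducible_closed ?Z" using rescaled_hypersurface_irreducible[OF assms] .
  have "r \<le> 1" if W: "W 0 = ?Z" "\<forall>i\<le>r. irreducible_closed (W i)" "\<forall>i<r. W i \<subset> W (Suc i)" for r and W :: "nat \<Rightarrow> _"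
  proof (rule ccontr)
    assume "\<not> r \<le> 1"
    then have W1: "irreducible_closed (W 1)" "?Z \<subset> W 1" "W 1 \<subset> W (Suc 1)"
      using W(2)[rule_format, of 1] W(3)[rule_format, of 0] W(3)[rule_format, of 1] W(1) by auto
    then obtain x where "x \<notin> W 1" by blast
    then obtain f where f: "peval f x \<noteq> 0" "\<forall>y\<in>W 1. peval f y = 0"
      using W1(1) unfolding irreducible_closed_def closedin_zariski by blast
    obtain f' where f': "\<And>z. peval f' z = peval f (l' * z)" using polyfun_rescale by blast
    have l': "l' * (l * z) = z" for z using l[of z] by (simp add: mult.left_commute)
    have "peval f' (l * x) \<noteq> 0" using f(1) f' l' by simp
    then have "f' \<noteq> 0" by (rule peval_nonzeroD)
    then obtain n g where g: "f' = \<Delta> ^ n * g" "\<not> \<Delta> dvd g" using split_off_power[OF irr] by blast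
    obtain g' where g': "\<And>z. peval g' z = peval g (l * z)" using polyfun_rescale by blast
    have "closedin zariski {z. peval g' z = 0}" unfolding closedin_zariski by auto
    moreover have "W 1 \<subseteq> ?Z \<union> {z. peval g' z = 0}"
    proof
      fix z assume "z \<in> W 1"
      then have "peval f' (l * z) = 0" using f(2) f' l' by simp
      then have "peval \<Delta> (l * z) = 0 \<or> peval g (l * z) = 0" using g(1) by auto
      then show "z \<in> ?Z \<union> {z. peval g' z = 0}" using g' by (auto simp: hypersurface_def)
    qed
    ultimately have "W 1 \<subseteq> ?Z \<or> W 1 \<subseteq> {z. peval g' z = 0}"
      using W1(1) Z unfolding irreducible_closed_def by blast
    then have "?Z \<subseteq> {z. peval g' z = 0}" using W1(2) by blast
    then have "peval g y = 0" if "y \<in> hypersurface \<Delta>" for y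
    proof -
      have "l' * y \<in> ?Z" using that l by simp
      then have "peval g' (l' * y) = 0" using \<open>?Z \<subseteq> _\<close> by blast
      then show ?thesis using g' l by simp
    qed
    then show False using vanishes_iff_dvd[OF irr] g(2) by blast
  qed
  then have "irreducible_codim ?Z \<le> 1"
    unfolding irreducible_codim_def by (intro Sup_least) (auto simp: one_enat_def)
  moreover have "codim ?Z \<le> irreducible_codim ?Z"
    unfolding codim_def by (rule INF_lower) (simp add: Z)
  ultimately show ?thesis by (rule order_trans[rotated])
qed

section \<open>Simultaneous factorization\<close>

text \<open>Between irreducible polynomials divisibility is association, so the members are pairwise
  non-associated.\<close>

definition coprime_irreducibles :: "'m::finite cpoly set \<Rightarrow> bool" where
  "coprime_irreducibles \<F> \<longleftrightarrow> finite \<F> \<and> (\<forall>F\<in>\<F>. irreducible F) \<and> (\<forall>F\<in>\<F>. \<forall>F'\<in>\<F>. F \<noteq> F' \<longrightarrow> \<not> F dvd F')"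

text \<open>The constant c stands for a unit: the units of this ring are the nonzero
  constants.\<close>

definition factors_over :: "'m::finite cpoly set \<Rightarrow> 'm cpoly \<Rightarrow> bool" where
  "factors_over \<F> q \<longleftrightarrow> (\<exists>c e. c \<noteq> 0 \<and> q = const_poly c * (\<Prod>F\<in>\<F>. F ^ e F))"

lemma factors_over_mono:
  assumes "factors_over \<F> q" "\<F> \<subseteq> \<G>" "finite \<G>"
  shows "factors_over \<G> q"
proof -
  obtain c e where c: "c \<noteq> 0" "q = const_poly c * (\<Prod>F\<in>\<F>. F ^ e F)"
    using assms(1) by (auto simp: factors_over_def)
  have "(\<Prod>F\<in>\<F>. F ^ e F) = (\<Prod>F\<in>\<G>. F ^ (if F \<in> \<F> then e F else 0))"
    using assms(2,3) by (intro prod.mono_neutral_cong_left) auto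
  then show ?thesis using c by (auto simp: factors_over_def)
qed

lemma irreducible_dvd_irreducible:
  assumes "irreducible p" "irreducible q" "p dvd (q :: 'm::finite cpoly)"
  shows "\<exists>c. c \<noteq> 0 \<and> q = const_poly c * p"
proof -
  obtain r where r: "q = p * r" using assms(3) by (elim dvdE)
  then have "r dvd 1" using assms(1,2) by (auto simp: irreducible_def)
  then have "r \<noteq> 0" "cnorm r = 0" using cpoly_unit_iff by blast+
  moreover obtain c where c: "r = const_poly c" using cnorm_eq_0[OF \<open>cnorm r = 0\<close>] by blast
  ultimately show ?thesis using r by (intro exI[of _ c]) (auto simp: mult.commute)
qed

text \<open>The family is only enlarged, so that polynomials factored earlier stay factored. An
  irreducible factor associated to a member is written as a constant times that member.\<close>

lemma factors_over_extend:
  assumes "q \<noteq> 0" "coprime_irreducibles \<F>"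
  shows "\<exists>\<G>. coprime_irreducibles \<G> \<and> \<F> \<subseteq> \<G> \<and> factors_over \<G> q"
  using assms
proof (induction "cnorm q" arbitrary: q rule: less_induct)
  case less
  show ?case
  proof (cases "q dvd 1")
    case True
    then obtain c where "q = const_poly c" using cpoly_unit_iff cnorm_eq_0 by blast
    then have "factors_over \<F> q"
      using less.prems unfolding factors_over_def by (intro exI[of _ c] exI[of _ "\<lambda>F. 0"]) auto
    then show ?thesis using less.prems by blast
  next
    case False
    then obtain p r where pr: "irreducible p" "q = p * r" "cnorm r < cnorm q"
      using cpoly_irreducible_factor less.prems by blast
    then have "r \<noteq> 0" using less.prems by auto
    then obtain \<G> where G: "coprime_irreducibles \<G>" "\<F> \<subseteq> \<G>" "factors_over \<G> r"
      using less.hyps[OF pr(3)] less.prems by blast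
    obtain c e where c: "c \<noteq> 0" "r = const_poly c * (\<Prod>F\<in>\<G>. F ^ e F)"
      using G(3) by (auto simp: factors_over_def)
    have fin: "finite \<G>" using G(1) by (simp add: coprime_irreducibles_def)
    show ?thesis
    proof (cases "\<exists>F\<in>\<G>. F dvd p")
      case True
      then obtain F where F: "F \<in> \<G>" "F dvd p" by blast
      then have "irreducible F" using G(1) by (simp add: coprime_irreducibles_def)
      then obtain d where d: "d \<noteq> 0" "p = const_poly d * F"
        using irreducible_dvd_irreducible pr(1) F(2) by blast
      have prod: "(\<Prod>F'\<in>\<G>. F' ^ (if F' = F then Suc (e F') else e F')) = F * (\<Prod>F\<in>\<G>. F ^ e F)"
      proof -
        have "(\<Prod>F'\<in>\<G>. F' ^ (if F' = F then Suc (e F') else e F')) =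
            (\<Prod>F'\<in>\<G>. (if F' = F then F else 1) * F' ^ e F')"
          by (intro prod.cong) auto
        then show ?thesis using F(1) fin by (simp add: prod.distrib)
      qed
      have "q = const_poly (d * c) * (\<Prod>F'\<in>\<G>. F' ^ (if F' = F then Suc (e F') else e F'))"
        unfolding prod by (simp add: pr(2) d c const_poly_mult mult_ac)
      then have "factors_over \<G> q" unfolding factors_over_def using c(1) d(1)
        by (intro exI[of _ "d * c"] exI[of _ "\<lambda>F'. if F' = F then Suc (e F') else e F'"]) simp
      then show ?thesis using G by blast
    next
      case False
      then have "p \<notin> \<G>" by auto
      have "\<not> p dvd F" if "F \<in> \<G>" for F
      proof
        assume "p dvd F"
        have "irreducible F" using that G(1) by (simp add: coprime_irreducibles_def)
        then obtain d where d: "d \<noteq> 0" "F = const_poly d * p"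
          using irreducible_dvd_irreducible[OF pr(1) _ \<open>p dvd F\<close>] by blast
        then have "const_poly (1 / d) * F = const_poly (1 / d * d) * p"
          unfolding const_poly_mult by (simp add: mult.assoc)
        then have "p = F * const_poly (1 / d)" using d(1) by (simp add: mult.commute)
        then have "F dvd p" by simp
        then show False using False that by blast
      qed
      then have "coprime_irreducibles (insert p \<G>)"
        using G(1) False pr(1) by (auto simp: coprime_irreducibles_def)
      moreover have "(\<Prod>F\<in>insert p \<G>. F ^ (if F = p then 1 else e F)) = p * (\<Prod>F\<in>\<G>. F ^ e F)"
        using \<open>p \<notin> \<G>\<close> fin by (simp add: prod.insert) (intro arg_cong2[where f = times] prod.cong, auto)
      then have "factors_over (insert p \<G>) q" unfolding factors_over_def
        using c pr(2) by (intro exI[of _ c] exI[of _ "\<lambda>F. if F = p then 1 else e F"]) (simp add: mult_ac)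
      ultimately show ?thesis using G(2) by blast
    qed
  qed
qed

theorem simultaneous_factorization:
  assumes "finite Q" "0 \<notin> Q"
  shows "\<exists>\<F>. coprime_irreducibles \<F> \<and> (\<forall>q\<in>Q. factors_over \<F> q)"
  using assms
proof (induction Q rule: finite_induct)
  case empty
  then show ?case by (auto simp: coprime_irreducibles_def)
next
  case (insert q Q)
  then obtain \<F> where F: "coprime_irreducibles \<F>" "\<forall>q\<in>Q. factors_over \<F> q" by auto
  then obtain \<G> where G: "coprime_irreducibles \<G>" "\<F> \<subseteq> \<G>" "factors_over \<G> q"
    using factors_over_extend[of q \<F>] insert.prems by auto
  then have "\<forall>q\<in>Q. factors_over \<G> q"
    using F(2) by (auto simp: coprime_irreducibles_def intro: factors_over_mono)
  then show ?case using G by auto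
qed

lemma irreducible_dvd_prod:
  assumes "irreducible p" "finite A" "p dvd (\<Prod>a\<in>A. f a)"
  shows "\<exists>a\<in>A. p dvd (f a :: 'm::finite cpoly)"
  using assms(2,3)
proof (induction A rule: finite_induct)
  case empty
  then show ?case using assms(1) by (simp add: irreducible_def)
next
  case (insert a A)
  then show ?case using cpoly_irreducible_prime[OF assms(1), of "f a" "\<Prod>a\<in>A. f a"] by auto
qed

lemma degree_in_row_poly_le: "degree_in x (row_poly c) \<le> 1"
  unfolding degree_in_le_iff
proof
  fix a assume "a \<in> pkeys (row_poly c)"
  then have "(\<Sum>i\<in>UNIV. plookup a i) = 1" using homogeneous_row_poly[of c] by (simp add: homogeneous_def)
  then show "plookup a x \<le> 1" using member_le_sum[of x UNIV "plookup a"] by simp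
qed

text \<open>A variable x of F has degree 1 in the linear form, so the cofactor h is free of x. By
  homogeneity the leading coefficient in x is constant; h divides it, so h is constant too.\<close>

lemma irreducible_dvd_row_poly:
  assumes F: "irreducible F" "F dvd row_poly c" and c: "c \<noteq> 0"
  shows "\<exists>d. d \<noteq> 0 \<and> F = const_poly d * row_poly c"
proof -
  obtain h where h: "row_poly c = F * h" using F(2) by (elim dvdE)
  have nz: "row_poly c \<noteq> 0" using row_poly_nonzero[OF c] .
  then have "F \<noteq> 0" "h \<noteq> 0" using h by auto
  obtain x where x: "degree_in x F > 0" using irreducible_nonconstant F(1) by blast
  have "degree_in x F + degree_in x h = degree_in x (row_poly c)"
    using degree_in_mult[OF \<open>F \<noteq> 0\<close> \<open>h \<noteq> 0\<close>] h by simp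
  then have d1: "degree_in x (row_poly c) = 1" "degree_in x h = 0"
    using x degree_in_row_poly_le[of x c] by linarith+
  have "lead_in x (row_poly c) \<in> vars_in {}"
    unfolding vars_in_alt
  proof (intro ballI allI impI)
    fix a y assume "a \<in> pkeys (lead_in x (row_poly c))"
    then have "a + psingle x 1 \<in> pkeys (row_poly c)"
      by (simp add: lead_in_def d1 keys_coeff_in)
    then have "(\<Sum>i\<in>UNIV. plookup (a + psingle x 1) i) = 1"
      using homogeneous_row_poly[of c] by (simp add: homogeneous_def)
    moreover have "(\<Sum>i\<in>UNIV. plookup (psingle x (1::nat)) i) = 1"
      by (simp add: lookup_single when_def)
    ultimately have "(\<Sum>i\<in>UNIV. plookup a i) = 0" by (simp add: lookup_add sum.distrib)
    then show "plookup a y = 0" by simp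
  qed
  then have "cnorm (lead_in x (row_poly c)) = 0" by (simp add: cnorm_def vars_in_def)
  moreover have "lead_in x (row_poly c) = lead_in x F * h"
    unfolding h lead_in_mult lead_in_free[OF d1(2)] ..
  moreover have "lead_in x F \<noteq> 0" using lead_in_nonzero \<open>F \<noteq> 0\<close> by blast
  ultimately have "cnorm h = 0" using cnorm_mult[of "lead_in x F" h] \<open>h \<noteq> 0\<close> by simp
  then obtain b where b: "h = const_poly b" using cnorm_eq_0 by blast
  then have "b \<noteq> 0" using \<open>h \<noteq> 0\<close> by auto
  have "const_poly (1 / b) * row_poly c = const_poly (1 / b * b) * F"
    unfolding h b const_poly_mult by (simp add: mult_ac)
  then have "F = const_poly (1 / b) * row_poly c" using \<open>b \<noteq> 0\<close> by simp
  then show ?thesis using \<open>b \<noteq> 0\<close> by (intro exI[of _ "1 / b"]) simp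
qed

section \<open>Parametrizations inverse to the logarithmic Gauss map\<close>

text \<open>Coordinates pulled back along g are fractions near one point L0, and p is nonzero only
  where these fractions and the identity for the Gauss map hold. The last clause is true because, on
  a nonempty open part of S, each y is the value of the fractions at its own gradient.\<close>

lemma inverse_parametrization:
  fixes \<Delta> :: "'m::finite cpoly"
  assumes irr: "irreducible \<Delta>"
    and inv: "rational_inverse (affine_variety (hypersurface \<Delta>)) projective_space_variety (log_gauss \<Delta>) g"
  obtains p G H where "p \<noteq> 0"
    "\<And>v k. peval p v \<noteq> 0 \<Longrightarrow> peval (H k) v \<noteq> 0"
    "\<And>v. peval p v \<noteq> 0 \<Longrightarrow> (quotient_point G H v) \<in> hypersurface \<Delta> \<inter> torus"
    "\<And>v. peval p v \<noteq> 0 \<Longrightarrow> \<exists>c. c \<noteq> 0 \<and> log_gauss_vec \<Delta> (quotient_point G H v) = c *s v"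
    "\<And>f. (\<And>v. peval p v \<noteq> 0 \<Longrightarrow> peval f (quotient_point G H v) = 0) \<Longrightarrow>
      \<forall>y\<in>hypersurface \<Delta>. peval f y = 0"
proof -
  let ?S = "hypersurface \<Delta>"
  obtain U where U: "openin proj_zariski U" "U \<noteq> {}" "\<And>L. L \<in> U \<Longrightarrow> (log_gauss \<Delta> \<circ>\<^sub>m g) L = Some L"
    using inv unfolding rational_inverse_def generically_identity_def by auto
  obtain U' where U': "openin (subtopology zariski ?S) U'" "U' \<noteq> {}" "\<And>y. y \<in> U' \<Longrightarrow> (g \<circ>\<^sub>m log_gauss \<Delta>) y = Some y"
    using inv unfolding rational_inverse_def generically_identity_def by auto
  have mor: "morphism_on projective_space_variety (dom g) (affine_variety ?S) (the \<circ> g)"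
    using inv unfolding rational_inverse_def rational_map_def by blast
  have gU: "\<exists>y. g L = Some y \<and> log_gauss \<Delta> y = Some L" if "L \<in> U" for L
    using U(3)[OF that] by (auto simp: map_comp_Some_iff)
  obtain L0 where L0: "L0 \<in> U" using U(2) by blast
  then obtain y0 where y0: "g L0 = Some y0" "log_gauss \<Delta> y0 = Some L0" using gU by blast
  have S_open: "openin (subtopology zariski ?S) ?S"
    using openin_topspace[of "subtopology zariski ?S"] by simp
  have coord: "(\<lambda>y. y $ k) \<in> regular_on (affine_variety ?S) ?S" for k
    unfolding regular_on_affine
  proof
    fix x assume "x \<in> ?S"
    then show "\<exists>V g h. openin (subtopology zariski ?S) V \<and> x \<in> V \<and> V \<subseteq> ?S \<and>
        (\<forall>y\<in>V. peval h y \<noteq> 0 \<and> y $ k = peval g y / peval h y)"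
      using S_open by (rule_tac exI[of _ ?S], rule_tac exI[of _ "var_poly k"], rule_tac exI[of _ 1]) simp
  qed
  have local: "\<exists>q d G H. homogeneous d q \<and> L0 \<in> proj_basic q \<and>
      (\<forall>L\<in>proj_basic q. \<forall>v\<in>L - {0}. peval H v \<noteq> 0 \<and> the (g L) $ k = peval G v / peval H v)" for k
  proof -
    have "openin (vtop (affine_variety ?S)) ?S" using S_open by simp
    then have reg: "(\<lambda>y. y $ k) \<circ> (the \<circ> g) \<in> regular_on projective_space_variety (dom g \<inter> (the \<circ> g) -` ?S)"
      using mor coord unfolding morphism_on_def by blast
    have "L0 \<in> dom g \<inter> (the \<circ> g) -` ?S" using y0 by (auto simp: log_gauss_eq)
    from bspec[OF reg[unfolded regular_on_projective] this]
    obtain V G H d where V: "openin proj_zariski V" "L0 \<in> V" "V \<subseteq> dom g \<inter> (the \<circ> g) -` ?S"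
      "homogeneous d G" "homogeneous d H"
      "\<forall>L\<in>V. \<forall>v\<in>L - {0}. peval H v \<noteq> 0 \<and> ((\<lambda>y. y $ k) \<circ> (the \<circ> g)) L = peval G v / peval H v"
      by (elim exE conjE) (rule that)
    obtain q e where q: "homogeneous e q" "L0 \<in> proj_basic q" "proj_basic q \<subseteq> V"
      using V(1,2) unfolding openin_proj_zariski by blast
    have "\<forall>L\<in>proj_basic q. \<forall>v\<in>L - {0}. peval H v \<noteq> 0 \<and> the (g L) $ k = peval G v / peval H v"
      using V(6) q(3) by auto
    then show ?thesis using q by blast
  qed
  then obtain q d G H where q: "\<And>k. homogeneous (d k) (q k)" "\<And>k. L0 \<in> proj_basic (q k)"
    "\<And>k L v. L \<in> proj_basic (q k) \<Longrightarrow> v \<in> L - {0} \<Longrightarrow>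
      peval (H k) v \<noteq> 0 \<and> the (g L) $ k = peval (G k) v / peval (H k) v" for k :: 'm
    by metis
  obtain r e where r: "homogeneous e r" "L0 \<in> proj_basic r" "proj_basic r \<subseteq> U"
    using U(1) L0 unfolding openin_proj_zariski by blast
  obtain v0 where v0: "v0 \<noteq> 0" "L0 = proj_point v0" using r(2) by (auto simp: proj_basic_def proj_space_def)
  obtain j where j: "v0 $ j \<noteq> 0" using v0(1) by (auto simp: vec_eq_iff)
  \<comment> \<open>The last factor excludes v = 0, which gives no point of projective space; j is
    such that it does not vanish at v0.\<close>
  define p where "p = r * (\<Prod>k\<in>UNIV. q k) * var_poly j"
  have hp: "homogeneous (e + (\<Sum>k\<in>UNIV. d k) + 1) p"
    unfolding p_def using r(1) q(1) by (intro homogeneous_mult homogeneous_prod homogeneous_var) auto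
  define \<Phi> where "\<Phi> v = (quotient_point G H v)" for v
  have pv: "v \<noteq> 0" "proj_point v \<in> U" "\<And>k. proj_point v \<in> proj_basic (q k)" if "peval p v \<noteq> 0" for v
  proof -
    show v: "v \<noteq> 0" using that by (auto simp: p_def)
    have "peval r v \<noteq> 0" using that by (simp add: p_def)
    then show "proj_point v \<in> U" using proj_point_in_basic[OF r(1) v] r(3) by blast
    have "peval (q k) v \<noteq> 0" for k using that by (simp add: p_def)
    then show "proj_point v \<in> proj_basic (q k)" for k using proj_point_in_basic[OF q(1) v] by blast
  qed
  have H: "peval (H k) v \<noteq> 0" "the (g (proj_point v)) $ k = peval (G k) v / peval (H k) v" if "peval p v \<noteq> 0" for v k
    using q(3)[OF pv(3)[OF that], of v k] pv(1)[OF that] in_proj_point by auto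
  have gv: "g (proj_point v) = Some (\<Phi> v)" if v: "peval p v \<noteq> 0" for v
  proof -
    obtain y where y: "g (proj_point v) = Some y" using gU pv(2)[OF v] by blast
    then have "y = \<Phi> v" using H(2)[OF v] by (simp add: vec_eq_iff \<Phi>_def)
    then show ?thesis using y by simp
  qed
  have lg: "log_gauss \<Delta> (\<Phi> v) = Some (proj_point v)" if "peval p v \<noteq> 0" for v
    using gU[OF pv(2)[OF that]] gv[OF that] by auto
  have p0: "peval p v0 \<noteq> 0"
  proof -
    have "peval r v0 \<noteq> 0" using proj_point_in_basic[OF r(1) v0(1)] r(2) v0(2) by blast
    moreover have "peval (q k) v0 \<noteq> 0" for k using proj_point_in_basic[OF q(1) v0(1)] q(2) v0(2) by blast
    ultimately show ?thesis using j by (simp add: p_def)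
  qed
  show ?thesis
  proof (rule that[of p H G])
    show "p \<noteq> 0" using p0 by (rule peval_nonzeroD)
    show "peval (H k) v \<noteq> 0" if "peval p v \<noteq> 0" for v k using H(1)[OF that] .
    show "(quotient_point G H v) \<in> ?S \<inter> torus" if "peval p v \<noteq> 0" for v
      using lg[OF that] unfolding log_gauss_eq \<Phi>_def by blast
    show "\<exists>c. c \<noteq> 0 \<and> log_gauss_vec \<Delta> (quotient_point G H v) = c *s v" if v: "peval p v \<noteq> 0" for v
    proof -
      have "proj_point (log_gauss_vec \<Delta> (\<Phi> v)) = proj_point v" "log_gauss_vec \<Delta> (\<Phi> v) \<noteq> 0"
        using lg[OF v] unfolding log_gauss_eq by auto
      then obtain c where "c \<noteq> 0" "log_gauss_vec \<Delta> (\<Phi> v) = c *s v" by (rule proj_point_eqD)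
      then show ?thesis unfolding \<Phi>_def by blast
    qed
    fix f assume f: "\<And>v. peval p v \<noteq> 0 \<Longrightarrow> peval f (quotient_point G H v) = 0"
    have "polyfun (\<lambda>y. peval p (log_gauss_vec \<Delta> y))"
      by (rule polyfun_compose) (auto simp: log_gauss_vec_def)
    then obtain p' where p': "\<And>y. peval p' y = peval p (log_gauss_vec \<Delta> y)" by (auto simp: polyfun_def)
    obtain x s where s: "x \<in> ?S" "peval s x \<noteq> 0" "{y\<in>?S. peval s y \<noteq> 0} \<subseteq> U'"
      using U'(1,2) unfolding openin_subtopology_zariski by blast
    \<comment> \<open>Where the other two factors are nonzero, y is the image of its own gradient,
      so f vanishes at y. Neither of these factors is divisible by \<open>\<Delta>\<close>, hence
      \<open>\<Delta>\<close> divides f.\<close>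
    have vanish: "peval (f * (torus_poly * p') * s) y = 0" if y: "y \<in> ?S" for y
    proof (rule ccontr)
      assume nz: "peval (f * (torus_poly * p') * s) y \<noteq> 0"
      then have "y \<in> U'" using s(3) y by auto
      have w: "peval p (log_gauss_vec \<Delta> y) \<noteq> 0" using nz p' by auto
      have "y \<in> torus" using nz peval_torus_poly by auto
      then have "log_gauss \<Delta> y = Some (proj_point (log_gauss_vec \<Delta> y))"
        unfolding log_gauss_eq using y pv(1)[OF w] by blast
      then have "g (proj_point (log_gauss_vec \<Delta> y)) = Some y"
        using U'(3)[OF \<open>y \<in> U'\<close>] by (simp add: map_comp_def)
      then have "y = \<Phi> (log_gauss_vec \<Delta> y)" using gv[OF w] by simp
      then have "peval f y = 0" using f[OF w] unfolding \<Phi>_def[symmetric] by simp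
      then show False using nz by simp
    qed
    have "\<not> \<Delta> dvd s" using vanishes_iff_dvd[OF irr] s(1,2) by blast
    moreover have "\<not> \<Delta> dvd torus_poly * p'"
    proof -
      have 1: "y0 \<in> ?S" "y0 \<in> torus" "log_gauss_vec \<Delta> y0 \<noteq> 0" "proj_point (log_gauss_vec \<Delta> y0) = proj_point v0"
        using y0(2) v0(2) unfolding log_gauss_eq by auto
      then obtain c where c: "c \<noteq> 0" "log_gauss_vec \<Delta> y0 = c *s v0" using proj_point_eqD by blast
      have "peval p' y0 \<noteq> 0" using p0 c by (simp add: p' peval_homogeneous_scale[OF hp])
      moreover have "peval torus_poly y0 \<noteq> 0" using 1(2) peval_torus_poly by blast
      ultimately have "peval (torus_poly * p') y0 \<noteq> 0" by simp
      then show ?thesis using vanishes_iff_dvd[OF irr] 1(1) by blast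
    qed
    moreover have "\<Delta> dvd f * (torus_poly * p') * s" using vanishes_iff_dvd[OF irr] vanish by blast
    ultimately have "\<Delta> dvd f" using cpoly_irreducible_prime[OF irr] by blast
    then show "\<forall>y\<in>?S. peval f y = 0" using vanishes_iff_dvd[OF irr] by blast
  qed
qed

text \<open>
  The appended rows \<open>\<plusminus>e\<^sub>j\<close> only change the sign of \<open>\<psi>\<^sub>C\<close>, but give full rank.
\<close>

definition unit_rows :: "'m::finite list \<Rightarrow> 'm int_matrix" where
  "unit_rows js = concat (map (\<lambda>j. [axis j 1, - axis j 1]) js)"

lemma horn_kapranov_vec_prod_list:
  "horn_kapranov_vec C u $ k = (\<Prod>c\<leftarrow>C. row_form c u powi (c $ k))"
  by (simp add: horn_kapranov_vec_def prod.list_conv_set_nth atLeast0LessThan)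

text \<open>The pair of rows for j contributes u_j / (- u_j) = - 1 to coordinate j and 1 to every
  other coordinate.\<close>

lemma unit_rows_prod:
  assumes "\<And>j. u $ j \<noteq> 0" "distinct js"
  shows "(\<Prod>c\<leftarrow>unit_rows js. row_form c u powi (c $ k)) = (if k \<in> set js then -1 else 1)"
  using assms(2)
proof (induction js)
  case Nil
  then show ?case by (simp add: unit_rows_def)
next
  case (Cons j js)
  have rf: "row_form (axis j 1) u = u $ j" "row_form (- axis j 1) u = - (u $ j)"
    unfolding row_form_def by (simp_all add: axis_def if_distrib[of of_int] if_distrib[of "\<lambda>a. a * _"] sum_negf cong: if_cong)
  have ax: "(axis j 1 :: int ^ 'a) $ k = (if k = j then 1 else 0)" by (simp add: axis_def)
  have two: "row_form (axis j 1) u powi (axis j 1 $ k) * row_form (- axis j 1) u powi ((- axis j 1) $ k) =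
      (if k = j then -1 else 1)"
    unfolding rf vector_uminus_component ax using assms(1)[of j] by (simp add: power_int_minus)
  have "(\<Prod>c\<leftarrow>unit_rows (j # js). row_form c u powi (c $ k)) =
      (row_form (axis j 1) u powi (axis j 1 $ k) * row_form (- axis j 1) u powi ((- axis j 1) $ k)) *
      (\<Prod>c\<leftarrow>unit_rows js. row_form c u powi (c $ k))"
    by (simp add: unit_rows_def mult.assoc)
  then show ?case using Cons unfolding two by auto
qed

lemma sum_list_unit_rows: "sum_list (unit_rows js) = 0"
  by (induction js) (simp_all add: unit_rows_def)

lemma length_unit_rows: "length (unit_rows js) = 2 * length js"
  by (induction js) (simp_all add: unit_rows_def)

lemma set_unit_rows: "set (unit_rows js) = (\<lambda>j. axis j 1) ` set js \<union> (\<lambda>j. - axis j 1) ` set js"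
  by (auto simp: unit_rows_def)

lemma matrix_rank_full:
  assumes "\<And>j :: 'm::finite. axis j 1 \<in> set C"
  shows "matrix_rank C = CARD('m)"
proof -
  let ?X = "(\<lambda>c. (\<chi> k. of_int (c $ k)) :: rat ^ 'm) ` set C"
  have "(axis j 1 :: rat ^ 'm) \<in> ?X" for j
    using assms[of j] by (intro image_eqI[of _ _ "axis j 1"]) (simp_all add: vec_eq_iff axis_def)
  then have "cart_basis \<subseteq> ?X" by (auto simp: cart_basis_def)
  then have "vec.span ?X = (UNIV :: (rat ^ 'm) set)"
    using vec.span_mono[of cart_basis ?X] span_cart_basis by auto
  then have "vec.dim ?X = vec.dim (UNIV :: (rat ^ 'm) set)" by (metis vec.dim_span)
  then show ?thesis unfolding matrix_rank_def vec_dim_card .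
qed

lemma proportional_to_row_poly_deriv:
  assumes "F = const_poly d * row_poly c"
  shows "peval (partial_deriv j F) v = d * of_int (c $ j)"
proof -
  have "((\<lambda>t. peval F (v + t *s axis j 1)) has_field_derivative
      (\<Sum>i\<in>UNIV. peval (partial_deriv i F) (v + 0 *s axis j 1) * axis j 1 $ i)) (at 0)"
    by (rule DERIV_peval_line)
  moreover have "(\<Sum>i\<in>UNIV. peval (partial_deriv i F) (v + 0 *s axis j 1) * axis j 1 $ i) = peval (partial_deriv j F) v"
    by (simp add: axis_def if_distrib cong: if_cong)
  moreover have "((\<lambda>t. peval F (v + t *s axis j 1)) has_field_derivative d * of_int (c $ j)) (at 0)"
    unfolding assms by (auto simp: row_form_add row_form_scale row_form_axis intro!: derivative_eq_intros)
  ultimately show ?thesis using DERIV_unique by metis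
qed

text \<open>
  If \<open>\<Phi>\<^sub>k = \<lambda>\<^sub>k \<Prod>\<^sub>F F\<^bsup>n F k\<^esup>\<close>, then \<open>\<Sum>\<^sub>k v\<^sub>k d\<Phi>\<^sub>k/\<Phi>\<^sub>k = 0\<close> becomes \<open>\<Sum>\<^sub>F l\<^sub>F dF/F = 0\<close> with the linear forms
  \<open>l\<^sub>F(v) = \<Sum>\<^sub>k n F k v\<^sub>k\<close>. Clearing denominators, each \<open>F\<close> divides \<open>l\<^sub>F \<partial>\<^sub>jF\<close>, hence \<open>l\<^sub>F\<close>.
\<close>

theorem logarithmic_parametrization_linear_factors:
  fixes \<Delta> p :: "'m::finite cpoly" and G H :: "'m \<Rightarrow> 'm cpoly"
  defines "\<Phi> \<equiv> \<lambda>v. quotient_point G H v"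
  assumes p: "p \<noteq> 0"
    and H: "\<And>v k. peval p v \<noteq> 0 \<Longrightarrow> peval (H k) v \<noteq> 0"
    and S: "\<And>v. peval p v \<noteq> 0 \<Longrightarrow> \<Phi> v \<in> hypersurface \<Delta> \<inter> torus"
    and gauss: "\<And>v. peval p v \<noteq> 0 \<Longrightarrow> \<exists>c. c \<noteq> 0 \<and> log_gauss_vec \<Delta> (\<Phi> v) = c *s v"
  obtains l C q where "l \<in> torus" "regular_matrix C" "0 \<notin> set C" "q \<noteq> 0"
    "\<And>v. peval q v \<noteq> 0 \<Longrightarrow> peval p v \<noteq> 0 \<and> \<Phi> v = l * horn_kapranov_vec C v"
proof -
  obtain v1 where v1: "peval p v1 \<noteq> 0" using peval_nonzero p by blast
  have G: "peval (G k) v \<noteq> 0" if "peval p v \<noteq> 0" for v k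
    using S[OF that] by (auto simp: torus_def \<Phi>_def)
  have nz: "G k \<noteq> 0" "H k \<noteq> 0" for k
    using peval_nonzeroD[OF G[OF v1]] peval_nonzeroD[OF H[OF v1]] by blast+
  obtain \<F> where F: "coprime_irreducibles \<F>" "\<And>k. factors_over \<F> (G k)" "\<And>k. factors_over \<F> (H k)"
    using simultaneous_factorization[of "range G \<union> range H"] nz by (force simp: image_iff)
  have fin: "finite \<F>" and irrF: "\<And>F. F \<in> \<F> \<Longrightarrow> irreducible F"
    and cop: "\<And>F F'. F \<in> \<F> \<Longrightarrow> F' \<in> \<F> \<Longrightarrow> F \<noteq> F' \<Longrightarrow> \<not> F dvd F'"
    using F(1) by (auto simp: coprime_irreducibles_def)
  obtain cG eG where cG: "\<And>k. cG k \<noteq> 0" "\<And>k. G k = const_poly (cG k) * (\<Prod>F\<in>\<F>. F ^ eG k F)"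
    using F(2) unfolding factors_over_def by metis
  obtain cH eH where cH: "\<And>k. cH k \<noteq> 0" "\<And>k. H k = const_poly (cH k) * (\<Prod>F\<in>\<F>. F ^ eH k F)"
    using F(3) unfolding factors_over_def by metis
  define row where "row F = (\<chi> k. int (eG k F) - int (eH k F))" for F
  \<comment> \<open>Where q is nonzero no F vanishes, so all logarithmic derivatives below are
    defined.\<close>
  define q where "q = p * (\<Prod>F\<in>\<F>. F)"
  have F0: "F \<noteq> 0" if "F \<in> \<F>" for F using irrF[OF that] by (auto simp: irreducible_def)
  then have q0: "q \<noteq> 0" using p fin by (simp add: q_def cpoly_mult_eq_0_iff cpoly_prod_eq_0_iff)
  have qD: "peval p v \<noteq> 0" "\<And>F. F \<in> \<F> \<Longrightarrow> peval F v \<noteq> 0" if "peval q v \<noteq> 0" for v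
    using that fin by (auto simp: q_def)
  have \<Phi>_eq: "\<Phi> v $ k = cG k / cH k * (\<Prod>F\<in>\<F>. peval F v powi (row F $ k))" if "peval q v \<noteq> 0" for v k
  proof -
    have "peval F v powi (row F $ k) = peval F v ^ eG k F / peval F v ^ eH k F" if "F \<in> \<F>" for F
      using qD(2)[OF \<open>peval q v \<noteq> 0\<close> that] by (simp add: row_def power_int_diff)
    then show ?thesis by (simp add: \<Phi>_def cG(2) cH(2) prod_dividef)
  qed
  have sum0: "(\<Sum>F\<in>\<F>. row_form (row F) v * peval (partial_deriv j F) v / peval F v) = 0"
    if v: "peval q v \<noteq> 0" for v j
  proof -
    let ?w = "axis j 1 :: complex ^ 'm"
    let ?D = "\<lambda>k. \<Sum>F\<in>\<F>. of_int (row F $ k) * peval (partial_deriv j F) v / peval F v"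
    have dF: "((\<lambda>t. peval F (v + t *s ?w)) has_field_derivative peval (partial_deriv j F) v) (at 0)" for F
      using DERIV_peval_line[of F v ?w 0] by (simp add: axis_def if_distrib cong: if_cong)
    have "((\<lambda>t. \<Phi> (v + t *s ?w) $ k) has_field_derivative \<Phi> v $ k * ?D k) (at 0)" for k
    proof -
      have nzF: "peval F (v + 0 *s ?w) \<noteq> 0" if "F \<in> \<F>" for F using qD(2)[OF v that] by simp
      have "((\<lambda>t. cG k / cH k * (\<Prod>F\<in>\<F>. peval F (v + t *s ?w) powi (row F $ k))) has_field_derivative
          cG k / cH k * ((\<Prod>F\<in>\<F>. peval F (v + 0 *s ?w) powi (row F $ k)) *
            (\<Sum>F\<in>\<F>. of_int (row F $ k) * peval (partial_deriv j F) v / peval F (v + 0 *s ?w)))) (at 0)"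
        by (intro DERIV_cmult DERIV_prod_power_int nzF dF)
      then have "((\<lambda>t. cG k / cH k * (\<Prod>F\<in>\<F>. peval F (v + t *s ?w) powi (row F $ k))) has_field_derivative
          \<Phi> v $ k * ?D k) (at 0)"
        by (simp add: \<Phi>_eq[OF v] mult.assoc)
      moreover have "eventually (\<lambda>t. cG k / cH k * (\<Prod>F\<in>\<F>. peval F (v + t *s ?w) powi (row F $ k)) = \<Phi> (v + t *s ?w) $ k) (nhds 0)"
        using eventually_peval_line[OF v, of ?w] by (rule eventually_mono) (simp add: \<Phi>_eq)
      ultimately show ?thesis by (rule DERIV_cong_ev[OF refl _ refl, THEN iffD1, rotated])
    qed
    then have "((\<lambda>t. peval \<Delta> (\<Phi> (v + t *s ?w))) has_field_derivative
        (\<Sum>k\<in>UNIV. peval (partial_deriv k \<Delta>) (\<Phi> (v + 0 *s ?w)) * (\<Phi> v $ k * ?D k))) (at 0)"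
      by (rule DERIV_peval)
    moreover have "eventually (\<lambda>t. peval \<Delta> (\<Phi> (v + t *s ?w)) = 0) (nhds 0)"
      using eventually_peval_line[OF v, of ?w]
      by (rule eventually_mono) (use S qD(1) in \<open>auto simp: hypersurface_def\<close>)
    ultimately have "(\<Sum>k\<in>UNIV. peval (partial_deriv k \<Delta>) (\<Phi> (v + 0 *s ?w)) * (\<Phi> v $ k * ?D k)) = 0"
      by (rule DERIV_eventually_zero)
    then have "(\<Sum>k\<in>UNIV. log_gauss_vec \<Delta> (\<Phi> v) $ k * ?D k) = 0" by (simp add: mult_ac)
    moreover obtain c where c: "c \<noteq> 0" "log_gauss_vec \<Delta> (\<Phi> v) = c *s v" using gauss[OF qD(1)[OF v]] by blast
    ultimately have "c * (\<Sum>k\<in>UNIV. v $ k * ?D k) = 0"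
      unfolding c(2) by (simp add: sum_distrib_left mult.assoc)
    then have "(\<Sum>k\<in>UNIV. v $ k * ?D k) = 0" using c(1) by simp
    also have "(\<Sum>k\<in>UNIV. v $ k * ?D k) =
        (\<Sum>F\<in>\<F>. \<Sum>k\<in>UNIV. v $ k * (of_int (row F $ k) * peval (partial_deriv j F) v / peval F v))"
      unfolding sum_distrib_left by (rule sum.swap)
    also have "\<dots> = (\<Sum>F\<in>\<F>. row_form (row F) v * peval (partial_deriv j F) v / peval F v)"
      by (intro sum.cong refl) (simp add: row_form_def sum_distrib_left sum_distrib_right sum_divide_distrib mult_ac)
    finally show ?thesis .
  qed
  have linear: "F dvd row_poly (row F)" if FF: "F \<in> \<F>" for F
  proof -
    obtain j where j: "degree_in j F > 0" using irreducible_nonconstant irrF[OF FF] by blast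
    \<comment> \<open>The summand of \<open>F'\<close> multiplied by the product of all factors: F
      divides each of these terms except possibly its own.\<close>
    let ?T = "\<lambda>F'. row_poly (row F') * partial_deriv j F' * (\<Prod>F''\<in>\<F> - {F'}. F'')"
    have "peval (q * (\<Sum>F'\<in>\<F>. ?T F')) v = 0" for v
    proof (cases "peval q v = 0")
      case False
      have "peval (?T F') v = row_form (row F') v * peval (partial_deriv j F') v / peval F' v * (\<Prod>F\<in>\<F>. peval F v)"
        if "F' \<in> \<F>" for F'
        using qD(2)[OF False that] fin that by (simp add: prod.remove[of \<F> F'])
      then have "peval (\<Sum>F'\<in>\<F>. ?T F') v =
          (\<Sum>F'\<in>\<F>. row_form (row F') v * peval (partial_deriv j F') v / peval F' v) * (\<Prod>F\<in>\<F>. peval F v)"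
        by (simp add: sum_distrib_right)
      then show ?thesis using sum0[OF False] by simp
    qed simp
    then have "q * (\<Sum>F'\<in>\<F>. ?T F') = 0" using peval_nonzero by blast
    then have "(\<Sum>F'\<in>\<F>. ?T F') = 0" using q0 cpoly_mult_eq_0_iff by blast
    then have "?T F = - (\<Sum>F'\<in>\<F> - {F}. ?T F')"
      using fin FF by (simp add: sum.remove[of \<F> F] eq_neg_iff_add_eq_0)
    moreover have "F dvd (\<Sum>F'\<in>\<F> - {F}. ?T F')"
      using fin FF by (intro dvd_sum dvd_mult dvd_prodI) auto
    ultimately have "F dvd ?T F" by simp
    moreover have "\<not> F dvd (\<Prod>F''\<in>\<F> - {F}. F'')"
      using irreducible_dvd_prod[OF irrF[OF FF], of "\<F> - {F}" "\<lambda>F. F"] fin cop[OF FF] by auto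
    moreover have "\<not> F dvd partial_deriv j F" using j by (rule not_dvd_partial_deriv)
    ultimately show ?thesis using cpoly_irreducible_prime[OF irrF[OF FF]] by blast
  qed
  \<comment> \<open>Factors with zero row cancel from \<open>\<Phi>\<close>; the others are linear
    forms up to constants.\<close>
  define \<G> where "\<G> = {F \<in> \<F>. row F \<noteq> 0}"
  have "\<forall>F\<in>\<G>. \<exists>d. d \<noteq> 0 \<and> F = const_poly d * row_poly (row F)"
  proof
    fix F assume "F \<in> \<G>"
    then show "\<exists>d. d \<noteq> 0 \<and> F = const_poly d * row_poly (row F)"
      using irreducible_dvd_row_poly[OF irrF linear] by (simp add: \<G>_def)
  qed
  from bchoice[OF this]
  obtain d where d: "\<And>F. F \<in> \<G> \<Longrightarrow> d F \<noteq> 0" "\<And>F. F \<in> \<G> \<Longrightarrow> F = const_poly (d F) * row_poly (row F)"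
    by blast
  have GF: "\<G> \<subseteq> \<F>" "finite \<G>" using fin by (auto simp: \<G>_def)
  have pF: "peval F v = d F * row_form (row F) v" if "F \<in> \<G>" for F v
    using arg_cong[OF d(2)[OF that], of "\<lambda>p. peval p v"] by simp
  obtain xs where xs: "set xs = \<G>" "distinct xs" using finite_distinct_list[OF GF(2)] by blast
  define C where "C = map row xs"
  \<comment> \<open>Each F in \<open>\<G>\<close> is \<open>d F\<close> times its row form, and the
    powers of the constants \<open>d F\<close> move into l.\<close>
  define l where "l = (\<chi> k. cG k / cH k * (\<Prod>F\<in>\<G>. d F powi (row F $ k)))"
  show ?thesis
  proof (rule that[of l C q])
    show "l \<in> torus" using cG(1) cH(1) d(1) GF(2) by (simp add: torus_def l_def)
    show "0 \<notin> set C" by (auto simp: C_def xs(1) \<G>_def)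
    show "q \<noteq> 0" by (rule q0)
    obtain v where v: "peval q v \<noteq> 0" using peval_nonzero q0 by blast
    \<comment> \<open>For a linear form F the term \<open>l_F \<partial>_j F / F\<close> is the
      constant \<open>row F $ j\<close>, so the vanishing sum of these terms is a column
      sum.\<close>
    have "(\<Sum>F\<in>\<G>. row F) $ j = 0" for j
    proof -
      have "(\<Sum>F\<in>\<F>. row_form (row F) v * peval (partial_deriv j F) v / peval F v) =
          (\<Sum>F\<in>\<G>. of_int (row F $ j))"
      proof (rule sum.mono_neutral_cong_right[OF fin GF(1)])
        show "\<forall>F\<in>\<F> - \<G>. row_form (row F) v * peval (partial_deriv j F) v / peval F v = 0"
          by (auto simp: \<G>_def row_form_def)
        fix F assume FG: "F \<in> \<G>"
        have "peval (partial_deriv j F) v = d F * of_int (row F $ j)"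
          using d(2)[OF FG] by (rule proportional_to_row_poly_deriv)
        moreover have "d F * row_form (row F) v \<noteq> 0" using qD(2)[OF v, of F] FG GF(1) pF by auto
        ultimately show "row_form (row F) v * peval (partial_deriv j F) v / peval F v = of_int (row F $ j)"
          using pF[OF FG, of v] by simp
      qed
      then have "(\<Sum>F\<in>\<G>. of_int (row F $ j)) = (0 :: complex)" using sum0[OF v] by simp
      then have "of_int (\<Sum>F\<in>\<G>. row F $ j) = (0 :: complex)" by simp
      then show ?thesis by (simp only: of_int_eq_0_iff sum_component)
    qed
    then have "(\<Sum>F\<in>\<G>. row F) = 0" by (simp add: vec_eq_iff)
    then show "regular_matrix C"
      using xs by (simp add: regular_matrix_def C_def sum_list_distinct_conv_sum_set)
    show "peval p v \<noteq> 0 \<and> \<Phi> v = l * horn_kapranov_vec C v" if v: "peval q v \<noteq> 0" for v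
    proof
      show "peval p v \<noteq> 0" by (rule qD(1)[OF v])
      have "\<Phi> v $ k = (l * horn_kapranov_vec C v) $ k" for k
      proof -
        have "(\<Prod>F\<in>\<F>. peval F v powi (row F $ k)) = (\<Prod>F\<in>\<G>. d F powi (row F $ k) * row_form (row F) v powi (row F $ k))"
          using fin GF(1) by (intro prod.mono_neutral_cong_right)
            (auto simp: \<G>_def[symmetric] pF power_int_mult_distrib, auto simp: \<G>_def)
        moreover have "horn_kapranov_vec C v $ k = (\<Prod>F\<in>\<G>. row_form (row F) v powi (row F $ k))"
          unfolding horn_kapranov_vec_prod_list C_def using xs
          by (simp add: comp_def prod.distinct_set_conv_list[symmetric])
        ultimately show ?thesis using \<Phi>_eq[OF v, of k] by (simp add: l_def prod.distrib mult.assoc)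
      qed
      then show "\<Phi> v = l * horn_kapranov_vec C v" by (simp add: vec_eq_iff)
    qed
  qed
qed

theorem birational_log_gauss_presentation:
  fixes \<Delta> :: "'m::finite cpoly"
  assumes irr: "irreducible \<Delta>" and ne: "hypersurface \<Delta> \<noteq> {}"
    and inv: "rational_inverse (affine_variety (hypersurface \<Delta>)) projective_space_variety (log_gauss \<Delta>) g"
  shows "\<exists>C l. horn_kapranov_presentation (hypersurface \<Delta>) C l"
proof (rule inverse_parametrization[OF irr inv])
  let ?S = "hypersurface \<Delta>"
  fix p :: "'m cpoly" and G H :: "'m \<Rightarrow> 'm cpoly"
  assume p: "p \<noteq> 0" and H: "\<And>v k. peval p v \<noteq> 0 \<Longrightarrow> peval (H k) v \<noteq> 0"
    and S: "\<And>v. peval p v \<noteq> 0 \<Longrightarrow> (quotient_point G H v) \<in> ?S \<inter> torus"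
    and gauss: "\<And>v. peval p v \<noteq> 0 \<Longrightarrow> \<exists>c. c \<noteq> 0 \<and> log_gauss_vec \<Delta> (quotient_point G H v) = c *s v"
    and dense: "\<And>f. (\<And>v. peval p v \<noteq> 0 \<Longrightarrow> peval f (quotient_point G H v) = 0) \<Longrightarrow>
      \<forall>y\<in>?S. peval f y = 0"
  define \<Phi> where "\<Phi> v = (quotient_point G H v)" for v
  obtain l0 C0 q0 where l0: "l0 \<in> torus" and C0: "regular_matrix C0" "0 \<notin> set C0" and q0: "q0 \<noteq> 0"
    "\<And>v. peval q0 v \<noteq> 0 \<Longrightarrow> peval p v \<noteq> 0 \<and> \<Phi> v = l0 * horn_kapranov_vec C0 v"
    by (rule logarithmic_parametrization_linear_factors[OF p H S gauss, folded \<Phi>_def])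
      (assumption+, rule that)
  obtain js :: "'m list" where js: "set js = UNIV" "distinct js" using finite_distinct_list[OF finite[of "UNIV :: 'm set"]] by blast
  \<comment> \<open>A pair of rows for every index gives at least m rows and full rank. Every
    coordinate of \<open>\<psi>\<close> changes sign, whence l = - l0.\<close>
  define C where "C = C0 @ unit_rows js"
  define l where "l = - l0"
  have C: "regular_matrix C" "0 \<notin> set C"
    using C0 by (auto simp: C_def regular_matrix_def sum_list_unit_rows set_unit_rows axis_eq_0_iff)
  define l' where "l' = (\<chi> k. inverse (l $ k))"
  have l: "l \<in> torus" using l0 by (simp add: l_def torus_def)
  then have ll': "l * (l' * z) = z" "l' * (l * z) = z" for z
    by (simp_all add: vec_eq_iff l'_def torus_def)
  define B where "B = rows_poly C"
  define q where "q = q0 * torus_poly * B"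
  have B0: "B \<noteq> 0" unfolding B_def using rows_poly_nonzero C(2) .
  have "torus_poly \<noteq> (0 :: 'm cpoly)"
    by (rule peval_nonzeroD[of _ "vec 1"]) (simp add: torus_poly_def)
  then have qnz: "q \<noteq> 0" using q0(1) B0 by (simp add: q_def cpoly_mult_eq_0_iff)
  have q: "peval p v \<noteq> 0" "peval B v \<noteq> 0" "v \<noteq> 0" "\<Phi> v = l * horn_kapranov_vec C v"
    if v: "peval q v \<noteq> 0" for v
  proof -
    have nz: "peval q0 v \<noteq> 0" "peval torus_poly v \<noteq> 0" "peval B v \<noteq> 0" using v by (auto simp: q_def)
    show "peval p v \<noteq> 0" "peval B v \<noteq> 0" using q0(2) nz by auto
    have vj: "v $ j \<noteq> 0" for j using nz(2) peval_torus_poly by (auto simp: torus_def)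
    then show "v \<noteq> 0" by (metis zero_index)
    have "horn_kapranov_vec C v $ k = - horn_kapranov_vec C0 v $ k" for k
      using unit_rows_prod[OF vj js(2), of k] js(1) unfolding horn_kapranov_vec_prod_list C_def by simp
    then show "\<Phi> v = l * horn_kapranov_vec C v" using q0(2)[OF nz(1)] by (simp add: vec_eq_iff l_def)
  qed
  \<comment> \<open>\<open>\<Phi>\<close> and \<open>l \<psi>\<close> agree where q is nonzero. For
    one inclusion the equation of S extends from there to the domain of \<open>\<psi>\<close>; for
    the other, an equation of the image of \<open>\<psi>\<close> extends to the domain of
    \<open>\<Phi>\<close>, whose image is dense in S.\<close>
  have var: "horn_kapranov_variety C = {z. l * z \<in> ?S}"
  proof (intro set_eqI iffI)
    fix z assume z: "z \<in> horn_kapranov_variety C"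
    obtain f where f: "\<And>z. peval f z = peval \<Delta> (l * z)" using polyfun_rescale by blast
    have "peval f x = 0" if x: "x \<in> ran (horn_kapranov C)" for x
    proof -
      obtain u where u: "peval B u \<noteq> 0" "x = horn_kapranov_vec C u"
        using ran_horn_kapranov[OF C(1) x] unfolding B_def by blast
      have "peval \<Delta> (quotient_point (hk_num l C) (hk_den C) u) = 0"
      proof (rule rational_vanishing_extends[OF qnz B0 _ _ u(1)])
        show "peval (hk_den C k) v \<noteq> 0" if "peval B v \<noteq> 0" for v k
          using hk_den_nonzero that unfolding B_def .
        fix v assume v: "peval q v \<noteq> 0" "peval B v \<noteq> 0"
        have "\<Phi> v \<in> ?S" using S[OF q(1)[OF v(1)]] unfolding \<Phi>_def by blast
        then show "peval \<Delta> (quotient_point (hk_num l C) (hk_den C) v) = 0"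
          using q(4)[OF v(1)] scaled_hk_vec_eq[of C v l] v(2) by (simp add: B_def hypersurface_def)
      qed
      then show ?thesis using u f scaled_hk_vec_eq[of C u l] by (simp add: B_def)
    qed
    then have "peval f z = 0"
      using z unfolding horn_kapranov_variety_def closure_of_zariski by blast
    then show "z \<in> {z. l * z \<in> ?S}" using f by (simp add: hypersurface_def)
  next
    fix z assume z: "z \<in> {z. l * z \<in> ?S}"
    show "z \<in> horn_kapranov_variety C"
      unfolding horn_kapranov_variety_def closure_of_zariski mem_Collect_eq
    proof (intro allI impI)
      fix f assume f: "\<forall>y\<in>ran (horn_kapranov C). peval f y = 0"
      obtain f' where f': "\<And>z. peval f' z = peval f (l' * z)" using polyfun_rescale by blast
      have "\<forall>y\<in>?S. peval f' y = 0"
      proof (rule dense)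
        fix v assume v: "peval p v \<noteq> 0"
        show "peval f' (quotient_point G H v) = 0"
        proof (rule rational_vanishing_extends[OF qnz p H _ v])
          fix u assume u: "peval q u \<noteq> 0"
          have "horn_kapranov_vec C u \<in> ran (horn_kapranov C)"
            using horn_kapranov_vec_in_ran[OF C(1) q(3)[OF u]] q(2)[OF u] unfolding B_def by blast
          then have "peval f' (\<Phi> u) = 0" using f f' q(4)[OF u] ll' by simp
          then show "peval f' (quotient_point G H u) = 0" unfolding \<Phi>_def .
        qed
      qed
      then have "peval f' (l * z) = 0" using z by blast
      then show "peval f z = 0" using f' ll' by simp
    qed
  qed
  have "codim (horn_kapranov_variety C) \<le> 1"
    unfolding var using rescaled_hypersurface_codim[OF irr ne ll'(1)] .
  then have "\<not> defective C" unfolding defective_def by (simp add: not_less)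
  moreover have "length C \<ge> CARD('m)"
    using js by (simp add: C_def length_unit_rows distinct_card[symmetric])
  moreover have "matrix_rank C = CARD('m)"
    by (rule matrix_rank_full) (simp add: C_def set_unit_rows js(1))
  moreover have "?S = (\<lambda>y. l * y) ` horn_kapranov_variety C"
  proof (intro set_eqI iffI)
    fix y assume "y \<in> ?S"
    then have "l' * y \<in> horn_kapranov_variety C" unfolding var by (simp add: ll')
    then show "y \<in> (\<lambda>y. l * y) ` horn_kapranov_variety C" using ll'(1)[of y] by (metis image_eqI)
  qed (auto simp: var)
  ultimately have "horn_kapranov_presentation ?S C l"
    using C l unfolding horn_kapranov_presentation_def by blast
  then show ?thesis by blast
qed

theorem theorem2p5:
  fixes S :: "(complex ^ 'm::finite) set" and \<Delta> :: "'m cpoly"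
  assumes "irreducible \<Delta>" and "S = hypersurface \<Delta>" and "S \<inter> torus \<noteq> {}"
  shows "(birational (affine_variety S) projective_space_variety (log_gauss \<Delta>) \<longleftrightarrow>
           (\<exists>C l. horn_kapranov_presentation S C l)) \<and>
         (\<forall>C l. horn_kapranov_presentation S C l \<longrightarrow>
           birational projective_space_variety (affine_variety S) (scaled_horn_kapranov l C) \<and>
           rational_inverse projective_space_variety (affine_variety S)
             (scaled_horn_kapranov l C) (log_gauss \<Delta>))"
proof -
  have inverse: "rational_inverse projective_space_variety (affine_variety S)
      (scaled_horn_kapranov l C) (log_gauss \<Delta>)" if "horn_kapranov_presentation S C l" for C l
  proof -
    interpret horn_kapranov_presented \<Delta> C l
      using assms that by unfold_locales simp_all
    show ?thesis using rational_inverse_log_gauss assms(2) by simp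
  qed
  have "birational (affine_variety S) projective_space_variety (log_gauss \<Delta>) \<longleftrightarrow>
      (\<exists>C l. horn_kapranov_presentation S C l)"
  proof
    assume "birational (affine_variety S) projective_space_variety (log_gauss \<Delta>)"
    then show "\<exists>C l. horn_kapranov_presentation S C l"
      using birational_log_gauss_presentation[OF assms(1)] assms(2,3) unfolding birational_def by blast
  next
    assume "\<exists>C l. horn_kapranov_presentation S C l"
    then show "birational (affine_variety S) projective_space_variety (log_gauss \<Delta>)"
      using inverse unfolding birational_def rational_inverse_def by blast
  qed
  then show ?thesis using inverse unfolding birational_def by blast
qed

end
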